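(* Let $(\xi_{n,m})_{n,m\in\mathbb Z}$ be a stationary random field of real random variables, let $f$ be a measurable function, and let $X_{n,m}=f(\xi_{i,j},\ i\le n,\ j\le m)$ for $n,m\in\mathbb Z$, with $X_{0,0}$ integrable. Let $\mathcal F_{n,m}=\sigma(\xi_{i,j},\ i\le n,\ j\le m)$ and $S_{j,k}=\sum_{u=1}^{j}\sum_{v=1}^{k}X_{u,v}$. Assume that the filtration is commuting, i.e. for all integers $a\ge u$, all integers $b,v$ and every integrable random variable $X$, $$E(E(X|\mathcal F_{a,b})|\mathcal F_{u,v})=E(X|\mathcal F_{u,b\wedge v})\quad\text{a.s.}$$ Assume that $$\sum_{j,k\ge1}\frac{1}{j^{3/2}k^{3/2}}\|E(S_{j,k}|\mathcal F_{1,1})\|<\infty ,$$ and that the vertical shift $T$ is ergodic. Then there is a constant $c$ such that $$\frac{1}{n_1n_2}E(S_{n_1,n_2}^2)\to c^2\quad\text{as }\min(n_1,n_2)\to\infty$$ and $$\frac{1}{\sqrt{n_1n_2}}S_{n_1,n_2}\Rightarrow N(0,c^2)\quad\text{as }\min(n_1,n_2)\to\infty .$$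
   Context: $\|\cdot\|$ is the norm in $L^2$; $\Rightarrow$ denotes convergence in distribution; $a\wedge b=\min(a,b)$. The notation $X_{n,m}=f(\xi_{i,j},\ i\le n,\ j\le m)$ means that the same measurable function $f$ is applied to the translated field, $X_{n,m}=f\big((\xi_{n-i,m-j})_{i,j\ge0}\big)$, so that $(X_{n,m})$ is stationary and $X_{n,m}$ is $\mathcal F_{n,m}$-measurable. The vertical shift $T$ is the shift by one unit in the first index, acting on realizations of the field $\xi$ by $(Tx)_{i,j}=x_{i+1,j}$; it preserves the law of $\xi$ by stationarity, and ergodicity of $T$ means that every $T$-invariant event has probability $0$ or $1$ under the law of $\xi$. $N(0,0)$ is the point mass at $0$. *)

theory Defs
  imports "HOL-Probability.Probability"
begin

abbreviation field_space :: "(int \<times> int \<Rightarrow> real) measure" where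
  "field_space \<equiv> Pi\<^sub>M UNIV (\<lambda>_. borel)"

definition field_law :: "'a measure \<Rightarrow> (int \<Rightarrow> int \<Rightarrow> 'a \<Rightarrow> real) \<Rightarrow> (int \<times> int \<Rightarrow> real) measure" where
  "field_law M \<xi> = distr M field_space (\<lambda>\<omega> (i, j). \<xi> i j \<omega>)"

definition random_field :: "'a measure \<Rightarrow> (int \<Rightarrow> int \<Rightarrow> 'a \<Rightarrow> real) \<Rightarrow> bool" where
  "random_field M \<xi> \<longleftrightarrow> (\<forall>i j. \<xi> i j \<in> borel_measurable M)"

definition stationary_field :: "'a measure \<Rightarrow> (int \<Rightarrow> int \<Rightarrow> 'a \<Rightarrow> real) \<Rightarrow> bool" where
  "stationary_field M \<xi> \<longleftrightarrow>
     (\<forall>a b. field_law M (\<lambda>i j. \<xi> (i + a) (j + b)) = field_law M \<xi>)"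

definition past_algebra ::
  "'a measure \<Rightarrow> (int \<Rightarrow> int \<Rightarrow> 'a \<Rightarrow> real) \<Rightarrow> int \<Rightarrow> int \<Rightarrow> 'a measure" where
  "past_algebra M \<xi> n m =
     sigma (space M) {\<xi> i j -` B \<inter> space M | i j B. i \<le> n \<and> j \<le> m \<and> B \<in> sets borel}"

definition causal_field ::
  "((nat \<times> nat \<Rightarrow> real) \<Rightarrow> real) \<Rightarrow> (int \<Rightarrow> int \<Rightarrow> 'a \<Rightarrow> real) \<Rightarrow> int \<Rightarrow> int \<Rightarrow> 'a \<Rightarrow> real" where
  "causal_field f \<xi> n m \<omega> = f (\<lambda>(i, j). \<xi> (n - int i) (m - int j) \<omega>)"

definition partial_sum :: "(int \<Rightarrow> int \<Rightarrow> 'a \<Rightarrow> real) \<Rightarrow> nat \<Rightarrow> nat \<Rightarrow> 'a \<Rightarrow> real" where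
  "partial_sum X j k \<omega> = (\<Sum>u=1..j. \<Sum>v=1..k. X (int u) (int v) \<omega>)"

definition commuting :: "'a measure \<Rightarrow> (int \<Rightarrow> int \<Rightarrow> 'a measure) \<Rightarrow> bool" where
  "commuting M G \<longleftrightarrow>
     (\<forall>a b u v Y. u \<le> a \<longrightarrow> integrable M Y \<longrightarrow>
        (AE \<omega> in M. real_cond_exp M (G u v) (real_cond_exp M (G a b) Y) \<omega>
                     = real_cond_exp M (G u (min b v)) Y \<omega>))"

definition L2_norm :: "'a measure \<Rightarrow> ('a \<Rightarrow> real) \<Rightarrow> ennreal" where
  "L2_norm M g =
     (if integrable M (\<lambda>\<omega>. (g \<omega>)\<^sup>2) then ennreal (sqrt (\<integral>\<omega>. (g \<omega>)\<^sup>2 \<partial>M)) else \<infinity>)"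

definition vertical_shift :: "(int \<times> int \<Rightarrow> real) \<Rightarrow> (int \<times> int \<Rightarrow> real)" where
  "vertical_shift x = (\<lambda>(i, j). x (i + 1, j))"

definition ergodic :: "'b measure \<Rightarrow> ('b \<Rightarrow> 'b) \<Rightarrow> bool" where
  "ergodic P T \<longleftrightarrow>
     (\<forall>A\<in>sets P. T -` A \<inter> space P = A \<longrightarrow> measure P A = 0 \<or> measure P A = 1)"

definition normal_law :: "real \<Rightarrow> real \<Rightarrow> real measure" where
  "normal_law \<mu> v =
     (if v = 0 then return borel \<mu> else density lborel (\<lambda>x. ennreal (normal_density \<mu> (sqrt v) x)))"

(* weak_conv_m only covers sequences; this is the same notion along an arbitrary filter. *)
definition conv_in_distr :: "('i \<Rightarrow> real measure) \<Rightarrow> real measure \<Rightarrow> 'i filter \<Rightarrow> bool" where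
  "conv_in_distr \<mu> \<nu> F \<longleftrightarrow>
     (\<forall>x. isCont (cdf \<nu>) x \<longrightarrow> ((\<lambda>i. cdf (\<mu> i) x) \<longlongrightarrow> cdf \<nu> x) F)"

lemma conv_in_distr_sequentially: "conv_in_distr \<mu> \<nu> sequentially \<longleftrightarrow> weak_conv_m \<mu> \<nu>"
  by (simp add: conv_in_distr_def weak_conv_m_def weak_conv_def)

(* The product filter is the limit regime in which min n1 n2 tends to infinity. *)
lemma min_at_top_eq:
  "filtercomap (\<lambda>(n1, n2). min n1 n2 :: nat) at_top = sequentially \<times>\<^sub>F sequentially"
proof (rule filter_eqI)
  fix P :: "nat \<times> nat \<Rightarrow> bool"
  show "eventually P (filtercomap (\<lambda>(n1, n2). min n1 n2) at_top) \<longleftrightarrow>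
        eventually P (sequentially \<times>\<^sub>F sequentially)"
    unfolding eventually_filtercomap_at_top_linorder eventually_prod_sequentially
    by auto
qed

end

theory Submission
  imports Defs
begin

text \<open>Why the theorem holds. Everything happens on the space of realizations of the field: the law \<open>P\<close> of the
field is invariant under the two shifts, \<open>X_{u,v}\<close> is a function \<open>h\<close> evaluated at the shifted
realization, and conditional expectations on the original space are pulled back from there
(\<open>cond_exp_sample\<close>, \<open>commuting_shifts_field_law\<close>). The term \<open>j = k = 1\<close> of the series already
forces \<open>h\<close> to be square integrable. The proof has three parts.

A norm inequality. A sum of \<open>n\<close> adapted variables is cut into blocks of dyadic lengths; replacing the
conditional expectations of the blocks of length \<open>2^q\<close> by those of length \<open>2^(q+1)\<close> changes the sum by a
sum of martingale differences, which costs only the square root of their number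
(\<open>dyadic_martingale_bound\<close>). Because the filtration commutes, the inequality can be applied first in one
direction and then in the other, and bounds the norm of the sum over an \<open>n\<close> by \<open>m\<close> rectangle by
\<open>25 sqrt (n m)\<close> times the dyadic sum of \<open>2^(-(q+p)/2) * norm (E (S_{2^q,2^p} | F_{1,1}))\<close>
(\<open>l2n_box_sum_le\<close>). By subadditivity that dyadic sum is at most a constant times the series of the
hypothesis (\<open>dyadic_double_sum_bounded\<close>).

Martingale approximation. Let \<open>Q1\<close> and \<open>Q2\<close> be the two one-step prediction operators
\<open>g \<mapsto> E (g \<circ> shift | F_{0,0})\<close>. Subtracting from \<open>h\<close> its averages over the powers of \<open>Q1\<close> and \<open>Q2\<close> up to \<open>R\<close> changes \<open>h\<close> by
something whose dyadic norm tends to \<open>0\<close> (\<open>dyad_residual_small\<close>), and what remains has the form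
\<open>(I - Q1)(I - Q2) g\<close> (\<open>residual_coboundary\<close>). Such a function is an orthomartingale difference up to
coboundaries, whose rectangle sums telescope in at least one direction and are negligible against
\<open>sqrt (n m)\<close> (\<open>coboundary_approx\<close>). Truncating \<open>g\<close> makes the orthomartingale difference bounded. So for each
\<open>e > 0\<close> there is a bounded orthomartingale difference \<open>D\<close> whose sums differ from those of \<open>h\<close> by at most
\<open>e sqrt (n m)\<close> in norm on all large rectangles (\<open>bounded_orthomartingale_approximation\<close>).

The limit law for bounded \<open>D\<close>. Sum \<open>D\<close> first along the ergodic vertical direction. The normalized column sums (\<open>ncol\<close>)
\<open>Z_v\<close> are martingale differences in \<open>v\<close>. Two distinct columns, and their sum and difference, are ergodic
martingales in the vertical direction, so their fourth moments converge to those of a Gaussian variable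
(\<open>fourth_moment_limit\<close>); by polarization \<open>E (Z_v^2 Z_w^2)\<close> converges to \<open>(E D^2)^2\<close>. Hence block averages of
\<open>Z_v^2\<close> concentrate at \<open>E D^2\<close> (\<open>block_variance\<close>), which is what a martingale needs to be asymptotically
normal (\<open>cosint_bound\<close>). Ergodicity of one shift suffices because the distinct columns become
uncorrelated in their squares; it enters only through the mean ergodic theorem (\<open>mean_ergodic\<close>).

Letting \<open>e\<close> tend to \<open>0\<close>, the norms of the approximating \<open>D\<close> form a Cauchy sequence, and their limit is \<open>c\<close>
(\<open>field_clt\<close>).\<close>

section \<open>Square integrable functions and conditional expectations\<close>

text \<open>Elements of L2 are kept as functions rather than as classes, so \<open>l2n\<close> is only a seminorm and an identity in
L2 is stated as an almost sure equality.\<close>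

definition sq_integrable :: "'a measure \<Rightarrow> ('a \<Rightarrow> real) \<Rightarrow> bool" where
  "sq_integrable M f \<longleftrightarrow> f \<in> borel_measurable M \<and> integrable M (\<lambda>x. (f x)\<^sup>2)"

definition l2n :: "'a measure \<Rightarrow> ('a \<Rightarrow> real) \<Rightarrow> real" where
  "l2n M f = sqrt (\<integral>x. (f x)\<^sup>2 \<partial>M)"

lemma l2n_nonneg [simp]: "0 \<le> l2n M f"
  unfolding l2n_def by simp

lemma l2n_sq: "(l2n M f)\<^sup>2 = (\<integral>x. (f x)\<^sup>2 \<partial>M)"
  unfolding l2n_def by simp

lemma l2n_leI: "0 \<le> c \<Longrightarrow> (\<integral>x. (f x)\<^sup>2 \<partial>M) \<le> c\<^sup>2 \<Longrightarrow> l2n M f \<le> c"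
  unfolding l2n_def by (intro real_le_lsqrt) auto

lemma sq_integrable_measurable [measurable_dest]: "sq_integrable M f \<Longrightarrow> f \<in> borel_measurable M"
  unfolding sq_integrable_def by simp

lemma sq_integrable_sq: "sq_integrable M f \<Longrightarrow> integrable M (\<lambda>x. (f x)\<^sup>2)"
  unfolding sq_integrable_def by simp

lemma sq_integrable_mult:
  assumes "sq_integrable M f" "sq_integrable M g"
  shows "integrable M (\<lambda>x. f x * g x)"
proof (rule Bochner_Integration.integrable_bound)
  show "integrable M (\<lambda>x. (f x)\<^sup>2 + (g x)\<^sup>2)"
    using assms[THEN sq_integrable_sq] by (intro Bochner_Integration.integrable_add)
  show "(\<lambda>x. f x * g x) \<in> borel_measurable M"
    using assms[THEN sq_integrable_measurable] by measurable
  have "\<bar>a * b\<bar> \<le> a\<^sup>2 + b\<^sup>2" for a b :: real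
  proof -
    have "0 \<le> (\<bar>a\<bar> - \<bar>b\<bar>)\<^sup>2" by simp
    then have "2 * (\<bar>a\<bar> * \<bar>b\<bar>) \<le> a\<^sup>2 + b\<^sup>2" by (simp add: power2_diff)
    moreover have "0 \<le> \<bar>a\<bar> * \<bar>b\<bar>" by simp
    ultimately show ?thesis unfolding abs_mult by linarith
  qed
  then show "AE x in M. norm (f x * g x) \<le> norm ((f x)\<^sup>2 + (g x)\<^sup>2)"
    by (auto simp: abs_of_nonneg)
qed

lemma sq_integrable_cmult [intro]: "sq_integrable M f \<Longrightarrow> sq_integrable M (\<lambda>x. c * f x)"
  unfolding sq_integrable_def by (auto simp: power_mult_distrib)

lemma sq_integrable_divide [intro]: "sq_integrable M f \<Longrightarrow> sq_integrable M (\<lambda>x. f x / c)"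
  unfolding sq_integrable_def by (auto simp: power_divide)

lemma sq_integrable_add [intro]:
  assumes "sq_integrable M f" "sq_integrable M g"
  shows "sq_integrable M (\<lambda>x. f x + g x)"
proof -
  have "integrable M (\<lambda>x. (f x)\<^sup>2 + (g x)\<^sup>2 + 2 * (f x * g x))"
    using sq_integrable_mult[OF assms] assms[THEN sq_integrable_sq]
    by (intro Bochner_Integration.integrable_add integrable_mult_right)
  then show ?thesis
    using assms[THEN sq_integrable_measurable] unfolding sq_integrable_def by (simp add: power2_sum mult.assoc)
qed

lemma sq_integrable_diff [intro]:
  assumes "sq_integrable M f" "sq_integrable M g"
  shows "sq_integrable M (\<lambda>x. f x - g x)"
  using sq_integrable_add[OF assms(1) sq_integrable_cmult[OF assms(2), of "-1"]] by simp

lemma sq_integrable_zero [simp]: "sq_integrable M (\<lambda>x. 0)"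
  unfolding sq_integrable_def by simp

lemma sq_integrable_sum [intro]:
  assumes "\<And>i. i \<in> I \<Longrightarrow> sq_integrable M (f i)"
  shows "sq_integrable M (\<lambda>x. \<Sum>i\<in>I. f i x)"
  using assms by (induction I rule: infinite_finite_induct) auto

lemma sq_integrable_cong_AE:
  assumes "sq_integrable M f" "g \<in> borel_measurable M" "AE x in M. f x = g x"
  shows "sq_integrable M g"
proof -
  have "integrable M (\<lambda>x. (g x)\<^sup>2)"
    using assms(1)[THEN sq_integrable_sq]
    by (rule Bochner_Integration.integrable_cong_AE_imp) (use assms in auto)
  then show ?thesis using assms unfolding sq_integrable_def by simp
qed

lemma l2n_cong_AE:
  assumes "f \<in> borel_measurable M" "g \<in> borel_measurable M" "AE x in M. f x = g x"
  shows "l2n M f = l2n M g"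
  unfolding l2n_def using assms by (intro arg_cong[where f=sqrt] integral_cong_AE) auto

lemma l2n_cmult: "l2n M (\<lambda>x. c * f x) = \<bar>c\<bar> * l2n M f"
  unfolding l2n_def by (simp add: power_mult_distrib real_sqrt_mult)

lemma l2n_uminus: "l2n M (\<lambda>x. - f x) = l2n M f"
  unfolding l2n_def by simp

text \<open>The quadratic polynomial \<open>t \<mapsto> \<integral> (f - t g)\<^sup>2\<close> has no negative value, so its discriminant is not positive.\<close>

lemma cauchy_schwarz_integral:
  assumes f: "sq_integrable M f" and g: "sq_integrable M g"
  shows "\<bar>\<integral>x. f x * g x \<partial>M\<bar> \<le> l2n M f * l2n M g"
proof -
  define a b c where "a = (\<integral>x. (f x)\<^sup>2 \<partial>M)" and "b = (\<integral>x. f x * g x \<partial>M)" and "c = (\<integral>x. (g x)\<^sup>2 \<partial>M)"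
  note [simp] = sq_integrable_sq[OF f] sq_integrable_sq[OF g] sq_integrable_mult[OF f g]
  have q: "0 \<le> a - 2 * t * b + t\<^sup>2 * c" for t
  proof -
    have "0 \<le> (\<integral>x. (f x - t * g x)\<^sup>2 \<partial>M)" by simp
    also have "\<dots> = (\<integral>x. (f x)\<^sup>2 - 2 * t * (f x * g x) + t\<^sup>2 * (g x)\<^sup>2 \<partial>M)"
      by (simp add: power2_diff power_mult_distrib algebra_simps)
    also have "\<dots> = a - 2 * t * b + t\<^sup>2 * c"
      unfolding a_def b_def c_def by simp
    finally show ?thesis .
  qed
  have c0: "0 \<le> c" "0 \<le> a" unfolding c_def a_def by auto
  have "b\<^sup>2 \<le> a * c"
  proof (cases "c = 0")
    case True
    have "b = 0"
    proof (rule ccontr)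
      assume "b \<noteq> 0"
      then show False using q[of "(a + 1) / (2 * b)"] True by (simp add: field_simps)
    qed
    then show ?thesis using True by simp
  next
    case False
    then have "c > 0" using c0 by simp
    then show ?thesis using q[of "b / c"] by (simp add: field_simps power2_eq_square)
  qed
  then have "\<bar>b\<bar> \<le> sqrt (a * c)" by (metis real_sqrt_abs real_sqrt_le_mono)
  then show ?thesis unfolding l2n_def a_def b_def c_def by (simp add: real_sqrt_mult)
qed

lemma l2n_triangle:
  assumes f: "sq_integrable M f" and g: "sq_integrable M g"
  shows "l2n M (\<lambda>x. f x + g x) \<le> l2n M f + l2n M g"
proof -
  note [simp] = sq_integrable_sq[OF f] sq_integrable_sq[OF g] sq_integrable_mult[OF f g]
  have "(\<integral>x. (f x + g x)\<^sup>2 \<partial>M) = (\<integral>x. (f x)\<^sup>2 + (g x)\<^sup>2 + 2 * (f x * g x) \<partial>M)"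
    by (simp add: power2_sum mult.assoc)
  also have "\<dots> = (l2n M f)\<^sup>2 + (l2n M g)\<^sup>2 + 2 * (\<integral>x. f x * g x \<partial>M)"
    by (simp add: l2n_sq)
  also have "\<dots> \<le> (l2n M f + l2n M g)\<^sup>2"
    using cauchy_schwarz_integral[OF f g] by (simp add: power2_sum)
  finally show ?thesis by (intro l2n_leI) auto
qed

lemma l2n_triangle_diff:
  assumes f: "sq_integrable M f" and g: "sq_integrable M g"
  shows "l2n M (\<lambda>x. f x - g x) \<le> l2n M f + l2n M g"
  using l2n_triangle[OF f sq_integrable_cmult[OF g, of "-1"]] by (simp add: l2n_uminus)

lemma l2n_reverse_triangle:
  assumes f: "sq_integrable M f" and g: "sq_integrable M g"
  shows "\<bar>l2n M f - l2n M g\<bar> \<le> l2n M (\<lambda>x. f x - g x)"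
  using l2n_triangle[OF g sq_integrable_diff[OF f g]] l2n_triangle_diff[OF f sq_integrable_diff[OF f g]]
  by simp

lemma l2n_zero [simp]: "l2n M (\<lambda>x. 0) = 0"
  unfolding l2n_def by simp

lemma l2n_sum:
  assumes "\<And>i. i \<in> I \<Longrightarrow> sq_integrable M (f i)"
  shows "l2n M (\<lambda>x. \<Sum>i\<in>I. f i x) \<le> (\<Sum>i\<in>I. l2n M (f i))"
  using assms
proof (induction I rule: infinite_finite_induct)
  case (insert i I)
  then have "l2n M (\<lambda>x. f i x + (\<Sum>i\<in>I. f i x)) \<le> l2n M (f i) + l2n M (\<lambda>x. \<Sum>i\<in>I. f i x)"
    by (intro l2n_triangle) auto
  then show ?case using insert by fastforce
qed auto

lemma pythagoras_integral:
  assumes "finite I" "\<And>i. i \<in> I \<Longrightarrow> sq_integrable M (f i)"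
    and "\<And>i j. i \<in> I \<Longrightarrow> j \<in> I \<Longrightarrow> i \<noteq> j \<Longrightarrow> (\<integral>x. f i x * f j x \<partial>M) = 0"
  shows "(\<integral>x. (\<Sum>i\<in>I. f i x)\<^sup>2 \<partial>M) = (\<Sum>i\<in>I. \<integral>x. (f i x)\<^sup>2 \<partial>M)"
proof -
  have "(\<integral>x. (\<Sum>i\<in>I. f i x)\<^sup>2 \<partial>M) = (\<integral>x. (\<Sum>i\<in>I. \<Sum>j\<in>I. f i x * f j x) \<partial>M)"
    by (simp add: power2_eq_square sum_product)
  also have "\<dots> = (\<Sum>i\<in>I. \<Sum>j\<in>I. \<integral>x. f i x * f j x \<partial>M)"
    using assms(2) by (simp add: sq_integrable_mult integrable_sum)
  also have "\<dots> = (\<Sum>i\<in>I. \<Sum>j\<in>I. if j = i then (\<integral>x. (f i x)\<^sup>2 \<partial>M) else 0)"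
    using assms(3) by (intro sum.cong refl) (auto simp: power2_eq_square)
  finally show ?thesis using assms(1) by simp
qed

text \<open>Orthogonality replaces the factor \<open>card I\<close> of the triangle inequality by its square root. Every gain that
comes from martingale structure is an application of this bound.\<close>

lemma pythagoras_le:
  assumes "finite I" "\<And>i. i \<in> I \<Longrightarrow> sq_integrable M (f i)"
    and "\<And>i j. i \<in> I \<Longrightarrow> j \<in> I \<Longrightarrow> i \<noteq> j \<Longrightarrow> (\<integral>x. f i x * f j x \<partial>M) = 0"
    and "\<And>i. i \<in> I \<Longrightarrow> l2n M (f i) \<le> c"
  shows "l2n M (\<lambda>x. \<Sum>i\<in>I. f i x) \<le> sqrt (real (card I)) * c"
proof (cases "I = {}")
  case False
  then have c: "0 \<le> c" using assms(4) l2n_nonneg order_trans by blast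
  have "(\<integral>x. (\<Sum>i\<in>I. f i x)\<^sup>2 \<partial>M) = (\<Sum>i\<in>I. (l2n M (f i))\<^sup>2)"
    using assms(1-3) by (subst pythagoras_integral) (auto simp: l2n_sq)
  also have "\<dots> \<le> (\<Sum>i\<in>I. c\<^sup>2)"
    using assms(4) by (intro sum_mono power_mono) auto
  also have "\<dots> = (sqrt (real (card I)) * c)\<^sup>2"
    by (simp add: power_mult_distrib)
  finally show ?thesis using c by (intro l2n_leI) auto
qed simp

context prob_space
begin

lemma sq_integrable_integrable: "sq_integrable M f \<Longrightarrow> integrable M f"
  unfolding sq_integrable_def using square_integrable_imp_integrable by blast

lemma sq_integrable_const [simp]: "sq_integrable M (\<lambda>x. c)"
  unfolding sq_integrable_def by simp

lemma sq_integrable_bounded: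
  assumes "f \<in> borel_measurable M" "AE x in M. \<bar>f x\<bar> \<le> K"
  shows "sq_integrable M f"
proof -
  have "integrable M (\<lambda>x. (f x)\<^sup>2)"
  proof (intro integrable_const_bound[where B="K\<^sup>2"])
    show "AE x in M. norm ((f x)\<^sup>2) \<le> K\<^sup>2"
      using assms(2) by eventually_elim (metis abs_ge_zero norm_power power_mono real_norm_def)
  qed (use assms(1) in measurable)
  then show ?thesis using assms unfolding sq_integrable_def by simp
qed

lemma l1_le_l2n:
  assumes "sq_integrable M f"
  shows "(\<integral>x. \<bar>f x\<bar> \<partial>M) \<le> l2n M f"
proof -
  have s: "sq_integrable M (\<lambda>x. \<bar>f x\<bar>)" using assms unfolding sq_integrable_def by auto
  have "l2n M (\<lambda>x. 1) = 1" unfolding l2n_def by (simp add: prob_space)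
  moreover have "l2n M (\<lambda>x. \<bar>f x\<bar>) = l2n M f" unfolding l2n_def by simp
  ultimately show ?thesis using cauchy_schwarz_integral[OF s, of "\<lambda>x. 1"] by simp
qed

lemma sigma_finite_subalgebraI: "subalgebra M F \<Longrightarrow> sigma_finite_subalgebra M F"
  by (intro finite_measure_subalgebra_is_sigma_finite)
    (simp add: finite_measure_axioms finite_measure_subalgebra.intro finite_measure_subalgebra_axioms_def)

lemma cond_exp_L2:
  assumes F: "subalgebra M F" and f: "sq_integrable M f"
  shows "sq_integrable M (real_cond_exp M F f)" "l2n M (real_cond_exp M F f) \<le> l2n M f"
proof -
  interpret sigma_finite_subalgebra M F by (rule sigma_finite_subalgebraI[OF F])
  have i: "integrable M f" by (rule sq_integrable_integrable[OF f])
  have cv: "convex_on UNIV (\<lambda>x::real. x\<^sup>2)"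
    using convex_power2 by simp
  have j: "AE x in M. (real_cond_exp M F f x)\<^sup>2 \<le> real_cond_exp M F (\<lambda>x. (f x)\<^sup>2) x"
    by (rule real_cond_exp_jensens_inequality(2)[where I=UNIV and q="\<lambda>x. x\<^sup>2"])
      (use i sq_integrable_sq[OF f] cv in auto)
  have int: "integrable M (\<lambda>x. (real_cond_exp M F f x)\<^sup>2)"
    by (rule integrable_convex_cond_exp[where I=UNIV and q="\<lambda>x. x\<^sup>2"])
      (use i sq_integrable_sq[OF f] cv in auto)
  show "sq_integrable M (real_cond_exp M F f)"
    using int unfolding sq_integrable_def by simp
  have "(\<integral>x. (real_cond_exp M F f x)\<^sup>2 \<partial>M) \<le> (\<integral>x. real_cond_exp M F (\<lambda>x. (f x)\<^sup>2) x \<partial>M)"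
    by (rule integral_mono_AE[OF int real_cond_exp_int(1)[OF sq_integrable_sq[OF f]] j])
  also have "\<dots> = (\<integral>x. (f x)\<^sup>2 \<partial>M)"
    by (rule real_cond_exp_int(2)[OF sq_integrable_sq[OF f]])
  finally show "l2n M (real_cond_exp M F f) \<le> l2n M f"
    unfolding l2n_def by simp
qed

lemma cond_exp_orthogonal:
  assumes F: "subalgebra M F" and "g \<in> borel_measurable F" "sq_integrable M g" "sq_integrable M d"
    and z: "AE x in M. real_cond_exp M F d x = 0"
  shows "(\<integral>x. g x * d x \<partial>M) = 0"
proof -
  interpret sigma_finite_subalgebra M F by (rule sigma_finite_subalgebraI[OF F])
  have "(\<integral>x. g x * d x \<partial>M) = (\<integral>x. g x * real_cond_exp M F d x \<partial>M)"
    using assms by (intro real_cond_exp_intg(2)[symmetric] sq_integrable_mult) auto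
  also have "\<dots> = (\<integral>x. 0 \<partial>M)"
    using assms z sq_integrable_measurable[of M g] by (intro integral_cong_AE) auto
  finally show ?thesis by simp
qed

lemma cond_exp_sum_AE:
  assumes "subalgebra M F" "\<And>i. i \<in> I \<Longrightarrow> integrable M (f i)"
  shows "AE x in M. real_cond_exp M F (\<lambda>x. \<Sum>i\<in>I. f i x) x = (\<Sum>i\<in>I. real_cond_exp M F (f i) x)"
proof -
  interpret sigma_finite_subalgebra M F by (rule sigma_finite_subalgebraI[OF assms(1)])
  show ?thesis using assms(2)
  proof (induction I rule: infinite_finite_induct)
    case (insert i I)
    have "AE x in M. real_cond_exp M F (\<lambda>x. f i x + (\<Sum>i\<in>I. f i x)) x
      = real_cond_exp M F (f i) x + real_cond_exp M F (\<lambda>x. \<Sum>i\<in>I. f i x) x"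
      using insert by (intro real_cond_exp_add) auto
    moreover have "AE x in M. real_cond_exp M F (\<lambda>x. \<Sum>i\<in>I. f i x) x = (\<Sum>i\<in>I. real_cond_exp M F (f i) x)"
      using insert by auto
    ultimately show ?case using insert by (auto elim: AE_mp)
  qed (use real_cond_exp_F_meas[of "\<lambda>x. 0"] in auto)
qed

lemma subalgebraI_mono:
  assumes "subalgebra M F" "subalgebra M H" "sets F \<subseteq> sets H"
  shows "subalgebra H F"
  using assms unfolding subalgebra_def by auto

lemma cond_exp_tower:
  assumes "subalgebra M F" "subalgebra M H" "sets F \<subseteq> sets H" "integrable M f"
  shows "AE x in M. real_cond_exp M F (real_cond_exp M H f) x = real_cond_exp M F f x"
proof -
  interpret sigma_finite_subalgebra M F by (rule sigma_finite_subalgebraI[OF assms(1)])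
  show ?thesis
    using assms subalgebraI_mono[OF assms(1-3)] by (intro real_cond_exp_nested_subalg)
qed

end

text \<open>Conditional expectations are transported along a measurable map as soon as the \<sigma>-algebra on the source
is exactly the one pulled back from the target. It is applied to the shifts and to the map that sends a
point of the probability space to the realization of the field.\<close>

lemma (in prob_space) cond_exp_comp:
  fixes y :: "'b \<Rightarrow> real"
  assumes X: "X \<in> M \<rightarrow>\<^sub>M N" and G: "subalgebra M G" and H: "subalgebra (distr M N X) H"
    and XG: "X \<in> G \<rightarrow>\<^sub>M H"
    and rep: "\<And>A. A \<in> sets G \<Longrightarrow> \<exists>B\<in>sets H. A = X -` B \<inter> space M"
    and y: "integrable (distr M N X) y"
  shows "AE x in M. real_cond_exp M G (\<lambda>x. y (X x)) x = real_cond_exp (distr M N X) H y (X x)"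
proof -
  let ?P = "distr M N X"
  interpret P: prob_space ?P by (rule prob_space_distr[OF X])
  interpret G: sigma_finite_subalgebra M G by (rule sigma_finite_subalgebraI[OF G])
  interpret H: sigma_finite_subalgebra ?P H by (rule P.sigma_finite_subalgebraI[OF H])
  have comp: "integrable M (\<lambda>x. g (X x))" if "integrable ?P g" for g :: "'b \<Rightarrow> real"
    by (rule integrable_distr[OF X that])
  show ?thesis
  proof (rule G.real_cond_exp_charact)
    fix A assume "A \<in> sets G"
    then obtain B where B: "B \<in> sets H" and A: "A = X -` B \<inter> space M" using rep by blast
    have BP: "B \<in> sets N" using B H unfolding subalgebra_def by auto
    have tr: "(\<integral>x\<in>A. g (X x) \<partial>M) = (\<integral>z\<in>B. g z \<partial>?P)" if g: "integrable ?P g" for g :: "'b \<Rightarrow> real"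
    proof -
      have gm: "g \<in> borel_measurable N" using borel_measurable_integrable[OF g] by simp
      have "(\<integral>x\<in>A. g (X x) \<partial>M) = (\<integral>x. (\<lambda>z. indicator B z * g z) (X x) \<partial>M)"
        unfolding set_lebesgue_integral_def A
        by (rule Bochner_Integration.integral_cong) (auto simp: indicator_def)
      also have "\<dots> = (\<integral>z. indicator B z * g z \<partial>?P)"
        by (rule integral_distr[OF X, symmetric]) (use gm BP in measurable)
      finally show ?thesis unfolding set_lebesgue_integral_def by simp
    qed
    show "(\<integral>x\<in>A. y (X x) \<partial>M) = (\<integral>x\<in>A. real_cond_exp ?P H y (X x) \<partial>M)"
      unfolding tr[OF y] tr[OF H.real_cond_exp_int(1)[OF y]] by (rule H.real_cond_exp_intA[OF y B])
  next
    show "(\<lambda>x. real_cond_exp ?P H y (X x)) \<in> borel_measurable G"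
      by (rule measurable_compose[OF XG borel_measurable_cond_exp])
  qed (intro comp y H.real_cond_exp_int(1))+
qed

section \<open>A dyadic inequality for sums of adapted variables\<close>

lemma sum_lessThan_pairs:
  fixes f :: "nat \<Rightarrow> 'b::comm_monoid_add"
  shows "(\<Sum>k<N. f k) = (\<Sum>k<N div 2. f (2 * k) + f (2 * k + 1)) + (if odd N then f (N - 1) else 0)"
proof -
  have e: "(\<Sum>k<2 * m. f k) = (\<Sum>k<m. f (2 * k) + f (2 * k + 1))" for m
    by (induction m) (simp_all add: add.assoc)
  show ?thesis
  proof (cases "odd N")
    case True
    then obtain m where "N = 2 * m + 1" by (auto elim: oddE)
    then show ?thesis using e[of m] by simp
  next
    case False
    then obtain m where "N = 2 * m" by (auto elim: evenE)
    then show ?thesis using e[of m] by simp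
  qed
qed

context prob_space
begin

text \<open>The increment \<open>E (W k | H' k) - E (W k | H k)\<close> is known at the time \<open>H' k \<subseteq> H (k + 1)\<close> and has mean zero given
\<open>H k\<close>. The increments are therefore orthogonal, whatever the dependence
between the variables \<open>W k\<close>.\<close>

lemma cond_exp_increments_bound:
  fixes H H' :: "nat \<Rightarrow> 'a measure" and N :: nat
  assumes sub: "\<And>k. subalgebra M (H k)" "\<And>k. subalgebra M (H' k)"
    and nest: "\<And>k. sets (H k) \<subseteq> sets (H' k)" "\<And>k l. k < l \<Longrightarrow> sets (H' k) \<subseteq> sets (H l)"
    and sq: "\<And>k. sq_integrable M (W k)"
    and bd: "\<And>k. l2n M (real_cond_exp M (H' k) (W k)) \<le> c"
  shows "l2n M (\<lambda>x. \<Sum>k<N. real_cond_exp M (H' k) (W k) x - real_cond_exp M (H k) (W k) x)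
           \<le> 2 * sqrt N * c"
proof -
  define d where "d k x = real_cond_exp M (H' k) (W k) x - real_cond_exp M (H k) (W k) x" for k x
  have dsq: "sq_integrable M (d k)" for k
    unfolding d_def using sub sq by (intro sq_integrable_diff cond_exp_L2(1))
  have dmeas: "d k \<in> borel_measurable (H l)" if "k < l" for k l
  proof -
    have s: "subalgebra (H' k) (H k)" "subalgebra (H l) (H' k)"
      using subalgebraI_mono[OF sub(1)[of k] sub(2)[of k] nest(1)[of k]]
        subalgebraI_mono[OF sub(2)[of k] sub(1)[of l] nest(2)[OF that]] by simp_all
    have "d k \<in> borel_measurable (H' k)"
      unfolding d_def
      by (intro borel_measurable_diff borel_measurable_cond_exp measurable_from_subalg[OF s(1)])
    then show ?thesis by (rule measurable_from_subalg[OF s(2)])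
  qed
  have dz: "AE x in M. real_cond_exp M (H k) (d k) x = 0" for k
  proof -
    interpret sigma_finite_subalgebra M "H k" by (rule sigma_finite_subalgebraI[OF sub(1)])
    note i = sq_integrable_integrable[OF cond_exp_L2(1)[OF sub(2) sq]]
      sq_integrable_integrable[OF cond_exp_L2(1)[OF sub(1) sq]]
    have "AE x in M. real_cond_exp M (H k) (d k) x
      = real_cond_exp M (H k) (real_cond_exp M (H' k) (W k)) x - real_cond_exp M (H k) (real_cond_exp M (H k) (W k)) x"
      unfolding d_def by (rule real_cond_exp_diff[OF i])
    moreover have "AE x in M. real_cond_exp M (H k) (real_cond_exp M (H' k) (W k)) x = real_cond_exp M (H k) (W k) x"
      using sub nest sq by (intro cond_exp_tower sq_integrable_integrable)
    moreover have "AE x in M. real_cond_exp M (H k) (real_cond_exp M (H k) (W k)) x = real_cond_exp M (H k) (W k) x"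
      using sub sq by (intro cond_exp_tower sq_integrable_integrable order_refl)
    ultimately show ?thesis by eventually_elim simp
  qed
  have orth: "(\<integral>x. d k x * d l x \<partial>M) = 0" if "k < l" for k l
    by (rule cond_exp_orthogonal[OF sub(1) dmeas[OF that] dsq dsq dz])
  have dbd: "l2n M (d k) \<le> 2 * c" for k
  proof -
    have "l2n M (real_cond_exp M (H k) (W k)) = l2n M (real_cond_exp M (H k) (real_cond_exp M (H' k) (W k)))"
      using cond_exp_tower[OF sub(1)[of k] sub(2)[of k] nest(1) sq_integrable_integrable[OF sq[of k]]]
      by (intro l2n_cong_AE) auto
    also have "\<dots> \<le> l2n M (real_cond_exp M (H' k) (W k))"
      by (intro cond_exp_L2 sub sq)
    finally have "l2n M (real_cond_exp M (H k) (W k)) \<le> c" using bd order_trans by blast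
    then show ?thesis
      using l2n_triangle_diff[OF cond_exp_L2(1)[OF sub(2)[of k] sq[of k]] cond_exp_L2(1)[OF sub(1)[of k] sq[of k]]] bd[of k]
      unfolding d_def by linarith
  qed
  have "l2n M (\<lambda>x. \<Sum>k\<in>{..<N}. d k x) \<le> sqrt (real (card {..<N})) * (2 * c)"
  proof (rule pythagoras_le)
    fix i j assume "i \<in> {..<N}" "j \<in> {..<N}" "i \<noteq> j"
    then show "(\<integral>x. d i x * d j x \<partial>M) = 0"
      using orth[of i j] orth[of j i] by (cases "i < j") (auto simp: mult.commute)
  qed (use dsq dbd in auto)
  then show ?thesis unfolding d_def by (simp add: mult_ac)
qed

text \<open>The idea is that of Peligrad and Utev. Let \<open>C q\<close> be the sum of the
predictions, made at the start of each block, of the sums over the full blocks of length \<open>2^q\<close> inside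
\<open>{1..n}\<close>. Two neighbouring blocks of length \<open>2^q\<close> form one block of length \<open>2^(q+1)\<close>, and the two predictions for the
left half agree. Hence \<open>C q - C (q + 1)\<close> consists of martingale increments from the right halves and of
at most one unpaired block. There are at most \<open>n / 2^q\<close> of them, which gives \<open>sqrt (n / 2^q) * a q\<close>; and \<open>C q\<close> vanishes once
\<open>2^q > n\<close>. Conditioning in the hypothesis at time \<open>k * 2^q + 1\<close> instead of \<open>k * 2^q\<close> lets the case \<open>q = 0\<close>
bound the single variables \<open>Y u\<close>.\<close>

lemma dyadic_martingale_bound:
  fixes Y :: "nat \<Rightarrow> 'a \<Rightarrow> real" and G :: "nat \<Rightarrow> 'a measure" and a :: "nat \<Rightarrow> real"
  assumes sub: "\<And>k. subalgebra M (G k)" and mono: "\<And>j k. j \<le> k \<Longrightarrow> sets (G j) \<subseteq> sets (G k)"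
    and Ym: "\<And>u. Y (Suc u) \<in> borel_measurable (G (Suc u))" and Ysq: "\<And>u. sq_integrable M (Y (Suc u))"
    and bd: "\<And>q k. l2n M (real_cond_exp M (G (k * 2 ^ q + 1)) (\<lambda>x. \<Sum>u\<in>{k * 2 ^ q<..(k + 1) * 2 ^ q}. Y u x)) \<le> a q"
    and n: "n < 2 ^ Q"
  shows "l2n M (\<lambda>x. \<Sum>u=1..n. Y u x) \<le> 5 * sqrt n * (\<Sum>q<Q. a q / sqrt (2 ^ q))"
proof -
  define B where "B q k x = (\<Sum>u\<in>{k * 2 ^ q<..(k + 1) * 2 ^ q}. Y u x)" for q k x
  define C where "C q x = (\<Sum>k<n div 2 ^ q. real_cond_exp M (G (k * 2 ^ q)) (B q k) x)" for q x
  define S where "S x = (\<Sum>u=1..n. Y u x)" for x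
  have Ysq': "sq_integrable M (Y u)" if "u > 0" for u
    using Ysq[of "u - 1"] that by simp
  have Bsq: "sq_integrable M (B q k)" for q k
    unfolding B_def by (intro sq_integrable_sum Ysq') auto
  note Bint = sq_integrable_integrable[OF Bsq]
  have Ssq: "sq_integrable M S"
    unfolding S_def by (intro sq_integrable_sum Ysq') auto
  have Csq: "sq_integrable M (C q)" for q
    unfolding C_def by (intro sq_integrable_sum cond_exp_L2(1) sub Bsq)
  have bdB: "l2n M (real_cond_exp M (G j) (B q k)) \<le> a q" if "j \<le> k * 2 ^ q + 1" for j q k
  proof -
    have "l2n M (real_cond_exp M (G j) (B q k)) =
      l2n M (real_cond_exp M (G j) (real_cond_exp M (G (k * 2 ^ q + 1)) (B q k)))"
      using cond_exp_tower[OF sub sub mono[OF that] Bint[of q k]] by (intro l2n_cong_AE) auto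
    also have "\<dots> \<le> l2n M (real_cond_exp M (G (k * 2 ^ q + 1)) (B q k))"
      by (intro cond_exp_L2 sub Bsq)
    also have "\<dots> \<le> a q" using bd[of k q] unfolding B_def .
    finally show ?thesis .
  qed
  have a0: "0 \<le> a q" for q
    using bdB[of 0 0 q] l2n_nonneg order_trans by blast
  have start: "l2n M (\<lambda>x. S x - C 0 x) \<le> 2 * sqrt n * a 0"
  proof -
    have "l2n M (\<lambda>x. S x - C 0 x) = l2n M (\<lambda>x. \<Sum>k<n. real_cond_exp M (G (Suc k)) (B 0 k) x - real_cond_exp M (G k) (B 0 k) x)"
    proof (rule l2n_cong_AE)
      have B0: "B 0 k = Y (Suc k)" for k
      proof -
        have "{k<..k + 1} = {Suc k}" by auto
        then show ?thesis unfolding B_def by auto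
      qed
      have "AE x in M. \<forall>k\<in>{..<n}. real_cond_exp M (G (Suc k)) (Y (Suc k)) x = Y (Suc k) x"
      proof (intro AE_finite_allI)
        fix k
        interpret sigma_finite_subalgebra M "G (Suc k)" by (rule sigma_finite_subalgebraI[OF sub])
        show "AE x in M. real_cond_exp M (G (Suc k)) (Y (Suc k)) x = Y (Suc k) x"
          by (intro real_cond_exp_F_meas sq_integrable_integrable Ysq Ym)
      qed simp
      then show "AE x in M. S x - C 0 x = (\<Sum>k<n. real_cond_exp M (G (Suc k)) (B 0 k) x - real_cond_exp M (G k) (B 0 k) x)"
      proof eventually_elim
        case (elim x)
        have "S x = (\<Sum>k<n. Y (Suc k) x)"
          unfolding S_def by (rule sum.reindex_bij_witness[of _ Suc "\<lambda>u. u - 1"]) auto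
        then show ?case using elim unfolding C_def B0 by (simp add: sum_subtractf)
      qed
    qed (use Ssq Csq in \<open>auto intro!: borel_measurable_diff sq_integrable_measurable\<close>)
    also have "\<dots> \<le> 2 * sqrt n * a 0"
      by (rule cond_exp_increments_bound[where H=G and H'="\<lambda>k. G (Suc k)" and W="B 0"])
        (simp_all add: sub mono Bsq bdB)
    finally show ?thesis .
  qed
  have step: "l2n M (\<lambda>x. C q x - C (Suc q) x) \<le> 3 * sqrt n * (a q / sqrt (2 ^ q))" for q
  proof -
    define N where "N = n div 2 ^ q"
    have N2: "n div 2 ^ Suc q = N div 2" unfolding N_def
      by (simp add: div_mult2_eq mult.commute[of 2])
    define H where "H k = G (2 * k * 2 ^ q)" for k
    define H' where "H' k = G ((2 * k + 1) * 2 ^ q)" for k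
    define W where "W k = B q (2 * k + 1)" for k
    define R where "R x = (if odd N then real_cond_exp M (G ((N - 1) * 2 ^ q)) (B q (N - 1)) x else 0)" for x
    define D where "D x = (\<Sum>k<N div 2. real_cond_exp M (H' k) (W k) x - real_cond_exp M (H k) (W k) x)" for x
    have Rsq: "sq_integrable M R"
      unfolding R_def by (cases "odd N") (auto intro: cond_exp_L2 sub Bsq)
    have Dsq: "sq_integrable M D"
      unfolding D_def H_def H'_def W_def
      by (intro sq_integrable_sum sq_integrable_diff cond_exp_L2(1) sub Bsq)
    have B2: "B (Suc q) k x = B q (2 * k) x + B q (2 * k + 1) x" for k x
    proof -
      have "{k * 2 ^ Suc q<..(k + 1) * 2 ^ Suc q} = {2 * k * 2 ^ q<..(2 * k + 1) * 2 ^ q} \<union> {(2 * k + 1) * 2 ^ q<..(2 * k + 1 + 1) * 2 ^ q}"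
        by (subst ivl_disj_un_two(6)) (auto simp: algebra_simps)
      then show ?thesis unfolding B_def
        by (simp only:) (subst sum.union_disjoint, auto)
    qed
    have CD: "AE x in M. C q x - C (Suc q) x = D x + R x"
    proof -
      have "AE x in M. \<forall>k\<in>{..<N div 2}. real_cond_exp M (G (k * 2 ^ Suc q)) (B (Suc q) k) x =
         real_cond_exp M (G (2 * k * 2 ^ q)) (B q (2 * k)) x + real_cond_exp M (G (2 * k * 2 ^ q)) (B q (2 * k + 1)) x"
      proof (intro AE_finite_allI)
        fix k
        interpret sigma_finite_subalgebra M "G (2 * k * 2 ^ q)" by (rule sigma_finite_subalgebraI[OF sub])
        have e: "k * 2 ^ Suc q = 2 * k * 2 ^ q" by simp
        have f: "B (Suc q) k = (\<lambda>x. B q (2 * k) x + B q (2 * k + 1) x)" using B2 by blast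
        show "AE x in M. real_cond_exp M (G (k * 2 ^ Suc q)) (B (Suc q) k) x =
         real_cond_exp M (G (2 * k * 2 ^ q)) (B q (2 * k)) x + real_cond_exp M (G (2 * k * 2 ^ q)) (B q (2 * k + 1)) x"
          unfolding e f by (rule real_cond_exp_add[OF Bint Bint])
      qed simp
      then show ?thesis
      proof eventually_elim
        case (elim x)
        define c where "c k = real_cond_exp M (G (k * 2 ^ q)) (B q k) x" for k
        have "C q x = (\<Sum>k<N div 2. c (2 * k) + c (2 * k + 1)) + R x"
          unfolding C_def N_def[symmetric] c_def[symmetric]
          by (subst sum_lessThan_pairs) (simp add: R_def c_def)
        moreover have "C (Suc q) x = (\<Sum>k<N div 2. c (2 * k) + real_cond_exp M (G (2 * k * 2 ^ q)) (B q (2 * k + 1)) x)"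
          unfolding C_def N2 c_def using elim by (intro sum.cong) auto
        ultimately show ?case
          unfolding D_def H_def H'_def W_def c_def by (simp add: sum_subtractf[symmetric])
      qed
    qed
    have "l2n M (\<lambda>x. C q x - C (Suc q) x) = l2n M (\<lambda>x. D x + R x)"
      using CD Csq Rsq Dsq by (intro l2n_cong_AE sq_integrable_measurable sq_integrable_diff sq_integrable_add)
    also have "\<dots> \<le> l2n M D + l2n M R" by (rule l2n_triangle[OF Dsq Rsq])
    also have "l2n M D \<le> 2 * sqrt (real (N div 2)) * a q"
      unfolding D_def
    proof (rule cond_exp_increments_bound)
      show "sets (H k) \<subseteq> sets (H' k)" for k unfolding H_def H'_def by (intro mono) auto
      show "sets (H' k) \<subseteq> sets (H l)" if "k < l" for k l
        unfolding H_def H'_def using that by (intro mono mult_right_mono) auto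
      show "l2n M (real_cond_exp M (H' k) (W k)) \<le> a q" for k
        unfolding H'_def W_def by (rule bdB) simp
    qed (auto simp: H_def H'_def W_def sub Bsq)
    also have "sqrt (real (N div 2)) \<le> sqrt n / sqrt (2 ^ q)"
    proof -
      have "real (N div 2) \<le> real n / 2 ^ q"
      proof -
        have "real (N div 2) \<le> real N" by simp
        also have "\<dots> \<le> real n / 2 ^ q" unfolding N_def using of_nat_div_le_of_nat[of n "2 ^ q"] by simp
        finally show ?thesis .
      qed
      then show ?thesis by (simp add: real_sqrt_divide[symmetric])
    qed
    also have "l2n M R \<le> sqrt n / sqrt (2 ^ q) * a q"
    proof (cases "odd N")
      case True
      then have "1 \<le> N" by (cases N) auto
      then have "2 ^ q \<le> n" unfolding N_def by (metis div_less less_one linorder_not_le)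
      then have "(2::real) ^ q \<le> n" by (metis of_nat_le_iff of_nat_numeral of_nat_power)
      then have "1 \<le> sqrt n / sqrt (2 ^ q)" by (simp add: real_sqrt_divide[symmetric])
      moreover have "l2n M R \<le> a q"
        unfolding R_def using True bdB[of "(N - 1) * 2 ^ q" "N - 1" q] by simp
      ultimately show ?thesis using a0[of q] mult_right_mono[of 1 "sqrt n / sqrt (2 ^ q)" "a q"] by linarith
    next
      case False
      then show ?thesis unfolding R_def using a0 by simp
    qed
    finally show ?thesis using a0[of q] by (simp add: mult_left_mono mult_right_mono field_simps)
  qed
  have CQ: "C Q x = 0" for x unfolding C_def using n by simp
  have tele: "S x = (S x - C 0 x) + (\<Sum>q<Q. C q x - C (Suc q) x)" for x
    using sum_lessThan_telescope'[of "\<lambda>q. C q x" Q] CQ by simp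
  have "l2n M S \<le> l2n M (\<lambda>x. S x - C 0 x) + l2n M (\<lambda>x. \<Sum>q<Q. C q x - C (Suc q) x)"
    using l2n_triangle[OF sq_integrable_diff[OF Ssq Csq[of 0]] sq_integrable_sum[of "{..<Q}" M "\<lambda>q x. C q x - C (Suc q) x"]]
      Csq tele by (simp add: sq_integrable_diff)
  also have "l2n M (\<lambda>x. \<Sum>q<Q. C q x - C (Suc q) x) \<le> (\<Sum>q<Q. l2n M (\<lambda>x. C q x - C (Suc q) x))"
    by (rule l2n_sum) (use Csq in auto)
  also have "\<dots> \<le> (\<Sum>q<Q. 3 * sqrt n * (a q / sqrt (2 ^ q)))"
    by (rule sum_mono) (rule step)
  also have "\<dots> = 3 * sqrt n * (\<Sum>q<Q. a q / sqrt (2 ^ q))"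
    by (simp add: sum_distrib_left)
  also have "l2n M (\<lambda>x. S x - C 0 x) \<le> 2 * sqrt n * (\<Sum>q<Q. a q / sqrt (2 ^ q))"
  proof (cases "n = 0")
    case False
    then have "0 < Q" using n by (cases Q) auto
    then have "a 0 / sqrt (2 ^ 0) \<le> (\<Sum>q<Q. a q / sqrt (2 ^ q))"
      by (intro member_le_sum) (use a0 in auto)
    then show ?thesis using start by (simp add: mult_left_mono order_trans)
  qed (use start in simp)
  finally show ?thesis unfolding S_def by (simp add: algebra_simps)
qed

end

section \<open>Fourth moments of bounded martingale differences\<close>

text \<open>For functions bounded everywhere all products are integrable, so moments up to the fourth can be expanded without
integrability side conditions. The measure is a parameter because measurability with respect to members of a
filtration is needed too.\<close>

definition bounded_mb :: "'a measure \<Rightarrow> ('a \<Rightarrow> real) \<Rightarrow> bool" where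
  "bounded_mb N f \<longleftrightarrow> f \<in> borel_measurable N \<and> (\<exists>K. \<forall>x. \<bar>f x\<bar> \<le> K)"

lemma bounded_mb_measurable: "bounded_mb N f \<Longrightarrow> f \<in> borel_measurable N"
  unfolding bounded_mb_def by simp

lemma bounded_mbI: "f \<in> borel_measurable N \<Longrightarrow> (\<And>x. \<bar>f x\<bar> \<le> K) \<Longrightarrow> bounded_mb N f"
  unfolding bounded_mb_def by auto

lemma bounded_mb_const [intro]: "bounded_mb N (\<lambda>x. c)"
  by (rule bounded_mbI[of _ _ "\<bar>c\<bar>"]) auto

lemma bounded_mb_add [intro]:
  assumes "bounded_mb N f" "bounded_mb N g" shows "bounded_mb N (\<lambda>x. f x + g x)"
proof -
  obtain K L where "\<And>x. \<bar>f x\<bar> \<le> K" "\<And>x. \<bar>g x\<bar> \<le> L" using assms unfolding bounded_mb_def by auto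
  then show ?thesis using assms[THEN bounded_mb_measurable]
    by (intro bounded_mbI[of _ _ "K + L"]) (auto intro: abs_triangle_ineq[THEN order_trans] add_mono)
qed

lemma bounded_mb_mult [intro]:
  assumes "bounded_mb N f" "bounded_mb N g" shows "bounded_mb N (\<lambda>x. f x * g x)"
proof -
  obtain K L where KL: "\<And>x. \<bar>f x\<bar> \<le> K" "\<And>x. \<bar>g x\<bar> \<le> L" using assms unfolding bounded_mb_def by auto
  then have "0 \<le> K" using abs_ge_zero order_trans by blast
  then show ?thesis using assms[THEN bounded_mb_measurable] KL
    by (intro bounded_mbI[of _ _ "K * L"]) (auto simp: abs_mult intro: mult_mono)
qed

lemma bounded_mb_uminus [intro]: "bounded_mb N f \<Longrightarrow> bounded_mb N (\<lambda>x. - f x)"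
  using bounded_mb_mult[OF bounded_mb_const[of N "-1"]] by simp

lemma bounded_mb_diff [intro]:
  "bounded_mb N f \<Longrightarrow> bounded_mb N g \<Longrightarrow> bounded_mb N (\<lambda>x. f x - g x)"
  using bounded_mb_add[OF _ bounded_mb_uminus, of N f g] by simp

lemma bounded_mb_divide [intro]: "bounded_mb N f \<Longrightarrow> bounded_mb N (\<lambda>x. f x / c)"
  using bounded_mb_mult[OF _ bounded_mb_const[of N "1 / c"], of f] by simp

lemma bounded_mb_power [intro]: "bounded_mb N f \<Longrightarrow> bounded_mb N (\<lambda>x. (f x) ^ k)"
  by (induction k) auto

lemma bounded_mb_abs [intro]: "bounded_mb N f \<Longrightarrow> bounded_mb N (\<lambda>x. \<bar>f x\<bar>)"
  unfolding bounded_mb_def by auto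

lemma bounded_mb_cos [intro]: "bounded_mb N f \<Longrightarrow> bounded_mb N (\<lambda>x. cos (f x))"
  by (intro bounded_mbI[of _ _ 1]) (auto dest: bounded_mb_measurable)

lemma bounded_mb_sin [intro]: "bounded_mb N f \<Longrightarrow> bounded_mb N (\<lambda>x. sin (f x))"
  by (intro bounded_mbI[of _ _ 1]) (auto dest: bounded_mb_measurable)

lemma bounded_mb_sum [intro]:
  "(\<And>i. i \<in> I \<Longrightarrow> bounded_mb N (f i)) \<Longrightarrow> bounded_mb N (\<lambda>x. \<Sum>i\<in>I. f i x)"
  by (induction I rule: infinite_finite_induct) auto

lemmas bounded_mb_intros = bounded_mb_const bounded_mb_add bounded_mb_mult bounded_mb_uminus
  bounded_mb_diff bounded_mb_divide bounded_mb_power bounded_mb_abs bounded_mb_cos bounded_mb_sin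
  bounded_mb_sum

lemma bounded_mb_mono:
  assumes "bounded_mb N f" "subalgebra H N" shows "bounded_mb H f"
  using assms measurable_from_subalg unfolding bounded_mb_def by blast

text \<open>A discrete form of integrating \<open>y' = o(s)\<close>: increments over blocks of one fixed length \<open>b\<close> that are at most
\<open>\<epsilon> b s + c\<close> add up to at most \<open>\<epsilon> n\<^sup>2 + O(n)\<close>.\<close>

lemma quadratic_ratio_tendsto_0:
  fixes y :: "nat \<Rightarrow> real"
  assumes "\<And>\<epsilon>. 0 < \<epsilon> \<Longrightarrow> \<exists>b c. 1 \<le> b \<and> (\<forall>s. \<bar>y (s + b) - y s\<bar> \<le> \<epsilon> * real b * real s + c)"
  shows "(\<lambda>n. y n / (real n)\<^sup>2) \<longlonglongrightarrow> 0"
proof (rule LIMSEQ_I)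
  fix r :: real assume "0 < r"
  then obtain b c where b: "1 \<le> b" and y: "\<And>s. \<bar>y (s + b) - y s\<bar> \<le> r / 2 * real b * real s + c"
    using assms[of "r / 2"] by auto
  have c0: "0 \<le> c" using y[of 0] by simp
  define Y where "Y = Max ((\<lambda>i. \<bar>y i\<bar>) ` {..<b})"
  have Y: "\<bar>y i\<bar> \<le> Y" if "i < b" for i
    unfolding Y_def using that by (intro Max_ge) auto
  have main: "\<bar>y n\<bar> \<le> Y + r / 2 * (real n)\<^sup>2 + c * n" for n
  proof -
    define i where "i = n mod b"
    have ib: "i < b" unfolding i_def using b by simp
    have it: "k * b + i \<le> n \<Longrightarrow> \<bar>y (k * b + i)\<bar> \<le> Y + real k * (r / 2 * real b * real n + c)" for k
    proof (induction k)
      case 0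
      then show ?case using Y[OF ib] by simp
    next
      case (Suc k)
      have "\<bar>y (k * b + i + b)\<bar> \<le> \<bar>y (k * b + i)\<bar> + (r / 2 * real b * real (k * b + i) + c)"
        using y[of "k * b + i"] by linarith
      also have "\<dots> \<le> \<bar>y (k * b + i)\<bar> + (r / 2 * real b * real n + c)"
        using Suc.prems \<open>0 < r\<close> by (intro add_mono mult_left_mono of_nat_mono order_refl) auto
      also have "\<dots> \<le> Y + real (Suc k) * (r / 2 * real b * real n + c)"
        using Suc by (simp add: field_simps)
      finally show ?case by (simp add: algebra_simps)
    qed
    define k where "k = n div b"
    have n: "k * b + i = n" unfolding k_def i_def by simp
    have "\<bar>y n\<bar> \<le> Y + real k * (r / 2 * real b * real n + c)" using it[of k] n by simp
    also have "\<dots> = Y + r / 2 * real (k * b) * real n + real k * c" by (simp add: algebra_simps)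
    also have "\<dots> \<le> Y + r / 2 * real n * real n + real n * c"
    proof -
      have "real (k * b) \<le> real n" "real k \<le> real n"
        using n b div_le_dividend[of n b] unfolding k_def
        by (intro of_nat_mono; linarith)+
      then show ?thesis using \<open>0 < r\<close> c0 by (intro add_mono mult_right_mono mult_left_mono) auto
    qed
    finally show ?thesis by (simp add: power2_eq_square algebra_simps)
  qed
  have "(\<lambda>n. Y / real n * (1 / real n) + c / real n) \<longlonglongrightarrow> 0 * 0 + 0"
    by (intro tendsto_add tendsto_mult lim_const_over_n)
  then have "(\<lambda>n. Y / (real n)\<^sup>2 + c / real n) \<longlonglongrightarrow> 0"
    by (simp add: power2_eq_square)
  then have "eventually (\<lambda>n. Y / (real n)\<^sup>2 + c / real n < r / 2) sequentially"
    using \<open>0 < r\<close> by (intro order_tendstoD(2)) auto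
  then have "eventually (\<lambda>n. norm (y n / (real n)\<^sup>2 - 0) < r) sequentially"
    using eventually_gt_at_top[of 0]
  proof eventually_elim
    case (elim n)
    have "\<bar>y n / (real n)\<^sup>2\<bar> \<le> (Y + r / 2 * (real n)\<^sup>2 + c * n) / (real n)\<^sup>2"
      using main[of n] elim(2) by (simp add: divide_right_mono)
    also have "\<dots> = r / 2 + (Y / (real n)\<^sup>2 + c / real n)"
      using elim(2) by (simp add: field_simps power2_eq_square)
    also have "\<dots> < r" using elim(1) by linarith
    finally show ?case by simp
  qed
  then show "\<exists>no. \<forall>n\<ge>no. norm (y n / (real n)\<^sup>2 - 0) < r" by (simp add: eventually_sequentially)
qed

context prob_space
begin

lemma bounded_mb_integrable: "bounded_mb M f \<Longrightarrow> integrable M f"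
  unfolding bounded_mb_def using integrable_const_bound[of f] by auto

lemma bounded_mb_sq_integrable: "bounded_mb M f \<Longrightarrow> sq_integrable M f"
  unfolding bounded_mb_def by (auto intro: sq_integrable_bounded)

end

text \<open>The filtration is indexed so that \<open>d u\<close> becomes known at time \<open>Suc u\<close> and is centred given time \<open>u\<close>.\<close>

locale bounded_martingale_differences = prob_space M for M :: "'a measure" +
  fixes d :: "nat \<Rightarrow> 'a \<Rightarrow> real" and G :: "nat \<Rightarrow> 'a measure" and \<sigma>2 :: real
  assumes sub: "\<And>k. subalgebra M (G k)"
    and mono: "\<And>j k. j \<le> k \<Longrightarrow> sets (G j) \<subseteq> sets (G k)"
    and adapted: "\<And>u. bounded_mb (G (Suc u)) (d u)"
    and centred: "\<And>u. AE x in M. real_cond_exp M (G u) (d u) x = 0"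
    and second_moment: "\<And>u. (\<integral>x. (d u x)\<^sup>2 \<partial>M) = \<sigma>2"
begin

definition mart :: "nat \<Rightarrow> 'a \<Rightarrow> real" where "mart s x = (\<Sum>u<s. d u x)"
definition incr :: "nat \<Rightarrow> nat \<Rightarrow> 'a \<Rightarrow> real" where "incr s b x = (\<Sum>u\<in>{s..<s + b}. d u x)"
definition sqs :: "nat \<Rightarrow> nat \<Rightarrow> 'a \<Rightarrow> real" where "sqs s b x = (\<Sum>u\<in>{s..<s + b}. (d u x)\<^sup>2)"

lemma sub_G: "j \<le> k \<Longrightarrow> subalgebra (G k) (G j)"
  using subalgebraI_mono[OF sub[of j] sub[of k] mono] by simp

lemma d_bounded: "bounded_mb M (d u)"
  by (rule bounded_mb_mono[OF adapted sub])

lemma d_bounded_G: "u < s \<Longrightarrow> bounded_mb (G s) (d u)"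
  by (rule bounded_mb_mono[OF adapted sub_G]) simp

lemma mart_bounded_G: "bounded_mb (G s) (mart s)"
  unfolding mart_def by (intro bounded_mb_intros d_bounded_G) simp

lemma mart_bounded: "bounded_mb M (mart s)"
  by (rule bounded_mb_mono[OF mart_bounded_G sub])

lemma incr_bounded: "bounded_mb M (incr s b)"
  unfolding incr_def by (intro bounded_mb_intros d_bounded)

lemma sqs_bounded: "bounded_mb M (sqs s b)"
  unfolding sqs_def by (intro bounded_mb_intros d_bounded)

lemma mart_add: "mart (s + b) x = mart s x + incr s b x"
  unfolding mart_def incr_def lessThan_atLeast0
  using sum.atLeastLessThan_concat[of 0 s "s + b" "\<lambda>u. d u x"] by simp

lemma orthogonal_past:
  assumes "bounded_mb (G s) g" "s \<le> u"
  shows "(\<integral>x. g x * d u x \<partial>M) = 0"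
proof -
  have g: "bounded_mb (G u) g" by (rule bounded_mb_mono[OF assms(1) sub_G[OF assms(2)]])
  show ?thesis
    by (intro cond_exp_orthogonal[OF sub _ _ _ centred[of u]] bounded_mb_sq_integrable d_bounded
        bounded_mb_measurable[OF g] bounded_mb_mono[OF g sub])
qed

lemma orthogonal_incr:
  assumes "bounded_mb (G s) g"
  shows "(\<integral>x. g x * incr s b x \<partial>M) = 0"
proof -
  have g: "bounded_mb M g" by (rule bounded_mb_mono[OF assms sub])
  have "(\<integral>x. g x * incr s b x \<partial>M) = (\<Sum>u\<in>{s..<s + b}. \<integral>x. g x * d u x \<partial>M)"
    unfolding incr_def
    by (subst sum_distrib_left, subst Bochner_Integration.integral_sum)
      (intro bounded_mb_integrable bounded_mb_intros g d_bounded refl)+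
  then show ?thesis using orthogonal_past[OF assms] by simp
qed

text \<open>Against a weight known at time \<open>s\<close>, the square of an increment after \<open>s\<close> may be replaced by the sum of the squared
differences, because all mixed products integrate to zero.\<close>

lemma integral_incr_sq:
  assumes "bounded_mb (G s) g"
  shows "(\<integral>x. g x * (incr s b x)\<^sup>2 \<partial>M) = (\<integral>x. g x * sqs s b x \<partial>M)"
proof -
  have g: "bounded_mb M g" by (rule bounded_mb_mono[OF assms sub])
  have lt: "(\<integral>x. g x * (d u x * d w x) \<partial>M) = 0" if "s \<le> u" "u < w" for u w
  proof -
    have "bounded_mb (G w) (\<lambda>x. g x * d u x)"
      using bounded_mb_mono[OF assms sub_G[of s w]] d_bounded_G[of u w] that by auto
    from orthogonal_past[OF this order_refl] show ?thesis by (simp add: mult.assoc)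
  qed
  have z: "(\<integral>x. g x * (d u x * d w x) \<partial>M) = 0" if "s \<le> u" "s \<le> w" "u \<noteq> w" for u w
    using lt[of u w] lt[of w u] that by (cases "u < w") (auto simp: mult.commute)
  have "(\<integral>x. g x * (incr s b x)\<^sup>2 \<partial>M) = (\<integral>x. (\<Sum>u\<in>{s..<s + b}. \<Sum>w\<in>{s..<s + b}. g x * (d u x * d w x)) \<partial>M)"
    unfolding incr_def power2_eq_square sum_product by (simp add: sum_distrib_left)
  also have "\<dots> = (\<Sum>u\<in>{s..<s + b}. \<Sum>w\<in>{s..<s + b}. \<integral>x. g x * (d u x * d w x) \<partial>M)"
    by (subst Bochner_Integration.integral_sum, intro bounded_mb_integrable bounded_mb_intros g d_bounded,
        intro sum.cong refl Bochner_Integration.integral_sum bounded_mb_integrable bounded_mb_intros g d_bounded)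
  also have "\<dots> = (\<Sum>u\<in>{s..<s + b}. \<Sum>w\<in>{s..<s + b}. if w = u then \<integral>x. g x * (d u x)\<^sup>2 \<partial>M else 0)"
    using z by (intro sum.cong refl) (auto simp: power2_eq_square)
  also have "\<dots> = (\<Sum>u\<in>{s..<s + b}. \<integral>x. g x * (d u x)\<^sup>2 \<partial>M)"
    by simp
  also have "\<dots> = (\<integral>x. g x * sqs s b x \<partial>M)"
    unfolding sqs_def
    by (subst sum_distrib_left, subst Bochner_Integration.integral_sum)
      (intro bounded_mb_integrable bounded_mb_intros g d_bounded refl)+
  finally show ?thesis .
qed

lemma integral_sqs: "(\<integral>x. sqs s b x \<partial>M) = b * \<sigma>2"
  unfolding sqs_def
  by (subst Bochner_Integration.integral_sum)
    (intro bounded_mb_integrable bounded_mb_intros d_bounded, simp add: second_moment)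

lemma second_moment_incr: "(\<integral>x. (incr s b x)\<^sup>2 \<partial>M) = b * \<sigma>2"
  using integral_incr_sq[OF bounded_mb_const[of _ 1], of s b] integral_sqs by simp

lemma mart_incr: "mart b = incr 0 b"
  unfolding mart_def incr_def by (simp add: lessThan_atLeast0)

lemma second_moment_mart: "(\<integral>x. (mart s x)\<^sup>2 \<partial>M) = s * \<sigma>2"
  using second_moment_incr[of 0 s] by (simp add: mart_incr)

lemma \<sigma>2_nonneg: "0 \<le> \<sigma>2"
proof -
  have "0 \<le> (\<integral>x. (d 0 x)\<^sup>2 \<partial>M)" by simp
  then show ?thesis using second_moment by simp
qed

end

locale uniformly_bounded_martingale_differences = bounded_martingale_differences M d G \<sigma>2
  for M :: "'a measure" and d G \<sigma>2 +
  fixes K :: real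
  assumes K: "\<And>u x. \<bar>d u x\<bar> \<le> K"
begin

lemma K_nonneg: "0 \<le> K"
  using K[of 0 undefined] by simp

lemma incr_le: "\<bar>incr s b x\<bar> \<le> b * K"
proof -
  have "\<bar>incr s b x\<bar> \<le> (\<Sum>u\<in>{s..<s + b}. \<bar>d u x\<bar>)" unfolding incr_def by (rule sum_abs)
  also have "\<dots> \<le> (\<Sum>u\<in>{s..<s + b}. K)" by (intro sum_mono K)
  finally show ?thesis by simp
qed

lemma sqs_le: "sqs s b x \<le> b * K\<^sup>2"
proof -
  have "sqs s b x \<le> (\<Sum>u\<in>{s..<s + b}. K\<^sup>2)"
    unfolding sqs_def by (intro sum_mono) (metis K abs_ge_zero power2_abs power_mono)
  then show ?thesis by simp
qed

lemma \<sigma>2_le: "\<sigma>2 \<le> K\<^sup>2"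
proof -
  have "\<sigma>2 = (\<integral>x. sqs 0 1 x \<partial>M)" using integral_sqs[of 0 1] by simp
  also have "\<dots> \<le> (\<integral>x. K\<^sup>2 \<partial>M)"
    using sqs_le[of 0 1] by (intro integral_mono bounded_mb_integrable sqs_bounded) auto
  finally show ?thesis by (simp add: prob_space)
qed

lemma l1_mart: "(\<integral>x. \<bar>mart s x\<bar> \<partial>M) \<le> K * sqrt s"
proof -
  have "(\<integral>x. \<bar>mart s x\<bar> \<partial>M) \<le> sqrt (s * \<sigma>2)"
    using l1_le_l2n[OF bounded_mb_sq_integrable[OF mart_bounded[of s]]] second_moment_mart[of s]
    unfolding l2n_def by simp
  also have "\<dots> \<le> sqrt (s * K\<^sup>2)" using \<sigma>2_le by (simp add: mult_left_mono)
  finally show ?thesis using K_nonneg by (simp add: real_sqrt_mult mult.commute)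
qed

text \<open>Expand the fourth power of \<open>mart s + incr s b\<close>. The linear term vanishes, the quadratic term is the main one, and the
cubic and quartic terms are small since an increment over a block of fixed length is bounded.\<close>

lemma fourth_moment_increment:
  "\<bar>(\<integral>x. (mart (s + b) x) ^ 4 \<partial>M) - (\<integral>x. (mart s x) ^ 4 \<partial>M) - 6 * (\<integral>x. (mart s x)\<^sup>2 * sqs s b x \<partial>M)\<bar>
     \<le> 4 * (b * K) ^ 3 * K * sqrt s + (b * K) ^ 4"
proof -
  define m w where "m = mart s" and "w = incr s b"
  note bm = mart_bounded[of s, folded m_def] and bw = incr_bounded[of s b, folded w_def]
  note bi = bounded_mb_integrable
  have e: "(mart (s + b) x) ^ 4 = (m x) ^ 4 + 4 * ((m x) ^ 3 * w x) + 6 * ((m x)\<^sup>2 * (w x)\<^sup>2) + 4 * (m x * (w x) ^ 3) + (w x) ^ 4" for x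
    unfolding mart_add m_def w_def by (simp add: power4_eq_xxxx power3_eq_cube power2_eq_square algebra_simps)
  have i: "integrable M (\<lambda>x. (m x) ^ 4)" "integrable M (\<lambda>x. (m x) ^ 3 * w x)" "integrable M (\<lambda>x. (m x)\<^sup>2 * (w x)\<^sup>2)"
     "integrable M (\<lambda>x. m x * (w x) ^ 3)" "integrable M (\<lambda>x. (w x) ^ 4)"
    by (intro bi bounded_mb_intros bm bw)+
  have "(\<integral>x. (mart (s + b) x) ^ 4 \<partial>M) = (\<integral>x. (m x) ^ 4 \<partial>M) + 4 * (\<integral>x. (m x) ^ 3 * w x \<partial>M)
     + 6 * (\<integral>x. (m x)\<^sup>2 * (w x)\<^sup>2 \<partial>M) + 4 * (\<integral>x. m x * (w x) ^ 3 \<partial>M) + (\<integral>x. (w x) ^ 4 \<partial>M)"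
    unfolding e using i by simp
  moreover have "(\<integral>x. (m x) ^ 3 * w x \<partial>M) = 0"
    unfolding m_def w_def by (rule orthogonal_incr) (intro bounded_mb_power mart_bounded_G)
  moreover have "(\<integral>x. (m x)\<^sup>2 * (w x)\<^sup>2 \<partial>M) = (\<integral>x. (mart s x)\<^sup>2 * sqs s b x \<partial>M)"
    unfolding m_def w_def by (rule integral_incr_sq) (intro bounded_mb_power mart_bounded_G)
  moreover have "\<bar>\<integral>x. m x * (w x) ^ 3 \<partial>M\<bar> \<le> (b * K) ^ 3 * K * sqrt s"
  proof -
    have "\<bar>\<integral>x. m x * (w x) ^ 3 \<partial>M\<bar> \<le> (\<integral>x. \<bar>m x * (w x) ^ 3\<bar> \<partial>M)"
      by (rule integral_abs_bound)
    also have "\<dots> \<le> (\<integral>x. (b * K) ^ 3 * \<bar>m x\<bar> \<partial>M)"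
    proof (rule integral_mono)
      fix x
      have "\<bar>w x\<bar> ^ 3 \<le> (b * K) ^ 3" unfolding w_def by (intro power_mono incr_le) simp
      then show "\<bar>m x * (w x) ^ 3\<bar> \<le> (b * K) ^ 3 * \<bar>m x\<bar>"
        by (simp add: abs_mult power_abs mult.commute mult_right_mono del: mult_le_cancel_right)
          (metis abs_ge_zero mult.commute mult_right_mono)
    qed (intro bi bounded_mb_intros bm bw)+
    also have "\<dots> = (b * K) ^ 3 * (\<integral>x. \<bar>m x\<bar> \<partial>M)" by simp
    also have "\<dots> \<le> (b * K) ^ 3 * (K * sqrt s)"
      unfolding m_def using K_nonneg by (intro mult_left_mono l1_mart) auto
    finally show ?thesis by (simp add: mult.assoc)
  qed
  moreover have "\<bar>\<integral>x. (w x) ^ 4 \<partial>M\<bar> \<le> (b * K) ^ 4"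
  proof -
    have "(\<integral>x. (w x) ^ 4 \<partial>M) \<le> (\<integral>x. (b * K) ^ 4 \<partial>M)"
    proof (rule integral_mono)
      fix x
      have "\<bar>w x\<bar> ^ 4 \<le> (b * K) ^ 4" unfolding w_def by (intro power_mono incr_le) simp
      then show "(w x) ^ 4 \<le> (b * K) ^ 4" by (simp add: power_even_abs)
    qed (use i in auto)
    moreover have "0 \<le> (\<integral>x. (w x) ^ 4 \<partial>M)" by simp
    ultimately show ?thesis by (simp add: prob_space)
  qed
  ultimately show ?thesis unfolding m_def by linarith
qed

lemma fourth_moment_bound: "(\<integral>x. (mart s x) ^ 4 \<partial>M) \<le> 11 * K ^ 4 * (real s)\<^sup>2"
proof (induction s)
  case 0
  then show ?case by (simp add: mart_def)
next
  case (Suc s)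
  have "(\<integral>x. (mart s x)\<^sup>2 * sqs s 1 x \<partial>M) \<le> (\<integral>x. K\<^sup>2 * (mart s x)\<^sup>2 \<partial>M)"
  proof (rule integral_mono)
    fix x show "(mart s x)\<^sup>2 * sqs s 1 x \<le> K\<^sup>2 * (mart s x)\<^sup>2"
      using mult_left_mono[OF sqs_le[of s 1 x], of "(mart s x)\<^sup>2"] by (simp add: mult.commute)
  qed (intro bounded_mb_integrable bounded_mb_intros mart_bounded sqs_bounded)+
  also have "\<dots> = K\<^sup>2 * (s * \<sigma>2)" using second_moment_mart by simp
  also have "\<dots> \<le> K\<^sup>2 * (s * K\<^sup>2)" using \<sigma>2_le by (intro mult_left_mono) auto
  finally have a: "(\<integral>x. (mart s x)\<^sup>2 * sqs s 1 x \<partial>M) \<le> s * K ^ 4"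
    by (simp add: power4_eq_xxxx power2_eq_square mult_ac)
  have "sqrt (real s) \<le> real s"
    by (cases "s = 0") (auto intro!: real_le_lsqrt simp: power2_eq_square)
  then have b: "K ^ 3 * K * sqrt s \<le> K ^ 4 * s"
    using K_nonneg by (simp add: power3_eq_cube power4_eq_xxxx mult_left_mono)
  have "(\<integral>x. (mart (s + 1) x) ^ 4 \<partial>M) \<le> (\<integral>x. (mart s x) ^ 4 \<partial>M) + 6 * (s * K ^ 4) + 4 * (K ^ 4 * s) + K ^ 4"
    using fourth_moment_increment[of s 1] a b unfolding of_nat_1 mult_1 by linarith
  also have "\<dots> \<le> 11 * K ^ 4 * (real s)\<^sup>2 + 10 * (s * K ^ 4) + K ^ 4"
    using Suc by (simp add: algebra_simps)
  also have "\<dots> \<le> 11 * K ^ 4 * (real (s + 1))\<^sup>2"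
    using K_nonneg by (simp add: power2_eq_square algebra_simps)
  finally show ?case by simp
qed

text \<open>If the squared differences obey a law of large numbers in L2, uniformly over the starting points, then the quadratic
term of the expansion over a block from \<open>s\<close> to \<open>s + b\<close> is \<open>6 s \<sigma>2 * b \<sigma>2\<close> up to \<open>o(s b)\<close>. Summing over the blocks
gives \<open>3 \<sigma>2\<^sup>2 n\<^sup>2\<close>, the fourth moment of a centred Gaussian variable of variance \<open>n \<sigma>2\<close>.\<close>

theorem fourth_moment_limit:
  assumes lln: "\<And>\<epsilon>. 0 < \<epsilon> \<Longrightarrow> \<exists>b\<ge>1. \<forall>s. l2n M (\<lambda>x. sqs s b x - b * \<sigma>2) \<le> \<epsilon> * b"
  shows "(\<lambda>n. (\<integral>x. (mart n x) ^ 4 \<partial>M) / (real n)\<^sup>2) \<longlonglongrightarrow> 3 * \<sigma>2\<^sup>2"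
proof -
  define z where "z n = (\<integral>x. (mart n x) ^ 4 \<partial>M)" for n
  define y where "y n = z n - 3 * \<sigma>2\<^sup>2 * (real n)\<^sup>2" for n
  define C where "C = sqrt (11 * K ^ 4)"
  have l2: "l2n M (\<lambda>x. (mart s x)\<^sup>2) \<le> C * s" for s
  proof (rule l2n_leI)
    have "(\<integral>x. ((mart s x)\<^sup>2)\<^sup>2 \<partial>M) = z s" unfolding z_def by simp
    then show "(\<integral>x. ((mart s x)\<^sup>2)\<^sup>2 \<partial>M) \<le> (C * s)\<^sup>2"
      using fourth_moment_bound[of s] unfolding C_def z_def by (simp add: power_mult_distrib)
  qed (simp add: C_def)
  have "(\<lambda>n. y n / (real n)\<^sup>2) \<longlonglongrightarrow> 0"
  proof (rule quadratic_ratio_tendsto_0)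
    fix \<epsilon> :: real assume e: "0 < \<epsilon>"
    \<comment> \<open>leaves one half of \<open>\<epsilon>\<close> for the cubic term of the expansion\<close>
    define \<eta> where "\<eta> = \<epsilon> / (2 * (6 * C + 1))"
    have C0: "0 \<le> C" unfolding C_def by simp
    have "0 < \<eta>" unfolding \<eta>_def using e C0 by simp
    from lln[OF this] obtain b where b: "1 \<le> b" and L: "\<And>s. l2n M (\<lambda>x. sqs s b x - b * \<sigma>2) \<le> \<eta> * b" by auto
    define A where "A = 4 * (b * K) ^ 3 * K"
    have A0: "0 \<le> A" unfolding A_def using K_nonneg by simp
    define c where "c = A\<^sup>2 / (2 * \<epsilon>) + (b * K) ^ 4 + 3 * \<sigma>2\<^sup>2 * (real b)\<^sup>2"
    have "\<bar>y (s + b) - y s\<bar> \<le> \<epsilon> * real b * real s + c" for s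
    proof -
      define I where "I = (\<integral>x. (mart s x)\<^sup>2 * sqs s b x \<partial>M)"
      have 1: "\<bar>I - s * \<sigma>2 * (b * \<sigma>2)\<bar> \<le> C * s * (\<eta> * b)"
      proof -
        have "I - s * \<sigma>2 * (b * \<sigma>2) = (\<integral>x. (mart s x)\<^sup>2 * sqs s b x \<partial>M) - (\<integral>x. (mart s x)\<^sup>2 * (b * \<sigma>2) \<partial>M)"
          unfolding I_def using second_moment_mart[of s] by simp
        also have "\<dots> = (\<integral>x. (mart s x)\<^sup>2 * (sqs s b x - b * \<sigma>2) \<partial>M)"
          by (subst Bochner_Integration.integral_diff[symmetric],
              (intro bounded_mb_integrable bounded_mb_intros mart_bounded sqs_bounded)+)
            (simp add: right_diff_distrib)
        finally have "\<bar>I - s * \<sigma>2 * (b * \<sigma>2)\<bar> \<le> l2n M (\<lambda>x. (mart s x)\<^sup>2) * l2n M (\<lambda>x. sqs s b x - b * \<sigma>2)"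
          using cauchy_schwarz_integral[of M "\<lambda>x. (mart s x)\<^sup>2" "\<lambda>x. sqs s b x - b * \<sigma>2"]
            bounded_mb_sq_integrable[OF bounded_mb_power[OF mart_bounded[of s], of 2]]
            bounded_mb_sq_integrable[OF bounded_mb_diff[OF sqs_bounded[of s b] bounded_mb_const]] by simp
        also have "\<dots> \<le> C * s * (\<eta> * b)"
          using C0 by (intro mult_mono l2 L) auto
        finally show ?thesis .
      qed
      have 2: "\<bar>z (s + b) - z s - 6 * I\<bar> \<le> A * sqrt s + (b * K) ^ 4"
        using fourth_moment_increment[of s b] unfolding z_def I_def A_def by simp
      have 3: "A * sqrt s \<le> \<epsilon> / 2 * s + A\<^sup>2 / (2 * \<epsilon>)"
      proof -
        have "0 \<le> (\<epsilon> * sqrt s - A)\<^sup>2" by simp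
        also have "\<dots> = \<epsilon>\<^sup>2 * s - 2 * \<epsilon> * (A * sqrt s) + A\<^sup>2" by (simp add: power2_diff power_mult_distrib)
        finally show ?thesis using e by (simp add: field_simps power2_eq_square)
      qed
      have 4: "y (s + b) - y s = (z (s + b) - z s - 6 * I) + 6 * (I - s * \<sigma>2 * (b * \<sigma>2)) - 3 * \<sigma>2\<^sup>2 * (real b)\<^sup>2"
        unfolding y_def by (simp add: power2_eq_square algebra_simps)
      have 5: "6 * (C * s * (\<eta> * b)) \<le> \<epsilon> / 2 * (real b * real s)"
      proof -
        have "6 * C * \<eta> \<le> (6 * C + 1) * \<eta>" using \<open>0 < \<eta>\<close> by simp
        also have "\<dots> = \<epsilon> / 2" unfolding \<eta>_def using C0 by (simp add: field_simps)
        finally have "6 * C * \<eta> * (real b * real s) \<le> \<epsilon> / 2 * (real b * real s)" by (rule mult_right_mono) simp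
        then show ?thesis by (simp add: mult_ac)
      qed
      have 6: "\<epsilon> / 2 * s \<le> \<epsilon> / 2 * (real b * real s)"
        using e b by (intro mult_left_mono) (auto simp: mult_le_cancel_right1)
      have aux: "\<bar>p + 6 * q - r\<bar> \<le> P + 6 * Q + r" if "\<bar>p\<bar> \<le> P" "\<bar>q\<bar> \<le> Q" "0 \<le> r" for p q r P Q :: real
        using that by linarith
      have "\<bar>y (s + b) - y s\<bar> \<le> A * sqrt s + (b * K) ^ 4 + 6 * (C * s * (\<eta> * b)) + 3 * \<sigma>2\<^sup>2 * (real b)\<^sup>2"
        unfolding 4 using aux[OF 2 1] by simp
      also have "\<dots> \<le> \<epsilon> * real b * real s + c"
        unfolding c_def using 3 5 6 by (simp add: mult.assoc)
      finally show ?thesis .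
    qed
    then show "\<exists>b c. 1 \<le> b \<and> (\<forall>s. \<bar>y (s + b) - y s\<bar> \<le> \<epsilon> * real b * real s + c)" using b by blast
  qed
  then have "(\<lambda>n. y n / (real n)\<^sup>2 + 3 * \<sigma>2\<^sup>2) \<longlonglongrightarrow> 0 + 3 * \<sigma>2\<^sup>2"
    by (intro tendsto_add) auto
  moreover have "eventually (\<lambda>n. y n / (real n)\<^sup>2 + 3 * \<sigma>2\<^sup>2 = z n / (real n)\<^sup>2) sequentially"
    using eventually_gt_at_top[of 0] by eventually_elim (simp add: y_def field_simps)
  ultimately show ?thesis unfolding z_def by (simp add: tendsto_cong)
qed

end

section \<open>Characteristic functions of martingale sums\<close>

lemma cos_taylor2: "\<bar>cos (a + w) - (cos a - w * sin a - w\<^sup>2 / 2 * cos a)\<bar> \<le> \<bar>w\<bar> ^ 3 / 6" for a w :: real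
proof -
  define z where "z = iexp w - (1 + \<i> * w - w\<^sup>2 / 2)"
  have "(\<Sum>k\<le>2. (\<i> * complex_of_real w) ^ k / fact k) = 1 + \<i> * w - w\<^sup>2 / 2"
    by (simp add: numeral_2_eq_2 power2_eq_square algebra_simps)
  then have "cmod z \<le> \<bar>w\<bar> ^ 3 / 6"
    using iexp_approx1[of w 2] unfolding z_def by (simp add: fact_numeral numeral_3_eq_3[symmetric])
  moreover have "\<bar>Re (iexp a * z)\<bar> \<le> cmod z"
    using abs_Re_le_cmod[of "iexp a * z"] by (simp add: norm_mult)
  moreover have "Re (iexp a * z) = cos (a + w) - (cos a - w * sin a - w\<^sup>2 / 2 * cos a)"
    unfolding z_def
    by (simp add: right_diff_distrib exp_add[symmetric] cis_conv_exp[symmetric] Re_exp Im_exp cos_add algebra_simps power2_eq_square)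
  ultimately show ?thesis by simp
qed

lemma cos_lipschitz: "\<bar>cos x - cos y\<bar> \<le> \<bar>x - y\<bar>" for x y :: real
proof -
  have "\<bar>cos x - cos y\<bar> = 2 * \<bar>sin ((x + y) / 2)\<bar> * \<bar>sin ((y - x) / 2)\<bar>"
    unfolding cos_diff_cos by (simp add: abs_mult)
  also have "\<dots> \<le> 2 * 1 * \<bar>(y - x) / 2\<bar>"
    by (intro mult_mono abs_sin_x_le_abs_x) auto
  finally show ?thesis by simp
qed

lemma exp_minus_approx: 
  fixes y :: real assumes "0 \<le> y" shows "\<bar>(1 - y) - exp (- y)\<bar> \<le> y\<^sup>2 / 2"
proof -
  have 1: "1 - y \<le> exp (- y)" using exp_ge_add_one_self[of "- y"] by simp
  define f where "f x = exp (- x) - 1 + x - x\<^sup>2 / 2" for x :: real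
  have "f y \<le> f 0"
  proof (rule DERIV_nonpos_imp_nonincreasing[OF assms])
    fix x :: real assume "0 \<le> x"
    have "(f has_real_derivative (- exp (- x) + 1 - x)) (at x)"
      unfolding f_def by (auto intro!: derivative_eq_intros)
    moreover have "- exp (- x) + 1 - x \<le> 0" using exp_ge_add_one_self[of "- x"] by simp
    ultimately show "\<exists>y. DERIV f x :> y \<and> y \<le> 0" by blast
  qed
  then show ?thesis using 1 unfolding f_def by simp
qed

lemma exp_minus_lipschitz:
  fixes u v :: real assumes "0 \<le> u" "u \<le> v" shows "\<bar>exp (- u) - exp (- v)\<bar> \<le> v - u"
proof -
  have "exp (- u) - exp (- v) = exp (- u) * (1 - exp (- (v - u)))"
    by (simp add: algebra_simps flip: exp_add)
  also have "\<dots> \<le> 1 * (v - u)"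
  proof (rule mult_mono)
    show "1 - exp (- (v - u)) \<le> v - u" using exp_ge_add_one_self[of "- (v - u)"] by linarith
  qed (use assms in auto)
  finally show ?thesis using assms by simp
qed

context bounded_martingale_differences
begin

text \<open>By \<open>\<bar>w\<bar> ^ 3 \<le> w\<^sup>2 + w ^ 4\<close> and the inequality between the quadratic and the arithmetic mean, applied twice. The bound need not
be sharp in \<open>b\<close>, because the block length stays fixed when the normalization tends to infinity.\<close>

lemma third_moment_incr:
  assumes C: "\<And>u. (\<integral>x. (d u x) ^ 4 \<partial>M) \<le> C"
  shows "(\<integral>x. \<bar>incr s b x\<bar> ^ 3 \<partial>M) \<le> b * \<sigma>2 + (real b) ^ 4 * C"
proof -
  have "(\<integral>x. \<bar>incr s b x\<bar> ^ 3 \<partial>M) \<le> (\<integral>x. (incr s b x)\<^sup>2 + (real b) ^ 3 * (\<Sum>u\<in>{s..<s + b}. (d u x) ^ 4) \<partial>M)"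
  proof (rule integral_mono)
    fix x
    define w where "w = incr s b x"
    have "\<bar>w\<bar> ^ 3 \<le> w\<^sup>2 + w ^ 4"
    proof (cases "\<bar>w\<bar> \<le> 1")
      case True
      then have "\<bar>w\<bar> ^ 3 \<le> \<bar>w\<bar> ^ 2" by (intro power_decreasing) auto
      moreover have "0 \<le> w ^ 4" by simp
      ultimately show ?thesis unfolding power2_abs by linarith
    next
      case False
      then have "\<bar>w\<bar> ^ 3 \<le> \<bar>w\<bar> ^ 4" by (intro power_increasing) auto
      moreover have "0 \<le> w\<^sup>2" "\<bar>w\<bar> ^ 4 = w ^ 4" by (simp_all add: power_even_abs)
      ultimately show ?thesis by linarith
    qed
    also have "w ^ 4 \<le> (real b) ^ 3 * (\<Sum>u\<in>{s..<s + b}. (d u x) ^ 4)"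
    proof -
      have 1: "w\<^sup>2 \<le> (\<Sum>u\<in>{s..<s + b}. (d u x)\<^sup>2) * b"
        unfolding w_def incr_def using sum_squared_le_sum_of_squares[of "\<lambda>u. d u x" "{s..<s + b}"] by simp
      have 2: "(\<Sum>u\<in>{s..<s + b}. (d u x)\<^sup>2)\<^sup>2 \<le> (\<Sum>u\<in>{s..<s + b}. ((d u x)\<^sup>2)\<^sup>2) * b"
        using sum_squared_le_sum_of_squares[of "\<lambda>u. (d u x)\<^sup>2" "{s..<s + b}"] by simp
      have "w ^ 4 = (w\<^sup>2)\<^sup>2" by simp
      also have "\<dots> \<le> ((\<Sum>u\<in>{s..<s + b}. (d u x)\<^sup>2) * b)\<^sup>2" by (intro power_mono 1) simp
      also have "\<dots> = (\<Sum>u\<in>{s..<s + b}. (d u x)\<^sup>2)\<^sup>2 * (real b)\<^sup>2" by (simp add: power_mult_distrib)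
      also have "\<dots> \<le> (\<Sum>u\<in>{s..<s + b}. ((d u x)\<^sup>2)\<^sup>2) * b * (real b)\<^sup>2"
        by (intro mult_right_mono 2) simp
      finally show ?thesis by (simp add: power2_eq_square power3_eq_cube power4_eq_xxxx mult_ac)
    qed
    finally show "\<bar>incr s b x\<bar> ^ 3 \<le> (incr s b x)\<^sup>2 + (real b) ^ 3 * (\<Sum>u\<in>{s..<s + b}. (d u x) ^ 4)"
      unfolding w_def by simp
  qed (intro bounded_mb_integrable bounded_mb_intros incr_bounded d_bounded)+
  also have "\<dots> = b * \<sigma>2 + (real b) ^ 3 * (\<Sum>u\<in>{s..<s + b}. \<integral>x. (d u x) ^ 4 \<partial>M)"
    by (subst Bochner_Integration.integral_add, (intro bounded_mb_integrable bounded_mb_intros incr_bounded d_bounded)+)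
      (simp add: second_moment_incr, subst Bochner_Integration.integral_sum,
        auto intro!: bounded_mb_integrable bounded_mb_power d_bounded)
  also have "\<dots> \<le> b * \<sigma>2 + (real b) ^ 3 * (\<Sum>u\<in>{s..<s + b}. C)"
    by (intro add_left_mono mult_left_mono sum_mono C) auto
  finally show ?thesis by (simp add: power4_eq_xxxx power3_eq_cube mult_ac)
qed

text \<open>With \<open>p = 0\<close> and \<open>p = - pi / 2\<close> this is the real and the imaginary part of the characteristic function of \<open>mart s\<close> at \<open>h\<close>.
A general phase \<open>p\<close> treats both at once with real integrals.\<close>

definition cosint :: "real \<Rightarrow> real \<Rightarrow> nat \<Rightarrow> real" where
  "cosint h p s = (\<integral>x. cos (h * mart s x + p) \<partial>M)"

lemma cos_arg_bounded: "bounded_mb (G s) (\<lambda>x. h * mart s x + p)"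
  by (intro bounded_mb_intros mart_bounded_G)

lemma cosint_le: "\<bar>cosint h p s\<bar> \<le> 1"
proof -
  have "\<bar>cosint h p s\<bar> \<le> (\<integral>x. \<bar>cos (h * mart s x + p)\<bar> \<partial>M)"
    unfolding cosint_def by (rule integral_abs_bound)
  also have "\<dots> \<le> (\<integral>x. 1 \<partial>M)"
    by (intro integral_mono bounded_mb_integrable bounded_mb_intros mart_bounded) auto
  finally show ?thesis by (simp add: prob_space)
qed

text \<open>Taylor expansion of the cosine over one block. The linear term is a martingale term and vanishes; in the
quadratic term the square of the increment becomes the sum of squares, which is close to \<open>b \<sigma>2\<close> in the mean.
So one block multiplies the integral by \<open>1 - h\<^sup>2 b \<sigma>2 / 2\<close>, that is, nearly by \<open>exp (- h\<^sup>2 b \<sigma>2 / 2)\<close>.\<close>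

lemma cosint_step:
  assumes C: "\<And>u. (\<integral>x. (d u x) ^ 4 \<partial>M) \<le> C"
    and blk: "(\<integral>x. \<bar>sqs s b x - b * \<sigma>2\<bar> \<partial>M) \<le> b * \<delta>"
  shows "\<bar>cosint h p (s + b) - exp (- (h\<^sup>2 * b * \<sigma>2 / 2)) * cosint h p s\<bar>
    \<le> h\<^sup>2 * b * \<delta> / 2 + \<bar>h\<bar> ^ 3 * (b * \<sigma>2 + (real b) ^ 4 * C) + (h\<^sup>2 * b * \<sigma>2 / 2)\<^sup>2"
proof -
  define y where "y = h\<^sup>2 * b * \<sigma>2 / 2"
  define a where "a x = h * mart s x + p" for x
  define w where "w x = incr s b x" for x
  note bd = bounded_mb_integrable bounded_mb_intros mart_bounded incr_bounded sqs_bounded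
  have y0: "0 \<le> y" unfolding y_def using \<sigma>2_nonneg by simp
  have ca: "bounded_mb (G s) (\<lambda>x. cos (a x))" "bounded_mb (G s) (\<lambda>x. sin (a x))"
    unfolding a_def by (intro bounded_mb_intros cos_arg_bounded)+
  define T where "T = (\<integral>x. cos (a x) - h * (sin (a x) * w x) - h\<^sup>2 / 2 * (cos (a x) * (w x)\<^sup>2) \<partial>M)"
  have 1: "\<bar>cosint h p (s + b) - T\<bar> \<le> \<bar>h\<bar> ^ 3 * (b * \<sigma>2 + (real b) ^ 4 * C) / 6"
  proof -
    have "cosint h p (s + b) - T = (\<integral>x. cos (a x + h * w x) - (cos (a x) - h * (sin (a x) * w x) - h\<^sup>2 / 2 * (cos (a x) * (w x)\<^sup>2)) \<partial>M)"
      unfolding cosint_def T_def a_def w_def mart_add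
      by (subst Bochner_Integration.integral_diff[symmetric], (intro bd)+) (simp add: algebra_simps)
    then have "\<bar>cosint h p (s + b) - T\<bar> \<le> (\<integral>x. \<bar>cos (a x + h * w x) - (cos (a x) - h * (sin (a x) * w x) - h\<^sup>2 / 2 * (cos (a x) * (w x)\<^sup>2))\<bar> \<partial>M)"
      by (simp only: integral_abs_bound)
    also have "\<dots> \<le> (\<integral>x. \<bar>h\<bar> ^ 3 / 6 * \<bar>w x\<bar> ^ 3 \<partial>M)"
    proof (rule integral_mono)
      fix x
      show "\<bar>cos (a x + h * w x) - (cos (a x) - h * (sin (a x) * w x) - h\<^sup>2 / 2 * (cos (a x) * (w x)\<^sup>2))\<bar> \<le> \<bar>h\<bar> ^ 3 / 6 * \<bar>w x\<bar> ^ 3"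
        using cos_taylor2[of "a x" "h * w x"] by (simp add: abs_mult power_mult_distrib mult_ac)
    qed (unfold a_def w_def, (intro bd)+)
    also have "\<dots> = \<bar>h\<bar> ^ 3 / 6 * (\<integral>x. \<bar>incr s b x\<bar> ^ 3 \<partial>M)" unfolding w_def by simp
    also have "\<dots> \<le> \<bar>h\<bar> ^ 3 / 6 * (b * \<sigma>2 + (real b) ^ 4 * C)"
      by (intro mult_left_mono third_moment_incr C) simp
    finally show ?thesis by simp
  qed
  have T: "T = cosint h p s - h\<^sup>2 / 2 * (\<integral>x. cos (a x) * sqs s b x \<partial>M)"
  proof -
    have "T = (\<integral>x. cos (a x) \<partial>M) - h * (\<integral>x. sin (a x) * w x \<partial>M) - h\<^sup>2 / 2 * (\<integral>x. cos (a x) * (w x)\<^sup>2 \<partial>M)"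
      unfolding T_def a_def w_def
      by (subst Bochner_Integration.integral_diff, (intro bd)+)+ simp
    moreover have "(\<integral>x. sin (a x) * w x \<partial>M) = 0"
      unfolding w_def by (rule orthogonal_incr[OF ca(2)])
    moreover have "(\<integral>x. cos (a x) * (w x)\<^sup>2 \<partial>M) = (\<integral>x. cos (a x) * sqs s b x \<partial>M)"
      unfolding w_def by (rule integral_incr_sq[OF ca(1)])
    ultimately show ?thesis unfolding cosint_def a_def by simp
  qed
  have 2: "\<bar>(\<integral>x. cos (a x) * sqs s b x \<partial>M) - b * \<sigma>2 * cosint h p s\<bar> \<le> b * \<delta>"
  proof -
    have "(\<integral>x. cos (a x) * sqs s b x \<partial>M) - b * \<sigma>2 * cosint h p s
      = (\<integral>x. cos (a x) * sqs s b x \<partial>M) - (\<integral>x. b * \<sigma>2 * cos (a x) \<partial>M)"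
      unfolding cosint_def a_def by simp
    also have "\<dots> = (\<integral>x. cos (a x) * (sqs s b x - b * \<sigma>2) \<partial>M)"
      unfolding a_def
      by (subst Bochner_Integration.integral_diff[symmetric], (intro bd)+) (simp add: algebra_simps)
    also have "\<bar>\<dots>\<bar> \<le> (\<integral>x. \<bar>cos (a x) * (sqs s b x - b * \<sigma>2)\<bar> \<partial>M)"
      by (rule integral_abs_bound)
    also have "\<dots> \<le> (\<integral>x. \<bar>sqs s b x - b * \<sigma>2\<bar> \<partial>M)"
    proof (rule integral_mono)
      fix x
      show "\<bar>cos (a x) * (sqs s b x - b * \<sigma>2)\<bar> \<le> \<bar>sqs s b x - b * \<sigma>2\<bar>"
        unfolding abs_mult by (rule mult_left_le_one_le) auto
    qed (unfold a_def, (intro bd)+)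
    finally show ?thesis using blk by linarith
  qed
  have 3: "\<bar>T - (1 - y) * cosint h p s\<bar> \<le> h\<^sup>2 / 2 * (b * \<delta>)"
  proof -
    have "T - (1 - y) * cosint h p s = - (h\<^sup>2 / 2) * ((\<integral>x. cos (a x) * sqs s b x \<partial>M) - b * \<sigma>2 * cosint h p s)"
      unfolding T y_def by (simp add: field_simps)
    then have "\<bar>T - (1 - y) * cosint h p s\<bar> = h\<^sup>2 / 2 * \<bar>(\<integral>x. cos (a x) * sqs s b x \<partial>M) - b * \<sigma>2 * cosint h p s\<bar>"
      by (simp add: abs_mult)
    also have "\<dots> \<le> h\<^sup>2 / 2 * (b * \<delta>)" by (rule mult_left_mono[OF 2]) simp
    finally show ?thesis .
  qed
  have 4: "\<bar>(1 - y) * cosint h p s - exp (- y) * cosint h p s\<bar> \<le> y\<^sup>2"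
  proof -
    have "\<bar>(1 - y) * cosint h p s - exp (- y) * cosint h p s\<bar> = \<bar>(1 - y) - exp (- y)\<bar> * \<bar>cosint h p s\<bar>"
      by (simp flip: abs_mult add: algebra_simps)
    also have "\<dots> \<le> (y\<^sup>2 / 2) * 1"
      by (intro mult_mono exp_minus_approx y0 cosint_le) auto
    also have "\<dots> \<le> y\<^sup>2" by simp
    finally show ?thesis .
  qed
  have C0: "0 \<le> C"
  proof -
    have "0 \<le> (\<integral>x. (d 0 x) ^ 4 \<partial>M)" by simp
    then show ?thesis using C[of 0] by linarith
  qed
  have 5: "0 \<le> \<bar>h\<bar> ^ 3 * (b * \<sigma>2 + (real b) ^ 4 * C)" using C0 \<sigma>2_nonneg by simp
  have "\<bar>cosint h p (s + b) - exp (- y) * cosint h p s\<bar> \<le> h\<^sup>2 / 2 * (b * \<delta>) + \<bar>h\<bar> ^ 3 * (b * \<sigma>2 + (real b) ^ 4 * C) / 6 + y\<^sup>2"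
    using 1 3 4 by linarith
  also have "\<dots> \<le> h\<^sup>2 * b * \<delta> / 2 + \<bar>h\<bar> ^ 3 * (b * \<sigma>2 + (real b) ^ 4 * C) + y\<^sup>2"
    using 5 by (simp add: mult_ac)
  finally show ?thesis unfolding y_def .
qed

text \<open>Iterate the block estimate over the \<open>m div b\<close> full blocks with \<open>h = t / sqrt m\<close>. The factors
\<open>exp (- h\<^sup>2 b \<sigma>2 / 2)\<close> are at most one, so errors only add up. Apart from the term with \<open>\<delta>\<close>,
which measures how well block averages of squares concentrate, they vanish as \<open>m\<close> tends to infinity with \<open>b\<close> fixed.\<close>

theorem cosint_bound:
  assumes C: "\<And>u. (\<integral>x. (d u x) ^ 4 \<partial>M) \<le> C"
    and blk: "\<And>s. (\<integral>x. \<bar>sqs s b x - b * \<sigma>2\<bar> \<partial>M) \<le> b * \<delta>"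
    and b: "1 \<le> b" and m: "1 \<le> m"
  shows "\<bar>(\<integral>x. cos (t / sqrt m * mart m x + p) \<partial>M) - exp (- (t\<^sup>2 * \<sigma>2 / 2)) * cos p\<bar>
    \<le> t\<^sup>2 * \<delta> / 2 + (\<bar>t\<bar> ^ 3 * (\<sigma>2 + (real b) ^ 3 * C) + t ^ 4 * \<sigma>2\<^sup>2 * b + \<bar>t\<bar> * sqrt (b * \<sigma>2) + t\<^sup>2 * \<sigma>2 * b) / sqrt m"
proof -
  define h where "h = t / sqrt m"
  define y where "y = h\<^sup>2 * b * \<sigma>2 / 2"
  define e where "e = h\<^sup>2 * b * \<delta> / 2 + \<bar>h\<bar> ^ 3 * (b * \<sigma>2 + (real b) ^ 4 * C) + y\<^sup>2"
  define k where "k = m div b"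
  define r where "r = m mod b"
  have mk: "m = k * b + r" unfolding k_def r_def by simp
  have rb: "r < b" unfolding r_def using b by simp
  have mp: "0 < real m" "1 \<le> sqrt (real m)" using m by auto
  have h2: "h\<^sup>2 = t\<^sup>2 / m" unfolding h_def using m by (simp add: power_divide)
  have h3: "\<bar>h\<bar> ^ 3 = \<bar>t\<bar> ^ 3 / (m * sqrt m)"
    unfolding h_def by (simp add: power_divide power3_eq_cube)
  have y0: "0 \<le> y" unfolding y_def using \<sigma>2_nonneg by simp
  have C0: "0 \<le> C"
  proof -
    have "0 \<le> (\<integral>x. (d 0 x) ^ 4 \<partial>M)" by simp
    then show ?thesis using C[of 0] by linarith
  qed
  have d0: "0 \<le> \<delta>"
  proof -
    have "0 \<le> (\<integral>x. \<bar>sqs 0 b x - b * \<sigma>2\<bar> \<partial>M)" by simp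
    then have "0 \<le> real b * \<delta>" using blk[of 0] by linarith
    then show ?thesis using b by (simp add: zero_le_mult_iff)
  qed
  have e0: "0 \<le> e" unfolding e_def using C0 d0 \<sigma>2_nonneg by simp
  have it: "\<bar>cosint h p (j * b) - exp (- (j * y)) * cos p\<bar> \<le> j * e" for j
  proof (induction j)
    case 0
    then show ?case by (simp add: cosint_def mart_def prob_space)
  next
    case (Suc j)
    have "\<bar>cosint h p (j * b + b) - exp (- y) * cosint h p (j * b)\<bar> \<le> e"
      using cosint_step[OF C blk, of h p "j * b"] unfolding e_def y_def .
    moreover have "\<bar>exp (- y) * cosint h p (j * b) - exp (- y) * (exp (- (j * y)) * cos p)\<bar> \<le> 1 * (j * e)"
      unfolding right_diff_distrib[symmetric] abs_mult
      by (rule mult_mono) (use y0 Suc in auto)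
    moreover have "exp (- y) * (exp (- (j * y)) * cos p) = exp (- (real (Suc j) * y)) * cos p"
      by (simp add: algebra_simps flip: exp_add)
    ultimately have "\<bar>cosint h p (j * b + b) - exp (- (real (Suc j) * y)) * cos p\<bar> \<le> e + j * e" by linarith
    then show ?case by (simp add: algebra_simps)
  qed
  have 1: "\<bar>cosint h p m - cosint h p (k * b)\<bar> \<le> \<bar>t\<bar> * sqrt (b * \<sigma>2) / sqrt m"
  proof -
    note bd = bounded_mb_integrable bounded_mb_intros mart_bounded incr_bounded
    have "cosint h p m - cosint h p (k * b) = (\<integral>x. cos (h * mart m x + p) - cos (h * mart (k * b) x + p) \<partial>M)"
      unfolding cosint_def by (subst Bochner_Integration.integral_diff, (intro bd)+) simp
    also have "\<bar>\<dots>\<bar> \<le> (\<integral>x. \<bar>cos (h * mart m x + p) - cos (h * mart (k * b) x + p)\<bar> \<partial>M)"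
      by (rule integral_abs_bound)
    also have "\<dots> \<le> (\<integral>x. \<bar>h\<bar> * \<bar>incr (k * b) r x\<bar> \<partial>M)"
    proof (rule integral_mono)
      fix x
      have "\<bar>cos (h * mart m x + p) - cos (h * mart (k * b) x + p)\<bar> \<le> \<bar>(h * mart m x + p) - (h * mart (k * b) x + p)\<bar>"
        by (rule cos_lipschitz)
      also have "(h * mart m x + p) - (h * mart (k * b) x + p) = h * incr (k * b) r x"
        unfolding mk mart_add by (simp add: algebra_simps)
      finally show "\<bar>cos (h * mart m x + p) - cos (h * mart (k * b) x + p)\<bar> \<le> \<bar>h\<bar> * \<bar>incr (k * b) r x\<bar>"
        by (simp add: abs_mult)
    qed (intro bd)+
    also have "\<dots> = \<bar>h\<bar> * (\<integral>x. \<bar>incr (k * b) r x\<bar> \<partial>M)" by simp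
    also have "\<dots> \<le> \<bar>h\<bar> * sqrt (b * \<sigma>2)"
    proof (rule mult_left_mono)
      have "(\<integral>x. \<bar>incr (k * b) r x\<bar> \<partial>M) \<le> sqrt (r * \<sigma>2)"
        using l1_le_l2n[OF bounded_mb_sq_integrable[OF incr_bounded[of "k * b" r]]] second_moment_incr[of "k * b" r]
        unfolding l2n_def by simp
      also have "\<dots> \<le> sqrt (b * \<sigma>2)" using rb \<sigma>2_nonneg by (simp add: mult_right_mono)
      finally show "(\<integral>x. \<bar>incr (k * b) r x\<bar> \<partial>M) \<le> sqrt (b * \<sigma>2)" .
    qed simp
    finally show ?thesis unfolding h_def by simp
  qed
  have 2: "\<bar>exp (- (k * y)) * cos p - exp (- (t\<^sup>2 * \<sigma>2 / 2)) * cos p\<bar> \<le> t\<^sup>2 * \<sigma>2 * b / sqrt m"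
  proof -
    have ky: "k * y = t\<^sup>2 * \<sigma>2 / 2 * ((k * b) / m)"
      unfolding y_def h2 by (simp add: field_simps)
    have kbm: "real (k * b) / m \<le> 1" using mk mp by (simp add: divide_le_eq)
    have kle: "k * y \<le> t\<^sup>2 * \<sigma>2 / 2"
      unfolding ky using kbm \<sigma>2_nonneg by (intro mult_left_le) auto
    have "\<bar>exp (- (k * y)) * cos p - exp (- (t\<^sup>2 * \<sigma>2 / 2)) * cos p\<bar> = \<bar>exp (- (k * y)) - exp (- (t\<^sup>2 * \<sigma>2 / 2))\<bar> * \<bar>cos p\<bar>"
      by (simp flip: abs_mult add: algebra_simps)
    also have "\<dots> \<le> (t\<^sup>2 * \<sigma>2 / 2 - k * y) * 1"
      using kle y0 by (intro mult_mono exp_minus_lipschitz) auto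
    also have "\<dots> = t\<^sup>2 * \<sigma>2 / 2 * (r / m)"
    proof -
      have "real r / m = 1 - real (k * b) / m" using mk mp by (simp add: field_simps)
      then show ?thesis unfolding ky by (simp only:) (simp add: algebra_simps)
    qed
    also have "\<dots> \<le> t\<^sup>2 * \<sigma>2 * (b / sqrt m)"
    proof (intro mult_mono frac_le)
      show "sqrt (real m) \<le> real m" using mp
        by (metis less_eq_real_def mult_right_mono mult_1 order_less_le_trans real_sqrt_gt_zero real_sqrt_mult_self abs_of_nonneg)
    qed (use rb mp \<sigma>2_nonneg in auto)
    finally show ?thesis by simp
  qed
  have 3: "k * e \<le> t\<^sup>2 * \<delta> / 2 + (\<bar>t\<bar> ^ 3 * (\<sigma>2 + (real b) ^ 3 * C) + t ^ 4 * \<sigma>2\<^sup>2 * b) / sqrt m"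
  proof -
    have "k * e \<le> m / b * e"
      using e0 mk b by (intro mult_right_mono) (auto simp: field_simps)
    also have "\<dots> = t\<^sup>2 * \<delta> / 2 + \<bar>t\<bar> ^ 3 * (\<sigma>2 + (real b) ^ 3 * C) / sqrt m + t ^ 4 * \<sigma>2\<^sup>2 * b / 4 / m"
    proof -
      have a1: "m / b * (h\<^sup>2 * b * \<delta> / 2) = t\<^sup>2 * \<delta> / 2" unfolding h2 using b mp by (simp add: field_simps)
      have a2: "m / b * (\<bar>h\<bar> ^ 3 * (b * \<sigma>2 + (real b) ^ 4 * C)) = \<bar>t\<bar> ^ 3 * (\<sigma>2 + (real b) ^ 3 * C) / sqrt m"
      proof -
        have "b * \<sigma>2 + (real b) ^ 4 * C = b * (\<sigma>2 + (real b) ^ 3 * C)"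
          by (simp add: power4_eq_xxxx power3_eq_cube algebra_simps)
        then show ?thesis unfolding h3 using b mp by (simp only:) (simp add: divide_simps)
      qed
      have a3: "m / b * y\<^sup>2 = t ^ 4 * \<sigma>2\<^sup>2 * b / 4 / m"
        unfolding y_def h2 using b mp by (simp add: field_simps power2_eq_square power4_eq_xxxx)
      have "m / b * e = m / b * (h\<^sup>2 * b * \<delta> / 2) + m / b * (\<bar>h\<bar> ^ 3 * (b * \<sigma>2 + (real b) ^ 4 * C)) + m / b * y\<^sup>2"
        unfolding e_def by (simp only: distrib_left)
      then show ?thesis unfolding a1 a2 a3 .
    qed
    also have "t ^ 4 * \<sigma>2\<^sup>2 * b / 4 / m \<le> t ^ 4 * \<sigma>2\<^sup>2 * b / sqrt m"
    proof (intro frac_le)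
      show "sqrt (real m) \<le> real m" using mp
        by (metis less_eq_real_def mult_right_mono mult_1 order_less_le_trans real_sqrt_gt_zero real_sqrt_mult_self abs_of_nonneg)
      show "t ^ 4 * \<sigma>2\<^sup>2 * b / 4 \<le> t ^ 4 * \<sigma>2\<^sup>2 * b" by simp
    qed (use mp in auto)
    finally show ?thesis by (simp add: add_divide_distrib)
  qed
  have "\<bar>cosint h p m - exp (- (t\<^sup>2 * \<sigma>2 / 2)) * cos p\<bar> \<le> \<bar>t\<bar> * sqrt (b * \<sigma>2) / sqrt m + k * e + t\<^sup>2 * \<sigma>2 * b / sqrt m"
    using 1 2 it[of k] by linarith
  then show ?thesis using 3 unfolding cosint_def h_def by (simp add: add_divide_distrib)
qed

end

section \<open>The mean ergodic theorem\<close>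

locale measure_preserving_map = prob_space M for M :: "'a measure" +
  fixes T :: "'a \<Rightarrow> 'a"
  assumes T_measurable [measurable]: "T \<in> M \<rightarrow>\<^sub>M M" and T_distr: "distr M M T = M"
begin

lemma T_pow_measurable [measurable]: "T ^^ i \<in> M \<rightarrow>\<^sub>M M"
  by (induction i) (auto intro: measurable_comp[OF _ T_measurable])

lemma integral_T:
  fixes g :: "'a \<Rightarrow> real"
  assumes "g \<in> borel_measurable M" shows "(\<integral>x. g (T x) \<partial>M) = (\<integral>x. g x \<partial>M)"
  using integral_distr[OF T_measurable assms] T_distr by simp

lemma integral_T_pow:
  fixes g :: "'a \<Rightarrow> real"
  assumes "g \<in> borel_measurable M" shows "(\<integral>x. g ((T ^^ i) x) \<partial>M) = (\<integral>x. g x \<partial>M)"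
proof (induction i)
  case (Suc i)
  have "(\<lambda>x. g ((T ^^ i) x)) \<in> borel_measurable M" using assms by measurable
  then show ?case using Suc integral_T[of "\<lambda>x. g ((T ^^ i) x)"] by (simp add: funpow_swap1)
qed simp

definition ave :: "('a \<Rightarrow> real) \<Rightarrow> nat \<Rightarrow> 'a \<Rightarrow> real" where
  "ave h n x = (\<Sum>i<n. h ((T ^^ i) x)) / n"

lemma bounded_T_pow: "bounded_mb M h \<Longrightarrow> bounded_mb M (\<lambda>x. h ((T ^^ i) x))"
  unfolding bounded_mb_def by auto

lemma bounded_ave: "bounded_mb M h \<Longrightarrow> bounded_mb M (ave h n)"
  unfolding ave_def by (intro bounded_mb_intros bounded_T_pow)

lemma ave_le:
  assumes "\<And>x. \<bar>h x\<bar> \<le> K" shows "\<bar>ave h n x\<bar> \<le> K"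
proof -
  have K0: "0 \<le> K" using assms[of x] by linarith
  have "\<bar>\<Sum>i<n. h ((T ^^ i) x)\<bar> \<le> (\<Sum>i<n. K)"
    by (rule order_trans[OF sum_abs sum_mono]) (rule assms)
  then show ?thesis using K0 unfolding ave_def
    by (cases "n = 0") (simp_all add: abs_divide divide_le_eq mult.commute)
qed

lemma ave_shift:
  assumes K: "\<And>x. \<bar>h x\<bar> \<le> K"
  shows "\<bar>ave h n (T x) - ave h n x\<bar> \<le> 2 * K / n"
proof -
  have "(\<Sum>i<n. h ((T ^^ i) (T x))) - (\<Sum>i<n. h ((T ^^ i) x)) = h ((T ^^ n) x) - h x"
    using sum_lessThan_telescope[of "\<lambda>i. h ((T ^^ i) x)" n] by (simp add: sum_subtractf funpow_swap1)
  moreover have "\<bar>h ((T ^^ n) x) - h x\<bar> \<le> 2 * K" using K[of "(T ^^ n) x"] K[of x] by linarith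
  ultimately have "\<bar>((\<Sum>i<n. h ((T ^^ i) (T x))) - (\<Sum>i<n. h ((T ^^ i) x))) / n\<bar> \<le> 2 * K / n"
    by (simp add: divide_right_mono)
  then show ?thesis unfolding ave_def by (simp add: diff_divide_distrib)
qed

lemma ave_shift_pow:
  assumes K: "\<And>x. \<bar>h x\<bar> \<le> K"
  shows "\<bar>ave h n ((T ^^ i) x) - ave h n x\<bar> \<le> i * (2 * K / n)"
proof (induction i)
  case (Suc i)
  have "\<bar>ave h n (T ((T ^^ i) x)) - ave h n ((T ^^ i) x)\<bar> \<le> 2 * K / n" by (rule ave_shift[where h=h, OF K])
  then have "\<bar>ave h n ((T ^^ Suc i) x) - ave h n x\<bar> \<le> i * (2 * K / n) + 2 * K / n"
    using Suc by simp
  also have "\<dots> = real (Suc i) * (2 * K / n)" by (simp add: algebra_simps add_divide_distrib)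
  finally show ?case .
qed simp

lemma ave_ave:
  assumes K: "\<And>x. \<bar>h x\<bar> \<le> K" and m: "1 \<le> m"
  shows "\<bar>ave (ave h m) n x - ave h n x\<bar> \<le> 2 * K * m / n"
proof -
  have K0: "0 \<le> K" using K[of x] by linarith
  have "ave (ave h m) n x = (\<Sum>j<m. ave h n ((T ^^ j) x)) / m"
    unfolding ave_def sum_divide_distrib[symmetric]
    by (subst sum.swap) (simp add: funpow_add[symmetric, THEN fun_cong, unfolded comp_def] add.commute)
  then have "ave (ave h m) n x - ave h n x = (\<Sum>j<m. ave h n ((T ^^ j) x) - ave h n x) / m"
    using m by (simp add: sum_subtractf diff_divide_distrib)
  also have "\<bar>\<dots>\<bar> \<le> (\<Sum>j<m. m * (2 * K / n)) / m"
    unfolding abs_divide abs_of_nat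
  proof (intro divide_right_mono order_trans[OF sum_abs sum_mono])
    fix j assume "j \<in> {..<m}"
    then have "j * (2 * K / n) \<le> m * (2 * K / n)" using K0 by (intro mult_right_mono) auto
    then show "\<bar>ave h n ((T ^^ j) x) - ave h n x\<bar> \<le> m * (2 * K / n)"
      using ave_shift_pow[where h=h and n=n and i=j and x=x, OF K] by linarith
  qed simp
  also have "\<dots> = 2 * K * m / n" using m by simp
  finally show ?thesis .
qed

lemma l2n_T_pow:
  assumes "g \<in> borel_measurable M" shows "l2n M (\<lambda>x. g ((T ^^ i) x)) = l2n M g"
  unfolding l2n_def using integral_T_pow[of "\<lambda>x. (g x)\<^sup>2" i] assms by simp

lemma l2n_ave_le:
  assumes g: "bounded_mb M g" shows "l2n M (ave g n) \<le> l2n M g"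
proof (cases "n = 0")
  case False
  have e: "ave g n = (\<lambda>x. 1 / n * (\<Sum>i<n. g ((T ^^ i) x)))" unfolding ave_def by auto
  have "l2n M (\<lambda>x. \<Sum>i<n. g ((T ^^ i) x)) \<le> (\<Sum>i<n. l2n M (\<lambda>x. g ((T ^^ i) x)))"
    by (intro l2n_sum bounded_mb_sq_integrable bounded_T_pow g)
  also have "\<dots> = n * l2n M g" using bounded_mb_measurable[OF g] by (simp add: l2n_T_pow)
  finally show ?thesis unfolding e l2n_cmult using False by (simp add: field_simps)
qed (simp add: ave_def l2n_def)

lemma l2n_bound:
  assumes "bounded_mb M g" "\<And>x. \<bar>g x\<bar> \<le> c" shows "l2n M g \<le> c"
proof (rule l2n_leI)
  show "0 \<le> c" using assms(2)[of undefined] by linarith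
  have "(\<integral>x. (g x)\<^sup>2 \<partial>M) \<le> (\<integral>x. c\<^sup>2 \<partial>M)"
  proof (rule integral_mono)
    fix x show "(g x)\<^sup>2 \<le> c\<^sup>2" using assms(2)[of x] by (metis abs_ge_zero power2_abs power_mono)
  qed (use assms in \<open>auto intro!: bounded_mb_integrable bounded_mb_power\<close>)
  then show "(\<integral>x. (g x)\<^sup>2 \<partial>M) \<le> c\<^sup>2" by (simp add: prob_space)
qed

text \<open>Let \<open>p\<close> be the infimum of the norms of the averages. Averaging is a contraction that changes a long average little, so the norms
converge to \<open>p\<close> and the midpoint of two averages has norm at least \<open>p\<close> as well. The parallelogram law
then makes two late averages close to each other.\<close>

lemma ave_L2_Cauchy:
  assumes h: "bounded_mb M h" and e: "0 < e"
  shows "\<exists>N\<ge>1. \<forall>n\<ge>N. \<forall>m\<ge>N. l2n M (\<lambda>x. ave h n x - ave h m x) < e"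
proof -
  obtain K where K: "\<And>x. \<bar>h x\<bar> \<le> K" using h unfolding bounded_mb_def by auto
  have K0: "0 \<le> K" using K[of undefined] by linarith
  note b = bounded_ave[OF h]
  note sq = bounded_mb_sq_integrable
  have key: "l2n M (ave h n) \<le> l2n M (\<lambda>x. (ave h m x + ave h k x) / 2) + 2 * K * (m + k) / n"
    if "1 \<le> m" "1 \<le> k" for n m k
  proof -
    define g where "g x = (ave h m x + ave h k x) / 2" for x
    have gb: "bounded_mb M g" unfolding g_def by (intro bounded_mb_intros b)
    have gave: "ave g n x = (ave (ave h m) n x + ave (ave h k) n x) / 2" for x
      unfolding ave_def[of g] ave_def[of "ave h m"] ave_def[of "ave h k"] g_def
      by (simp add: sum_divide_distrib[symmetric] sum.distrib add_divide_distrib)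
    have aux: "\<bar>c - (a + b) / 2\<bar> \<le> A + B" if "\<bar>a - c\<bar> \<le> A" "\<bar>b - c\<bar> \<le> B" for a b c A B :: real
      using that unfolding abs_le_iff by (auto simp: field_simps)
    have "l2n M (\<lambda>x. ave h n x - ave g n x) \<le> 2 * K * (m + k) / n"
    proof (rule l2n_bound)
      fix x
      have "\<bar>ave h n x - ave g n x\<bar> \<le> 2 * K * m / n + 2 * K * k / n"
        unfolding gave
        by (rule aux[OF ave_ave[where h=h and n=n and x=x, OF K that(1)] ave_ave[where h=h and n=n and x=x, OF K that(2)]])
      then show "\<bar>ave h n x - ave g n x\<bar> \<le> 2 * K * (m + k) / n"
        by (simp add: add_divide_distrib distrib_left)
    qed (intro bounded_mb_intros bounded_ave gb h)
    moreover have "l2n M (ave g n) \<le> l2n M g" by (rule l2n_ave_le[OF gb])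
    moreover have "l2n M (ave h n) \<le> l2n M (\<lambda>x. ave h n x - ave g n x) + l2n M (ave g n)"
      using l2n_triangle[of M "\<lambda>x. ave h n x - ave g n x" "ave g n"]
      by (simp add: sq bounded_mb_diff b bounded_ave[OF gb])
    ultimately show ?thesis unfolding g_def by linarith
  qed
  define p where "p = (INF n\<in>{1::nat..}. l2n M (ave h n))"
  have bdd: "bdd_below ((\<lambda>n. l2n M (ave h n)) ` {1..})" by (rule bdd_belowI2[of _ 0]) simp
  have p_le: "p \<le> l2n M (ave h n)" if "1 \<le> n" for n
    unfolding p_def using that bdd by (intro cINF_lower) auto
  have p0: "0 \<le> p" unfolding p_def by (rule cINF_greatest) auto
  have half: "p \<le> l2n M (\<lambda>x. (ave h m x + ave h k x) / 2)" if "1 \<le> m" "1 \<le> k" for m k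
  proof (rule LIMSEQ_le_const)
    show "(\<lambda>n. l2n M (\<lambda>x. (ave h m x + ave h k x) / 2) + 2 * K * (m + k) / real n) \<longlonglongrightarrow> l2n M (\<lambda>x. (ave h m x + ave h k x) / 2)"
      using tendsto_add[OF tendsto_const lim_const_over_n[of "2 * K * (m + k)"]] by simp
    show "\<exists>N. \<forall>n\<ge>N. p \<le> l2n M (\<lambda>x. (ave h m x + ave h k x) / 2) + 2 * K * (m + k) / real n"
      using key[OF that] p_le order_trans by blast
  qed
  \<comment> \<open>chosen so that \<open>2 (p + \<delta>)\<^sup>2 + 2 (p + \<delta>)\<^sup>2 - 4 p\<^sup>2 < e\<^sup>2\<close> in the parallelogram law\<close>
  define \<delta> where "\<delta> = e\<^sup>2 / (4 * (2 * p + 1) + e\<^sup>2)"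
  have dp: "0 < \<delta>" "\<delta> \<le> 1" "4 * (\<delta> * (2 * p + 1)) < e\<^sup>2"
  proof -
    have q: "0 < 4 * (2 * p + 1) + e\<^sup>2" using p0 e by (intro add_pos_pos) auto
    show "0 < \<delta>" unfolding \<delta>_def using q e by simp
    show "\<delta> \<le> 1" unfolding \<delta>_def using q p0 by (simp add: divide_le_eq)
    have "e\<^sup>2 * (4 * (2 * p + 1)) < e\<^sup>2 * (4 * (2 * p + 1) + e\<^sup>2)" using e by simp
    then show "4 * (\<delta> * (2 * p + 1)) < e\<^sup>2"
      unfolding \<delta>_def using q by (simp add: divide_less_eq algebra_simps)
  qed
  have "p < p + \<delta> / 2" using dp by simp
  then obtain m where m: "1 \<le> m" "l2n M (ave h m) < p + \<delta> / 2"
    using cINF_less_iff[OF _ bdd, of "p + \<delta> / 2"] unfolding p_def[symmetric] by auto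
  have "eventually (\<lambda>n. 2 * K * (m + m) / real n < \<delta> / 2) sequentially"
    using order_tendstoD(2)[OF lim_const_over_n[of "2 * K * (m + m)"], of "\<delta> / 2"] dp by simp
  then obtain N where N: "\<And>n. n \<ge> N \<Longrightarrow> 2 * K * (m + m) / real n < \<delta> / 2"
    unfolding eventually_sequentially by blast
  have small: "l2n M (ave h n) < p + \<delta>" if "n \<ge> N" for n
    using key[OF m(1) m(1), of n] m(2) N[OF that] by simp
  have "l2n M (\<lambda>x. ave h n x - ave h k x) < e" if "n \<ge> max 1 N" "k \<ge> max 1 N" for n k
  proof -
    have par: "(l2n M (\<lambda>x. ave h n x - ave h k x))\<^sup>2 = 2 * (l2n M (ave h n))\<^sup>2 + 2 * (l2n M (ave h k))\<^sup>2
       - 4 * (l2n M (\<lambda>x. (ave h n x + ave h k x) / 2))\<^sup>2"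
    proof -
      have i: "integrable M (\<lambda>x. (ave h n x)\<^sup>2)" "integrable M (\<lambda>x. (ave h k x)\<^sup>2)"
        "integrable M (\<lambda>x. ((ave h n x + ave h k x) / 2)\<^sup>2)"
        by (intro bounded_mb_integrable bounded_mb_intros b)+
      have "(\<integral>x. (ave h n x - ave h k x)\<^sup>2 \<partial>M) = (\<integral>x. 2 * (ave h n x)\<^sup>2 + 2 * (ave h k x)\<^sup>2
        - 4 * ((ave h n x + ave h k x) / 2)\<^sup>2 \<partial>M)"
        by (rule Bochner_Integration.integral_cong) (auto simp: power2_eq_square field_simps)
      then show ?thesis unfolding l2n_sq using i by simp
    qed
    have s: "(l2n M (ave h j))\<^sup>2 \<le> p\<^sup>2 + \<delta> * (2 * p + 1)" if "j \<ge> N" for j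
    proof -
      have "(l2n M (ave h j))\<^sup>2 \<le> (p + \<delta>)\<^sup>2" using small[OF that] by (intro power_mono) auto
      also have "\<dots> = p\<^sup>2 + \<delta> * (2 * p + \<delta>)" by (simp add: power2_eq_square algebra_simps)
      also have "\<dots> \<le> p\<^sup>2 + \<delta> * (2 * p + 1)" using dp by (intro add_left_mono mult_left_mono) auto
      finally show ?thesis .
    qed
    have "p\<^sup>2 \<le> (l2n M (\<lambda>x. (ave h n x + ave h k x) / 2))\<^sup>2"
      using half[of n k] p0 that by (intro power_mono) auto
    then have "(l2n M (\<lambda>x. ave h n x - ave h k x))\<^sup>2 \<le> 4 * (\<delta> * (2 * p + 1))"
      unfolding par using s[of n] s[of k] that by simp
    also have "\<dots> < e\<^sup>2" by (rule dp(3))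
    finally show ?thesis using e by (metis less_eq_real_def power2_less_imp_less)
  qed
  then show ?thesis by (intro exI[of _ "max 1 N"]) auto
qed

text \<open>Along a fast subsequence the averages converge almost surely. Averages at \<open>x\<close> and at \<open>T x\<close> differ by \<open>2 K / n\<close>, so the function
\<open>lim\<close> of the subsequence is invariant at every point, including those where the sequence diverges and \<open>lim\<close> is a default value;
no correction on a null set is needed before ergodicity is applied to its level sets.\<close>

theorem mean_ergodic:
  assumes erg: "ergodic M T" and h: "bounded_mb M h" and e: "0 < e"
  shows "\<exists>b\<ge>1. l2n M (\<lambda>x. ave h b x - (\<integral>x. h x \<partial>M)) \<le> e"
proof -
  obtain K where K: "\<And>x. \<bar>h x\<bar> \<le> K" using h unfolding bounded_mb_def by auto
  have K0: "0 \<le> K" using K[of undefined] by linarith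
  note b = bounded_ave[OF h]
  have "\<exists>N\<ge>1. \<forall>n\<ge>N. \<forall>m\<ge>N. l2n M (\<lambda>x. ave h n x - ave h m x) < (1 / 2) ^ k" for k
    by (rule ave_L2_Cauchy[OF h]) simp
  then obtain N where N: "\<And>k. 1 \<le> N k" "\<And>k n m. N k \<le> n \<Longrightarrow> N k \<le> m \<Longrightarrow> l2n M (\<lambda>x. ave h n x - ave h m x) < (1 / 2) ^ k"
    by metis
  \<comment> \<open>a nondecreasing choice of indices with \<open>r k \<ge> N k\<close> and \<open>r k \<ge> k\<close>\<close>
  define r where "r k = k + (\<Sum>j\<le>k. N j)" for k
  have rN: "N k \<le> r k" for k
    unfolding r_def using member_le_sum[of k "{..k}" N] by simp
  have rk: "r k \<ge> k" for k unfolding r_def by simp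
  have r_mono: "r k \<le> r (Suc k)" for k unfolding r_def by simp
  have r1: "1 \<le> r k" for k using N(1)[of k] rN[of k] by linarith
  define Y where "Y k x = ave h (r k) x" for k x
  have Yb: "bounded_mb M (Y k)" for k unfolding Y_def using b .
  have Ym [measurable]: "Y k \<in> borel_measurable M" for k by (rule bounded_mb_measurable[OF Yb])
  have YK: "\<bar>Y k x\<bar> \<le> K" for k x unfolding Y_def by (rule ave_le[where h=h, OF K])
  have conv: "AE x in M. convergent (\<lambda>k. Y k x)"
  proof -
    have i: "integrable M (\<lambda>x. Y (Suc k) x - Y k x)" for k
      by (intro bounded_mb_integrable bounded_mb_intros Yb)
    have l1: "(\<integral>x. norm (Y (Suc k) x - Y k x) \<partial>M) \<le> (1 / 2) ^ k" for k
    proof -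
      have "(\<integral>x. \<bar>Y (Suc k) x - Y k x\<bar> \<partial>M) \<le> l2n M (\<lambda>x. Y (Suc k) x - Y k x)"
        by (intro l1_le_l2n bounded_mb_sq_integrable bounded_mb_intros Yb)
      also have "\<dots> < (1 / 2) ^ k"
        unfolding Y_def using rN[of k] r_mono[of k] by (intro N(2)) auto
      finally show ?thesis by simp
    qed
    have "(\<Sum>k. \<integral>\<^sup>+x. ennreal (norm (Y (Suc k) x - Y k x)) \<partial>M) \<le> (\<Sum>k. ennreal ((1 / 2) ^ k))"
    proof (rule suminf_le)
      fix k
      show "(\<integral>\<^sup>+x. ennreal (norm (Y (Suc k) x - Y k x)) \<partial>M) \<le> ennreal ((1 / 2) ^ k)"
        using l1[of k] i[of k] by (subst nn_integral_eq_integral) (auto intro: ennreal_leI)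
    qed auto
    also have "\<dots> = ennreal (\<Sum>k. (1 / 2) ^ k)"
      by (intro suminf_ennreal2) auto
    also have "\<dots> < \<infinity>" by simp
    finally have "(\<integral>\<^sup>+x. (\<Sum>k. ennreal (norm (Y (Suc k) x - Y k x))) \<partial>M) < \<infinity>"
      by (subst nn_integral_suminf) auto
    then have "AE x in M. (\<Sum>k. ennreal (norm (Y (Suc k) x - Y k x))) \<noteq> \<infinity>"
      by (intro nn_integral_PInf_AE) auto
    then show ?thesis
    proof eventually_elim
      case (elim x)
      have "summable (\<lambda>k. norm (Y (Suc k) x - Y k x))"
        by (rule summable_suminf_not_top) (use elim in auto)
      then have "summable (\<lambda>k. Y (Suc k) x - Y k x)" by (rule summable_norm_cancel)
      then have "convergent (\<lambda>n. \<Sum>k<n. Y (Suc k) x - Y k x)" by (simp add: summable_iff_convergent)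
      then have "convergent (\<lambda>n. Y n x - Y 0 x)" by (simp add: sum_lessThan_telescope[where f="\<lambda>k. Y k x"])
      from convergent_add[OF this convergent_const[of "Y 0 x"]] show ?case by simp
    qed
  qed
  define L where "L x = lim (\<lambda>k. Y k x)" for x
  have Lm [measurable]: "L \<in> borel_measurable M" unfolding L_def by measurable
  have YL: "AE x in M. (\<lambda>k. Y k x) \<longlonglongrightarrow> L x"
    using conv unfolding L_def by eventually_elim (simp add: convergent_LIMSEQ_iff)
  have LK: "AE x in M. \<bar>L x\<bar> \<le> K"
    using YL
  proof eventually_elim
    case (elim x)
    from tendsto_rabs[OF this] show ?case by (rule LIMSEQ_le_const2) (use YK in auto)
  qed
  have Li: "integrable M L" using LK by (intro integrable_const_bound[of _ K]) auto
  have invL: "L (T x) = L x" for x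
  proof -
    have z: "(\<lambda>k. Y k (T x) - Y k x) \<longlonglongrightarrow> 0"
    proof (rule Lim_null_comparison)
      show "eventually (\<lambda>k. norm (Y k (T x) - Y k x) \<le> 2 * K / real k) sequentially"
        using eventually_gt_at_top[of 0]
      proof eventually_elim
        case (elim k)
        have "\<bar>Y k (T x) - Y k x\<bar> \<le> 2 * K / real (r k)" unfolding Y_def by (rule ave_shift[where h=h, OF K])
        also have "\<dots> \<le> 2 * K / real k" using elim rk[of k] K0 by (intro divide_left_mono mult_pos_pos) auto
        finally show ?case by simp
      qed
      show "(\<lambda>k. 2 * K / real k) \<longlonglongrightarrow> 0" by (rule lim_const_over_n)
    qed
    have "(\<lambda>k. Y k (T x)) \<longlonglongrightarrow> l \<longleftrightarrow> (\<lambda>k. Y k x) \<longlonglongrightarrow> l" for l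
      using tendsto_add[OF z, of "\<lambda>k. Y k x" l] tendsto_diff[OF _ z, of "\<lambda>k. Y k (T x)" l] by auto
    then show ?thesis unfolding L_def lim_def by simp
  qed
  define c where "c = (\<integral>x. L x \<partial>M)"
  have null: "measure M {x \<in> space M. P (L x)} = 0 \<or> measure M {x \<in> space M. P (L x)} = 1"
    if "Measurable.pred borel P" for P
  proof -
    have "{x \<in> space M. P (L x)} \<in> sets M" using that by measurable
    moreover have "T -` {x \<in> space M. P (L x)} \<inter> space M = {x \<in> space M. P (L x)}"
      using invL measurable_space[OF T_measurable] by auto
    ultimately show ?thesis using erg unfolding ergodic_def by blast
  qed
  have gt: "AE x in M. \<not> L x > c"
  proof (rule ccontr)
    assume n: "\<not> ?thesis"
    have "measure M {x \<in> space M. L x > c} \<noteq> 0"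
    proof
      assume "measure M {x \<in> space M. L x > c} = 0"
      then have "AE x in M. \<not> L x > c"
        by (subst AE_iff_measurable[OF _ refl]) (auto simp: emeasure_eq_measure)
      with n show False by simp
    qed
    then have "prob {x \<in> space M. L x > c} = 1" using null[of "\<lambda>l. l > c"] by simp
    then have "AE x in M. c < L x" by (subst (asm) prob_Collect_eq_1) auto
    then have "(\<integral>x. c \<partial>M) < (\<integral>x. L x \<partial>M)"
      using Li by (intro integral_less_AE_space) (auto simp: emeasure_space_1)
    then show False unfolding c_def by (simp add: prob_space)
  qed
  have lt: "AE x in M. \<not> L x < c"
  proof (rule ccontr)
    assume n: "\<not> ?thesis"
    have "measure M {x \<in> space M. L x < c} \<noteq> 0"
    proof
      assume "measure M {x \<in> space M. L x < c} = 0"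
      then have "AE x in M. \<not> L x < c"
        by (subst AE_iff_measurable[OF _ refl]) (auto simp: emeasure_eq_measure)
      with n show False by simp
    qed
    then have "prob {x \<in> space M. L x < c} = 1" using null[of "\<lambda>l. l < c"] by simp
    then have "AE x in M. L x < c" by (subst (asm) prob_Collect_eq_1) auto
    then have "(\<integral>x. L x \<partial>M) < (\<integral>x. c \<partial>M)"
      using Li by (intro integral_less_AE_space) (auto simp: emeasure_space_1)
    then show False unfolding c_def by (simp add: prob_space)
  qed
  have Yc: "AE x in M. (\<lambda>k. Y k x) \<longlonglongrightarrow> c"
    using YL gt lt by eventually_elim (metis linorder_neqE)
  have EY: "(\<integral>x. Y k x \<partial>M) = (\<integral>x. h x \<partial>M)" for k
  proof -
    have "(\<integral>x. Y k x \<partial>M) = (\<Sum>i<r k. \<integral>x. h ((T ^^ i) x) \<partial>M) / r k"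
      unfolding Y_def ave_def
      by (simp, subst Bochner_Integration.integral_sum, intro bounded_mb_integrable bounded_T_pow h, simp)
    then show ?thesis using r1[of k] integral_T_pow[OF bounded_mb_measurable[OF h]] by simp
  qed
  have "(\<lambda>k. \<integral>x. Y k x \<partial>M) \<longlonglongrightarrow> (\<integral>x. c \<partial>M)"
    by (rule integral_dominated_convergence[where w="\<lambda>_. K"]) (use Yc YK in auto)
  then have ch: "c = (\<integral>x. h x \<partial>M)" unfolding EY using LIMSEQ_unique[OF _ tendsto_const] by (force simp: prob_space)
  have cK: "\<bar>c\<bar> \<le> K"
  proof -
    have "\<bar>c\<bar> \<le> (\<integral>x. \<bar>h x\<bar> \<partial>M)" unfolding ch by (rule integral_abs_bound)
    also have "\<dots> \<le> (\<integral>x. K \<partial>M)" by (intro integral_mono bounded_mb_integrable bounded_mb_intros h) (auto simp: K)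
    finally show ?thesis by (simp add: prob_space)
  qed
  have "(\<lambda>k. \<integral>x. (Y k x - c)\<^sup>2 \<partial>M) \<longlonglongrightarrow> (\<integral>x. 0 \<partial>M)"
  proof (rule integral_dominated_convergence[where w="\<lambda>_. (2 * K)\<^sup>2"])
    show "AE x in M. (\<lambda>k. (Y k x - c)\<^sup>2) \<longlonglongrightarrow> 0"
      using Yc
    proof eventually_elim
      case (elim x)
      from tendsto_power[OF tendsto_diff[OF this tendsto_const[of c]], of 2] show ?case by simp
    qed
    show "AE x in M. norm ((Y k x - c)\<^sup>2) \<le> (2 * K)\<^sup>2" for k
    proof (rule AE_I2)
      fix x
      have "\<bar>Y k x - c\<bar> \<le> 2 * K" using YK[of k x] cK by linarith
      then have "\<bar>Y k x - c\<bar>\<^sup>2 \<le> (2 * K)\<^sup>2" by (rule power_mono) simp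
      then show "norm ((Y k x - c)\<^sup>2) \<le> (2 * K)\<^sup>2" by simp
    qed
  qed auto
  then have "eventually (\<lambda>k. (\<integral>x. (Y k x - c)\<^sup>2 \<partial>M) < e\<^sup>2) sequentially"
    using e by (intro order_tendstoD(2)) auto
  then obtain k where k: "(\<integral>x. (Y k x - c)\<^sup>2 \<partial>M) < e\<^sup>2" unfolding eventually_sequentially by blast
  then have "l2n M (\<lambda>x. ave h (r k) x - c) \<le> e" using e unfolding Y_def by (intro l2n_leI) auto
  then show ?thesis using r1 ch by blast
qed

end

section \<open>Fields with a commuting filtration\<close>

text \<open>A group of measure preserving shifts \<open>\<theta>\<close> of the plane lattice and a filtration that moves along with it. The index of \<open>F\<close> refers to
the past of a lattice point in both coordinates. The half of the commutation property with \<open>a < u\<close> is derived in \<open>commuting\<close>.\<close>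

locale commuting_shifts = prob_space M for M :: "'a measure" +
  fixes \<theta> :: "int \<Rightarrow> int \<Rightarrow> 'a \<Rightarrow> 'a" and F :: "int \<Rightarrow> int \<Rightarrow> 'a measure"
  assumes \<theta>_measurable [measurable]: "\<And>a b. \<theta> a b \<in> M \<rightarrow>\<^sub>M M"
    and \<theta>_distr: "\<And>a b. distr M M (\<theta> a b) = M"
    and \<theta>_add: "\<And>a b c d x. \<theta> a b (\<theta> c d x) = \<theta> (a + c) (b + d) x"
    and \<theta>_zero: "\<And>x. \<theta> 0 0 x = x"
    and sub_F: "\<And>a b. subalgebra M (F a b)"
    and F_mono: "\<And>a b c d. a \<le> c \<Longrightarrow> b \<le> d \<Longrightarrow> sets (F a b) \<subseteq> sets (F c d)"
    and \<theta>_F: "\<And>a b c d. \<theta> a b \<in> F (c + a) (d + b) \<rightarrow>\<^sub>M F c d"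
    and half_commuting: "\<And>a b u v Y. u \<le> a \<Longrightarrow> integrable M Y \<Longrightarrow>
      AE x in M. real_cond_exp M (F u v) (real_cond_exp M (F a b) Y) x = real_cond_exp M (F u (min b v)) Y x"
begin

abbreviation E :: "int \<Rightarrow> int \<Rightarrow> ('a \<Rightarrow> real) \<Rightarrow> 'a \<Rightarrow> real" where
  "E a b \<equiv> real_cond_exp M (F a b)"

definition sh :: "int \<Rightarrow> int \<Rightarrow> ('a \<Rightarrow> real) \<Rightarrow> 'a \<Rightarrow> real" where
  "sh a b h x = h (\<theta> a b x)"

definition box_sum :: "nat \<Rightarrow> nat \<Rightarrow> ('a \<Rightarrow> real) \<Rightarrow> 'a \<Rightarrow> real" where
  "box_sum n m h x = (\<Sum>u=1..n. \<Sum>v=1..m. sh (int u) (int v) h x)"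

lemma sh_sh: "sh a b (sh c d h) = sh (a + c) (b + d) h"
  unfolding sh_def by (simp add: \<theta>_add add.commute)

lemma sh_zero: "sh 0 0 h = h"
  unfolding sh_def by (simp add: \<theta>_zero)

lemma measurable_sh [measurable]: "h \<in> borel_measurable M \<Longrightarrow> sh a b h \<in> borel_measurable M"
  unfolding sh_def[abs_def] by (rule measurable_compose[OF \<theta>_measurable])

lemma integral_sh: "h \<in> borel_measurable M \<Longrightarrow> (\<integral>x. sh a b h x \<partial>M) = (\<integral>x. h x \<partial>M)"
  unfolding sh_def[abs_def] using integral_distr[OF \<theta>_measurable[of a b], of h] by (simp add: \<theta>_distr)

lemma integrable_sh: "integrable M h \<Longrightarrow> integrable M (sh a b h)"
  unfolding sh_def[abs_def] using integrable_distr[OF \<theta>_measurable[of a b], of h] by (simp add: \<theta>_distr)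

lemma AE_sh:
  assumes "AE x in M. Q x" shows "AE x in M. Q (\<theta> a b x)"
proof -
  have "AE x in distr M M (\<theta> a b). Q x" unfolding \<theta>_distr by (rule assms)
  then show ?thesis by (rule AE_distrD[OF \<theta>_measurable])
qed

lemma sq_integrable_sh:
  assumes "sq_integrable M h" shows "sq_integrable M (sh a b h)"
  using assms integrable_sh[of "\<lambda>x. (h x)\<^sup>2" a b] measurable_sh[of h a b]
  unfolding sq_integrable_def by (simp add: sh_def[abs_def])

lemma l2n_sh: "h \<in> borel_measurable M \<Longrightarrow> l2n M (sh a b h) = l2n M h"
  unfolding l2n_def using integral_sh[of "\<lambda>x. (h x)\<^sup>2" a b] by (simp add: sh_def)

lemma sh_F: "h \<in> borel_measurable (F c d) \<Longrightarrow> sh a b h \<in> borel_measurable (F (c + a) (d + b))"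
  unfolding sh_def[abs_def] using measurable_compose[OF \<theta>_F[of a b c d]] by auto

lemma F_measurable_mono:
  assumes "h \<in> borel_measurable (F a b)" "a \<le> c" "b \<le> d"
  shows "h \<in> borel_measurable (F c d)"
  by (rule measurable_from_subalg[OF subalgebraI_mono[OF sub_F sub_F F_mono[OF assms(2,3)]] assms(1)])

lemma sigma_finite_F: "sigma_finite_subalgebra M (F a b)"
  by (rule sigma_finite_subalgebraI[OF sub_F])

lemmas E_int = sigma_finite_subalgebra.real_cond_exp_int(1)[OF sigma_finite_F]
  and E_cong = sigma_finite_subalgebra.real_cond_exp_cong[OF sigma_finite_F]
  and E_add = sigma_finite_subalgebra.real_cond_exp_add[OF sigma_finite_F]
  and E_diff = sigma_finite_subalgebra.real_cond_exp_diff[OF sigma_finite_F]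
  and E_cmult = sigma_finite_subalgebra.real_cond_exp_cmult[OF sigma_finite_F]
  and E_F_meas = sigma_finite_subalgebra.real_cond_exp_F_meas[OF sigma_finite_F]
  and E_sq = cond_exp_L2(1)[OF sub_F]
  and E_le = cond_exp_L2(2)[OF sub_F]
  and E_sum = cond_exp_sum_AE[OF sub_F]

lemma E_shift:
  assumes h: "integrable M h"
  shows "AE x in M. sh c d (E a b h) x = E (a + c) (b + d) (sh c d h) x"
proof -
  have "AE x in M. E (a + c) (b + d) (\<lambda>x. h (\<theta> c d x)) x = real_cond_exp (distr M M (\<theta> c d)) (F a b) h (\<theta> c d x)"
  proof (rule cond_exp_comp[OF \<theta>_measurable sub_F])
    show "subalgebra (distr M M (\<theta> c d)) (F a b)" unfolding \<theta>_distr by (rule sub_F)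
    show "\<theta> c d \<in> F (a + c) (b + d) \<rightarrow>\<^sub>M F a b" by (rule \<theta>_F)
    show "integrable (distr M M (\<theta> c d)) h" unfolding \<theta>_distr by (rule h)
    fix A assume A: "A \<in> sets (F (a + c) (b + d))"
    have space_F: "space (F i j) = space M" for i j using sub_F[of i j] unfolding subalgebra_def by simp
    have AM: "A \<subseteq> space M" using sets.sets_into_space[OF A] unfolding space_F .
    have "\<theta> (- c) (- d) -` A \<inter> space M \<in> sets (F a b)"
      using measurable_sets[OF \<theta>_F[of "- c" "- d" "a + c" "b + d"] A] unfolding space_F by simp
    moreover have "A = \<theta> c d -` (\<theta> (- c) (- d) -` A \<inter> space M) \<inter> space M"
      using AM measurable_space[OF \<theta>_measurable[of c d]] by (auto simp: \<theta>_add \<theta>_zero)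
    ultimately show "\<exists>B\<in>sets (F a b). A = \<theta> c d -` B \<inter> space M" by blast
  qed
  then show ?thesis unfolding \<theta>_distr sh_def[abs_def] by eventually_elim simp
qed

text \<open>The case \<open>a < u\<close> follows from the case \<open>u \<le> a\<close> because conditional expectations are self-adjoint: testing \<open>E u v (E a b Y)\<close> on
an event of \<open>F u v\<close> moves both operators onto the indicator, where they occur in the opposite order.\<close>

lemma commuting:
  assumes Y: "integrable M Y"
  shows "AE x in M. E u v (E a b Y) x = E (min u a) (min v b) Y x"
proof (cases "u \<le> a")
  case True
  then show ?thesis using half_commuting[OF True Y, of v b] by (simp add: min.commute)
next
  case False
  then have au: "a \<le> u" "min u a = a" by auto
  interpret U: sigma_finite_subalgebra M "F u v" by (rule sigma_finite_F)
  interpret A: sigma_finite_subalgebra M "F a b" by (rule sigma_finite_F)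
  interpret W: sigma_finite_subalgebra M "F a (min v b)" by (rule sigma_finite_F)
  have "AE x in M. E u v (E a b Y) x = E a (min v b) Y x"
  proof (rule U.real_cond_exp_charact)
    fix S assume S: "S \<in> sets (F u v)"
    have SM: "S \<in> sets M" using S sub_F[of u v] unfolding subalgebra_def by auto
    \<comment> \<open>both conditional expectations are moved onto the indicator of the test event\<close>
    define i :: "'a \<Rightarrow> real" where "i = indicator S"
    have im: "i \<in> borel_measurable M" "i \<in> borel_measurable (F u v)" unfolding i_def using SM S by auto
    have ii: "integrable M i" unfolding i_def using SM by (intro integrable_real_indicator) (auto simp: emeasure_eq_measure)
    have bnd: "AE x in M. \<bar>E a b i x\<bar> \<le> 1"
    proof -
      have "AE x in M. E a b i x \<le> 1" by (rule A.real_cond_exp_le_c[OF ii]) (auto simp: i_def)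
      moreover have "AE x in M. 0 \<le> E a b i x" by (rule A.real_cond_exp_ge_c[OF ii]) (auto simp: i_def)
      ultimately show ?thesis by eventually_elim auto
    qed
    have Ym [measurable]: "Y \<in> borel_measurable M" using Y by auto
    have intp: "integrable M (\<lambda>x. E a b i x * Z x)" if Z: "integrable M Z" for Z
    proof (rule Bochner_Integration.integrable_bound[OF Z])
      show "AE x in M. norm (E a b i x * Z x) \<le> norm (Z x)"
        using bnd by eventually_elim (simp add: abs_mult mult_left_le_one_le)
    qed (use Z in auto)
    have inti: "integrable M (\<lambda>x. i x * Z x)" if Z: "integrable M Z" for Z
      unfolding i_def using integrable_mult_indicator[OF SM Z] by simp
    have key: "AE x in M. E a b i x = E a (min v b) i x"
    proof -
      have "AE x in M. E a b i x = E a b (E u v i) x"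
        by (rule E_cong) (use U.real_cond_exp_F_meas[OF ii im(2)] im in \<open>auto elim: AE_mp\<close>)
      moreover have "AE x in M. E a b (E u v i) x = E a (min v b) i x"
        by (rule half_commuting[OF au(1) ii])
      ultimately show ?thesis by eventually_elim simp
    qed
    have "(\<integral>x\<in>S. E a b Y x \<partial>M) = (\<integral>x. E a b Y x * i x \<partial>M)"
      unfolding set_lebesgue_integral_def i_def by (simp add: mult.commute)
    also have "\<dots> = (\<integral>x. E a b Y x * E a b i x \<partial>M)"
      using inti[OF E_int[OF Y, of a b]] by (intro A.real_cond_exp_intg(2)[symmetric]) (auto simp: im mult.commute)
    also have "\<dots> = (\<integral>x. E a b i x * E a b Y x \<partial>M)" by (simp add: mult.commute)
    also have "\<dots> = (\<integral>x. E a b i x * Y x \<partial>M)"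
      by (intro A.real_cond_exp_intg(2) intp Y) auto
    also have "\<dots> = (\<integral>x. E a (min v b) i x * Y x \<partial>M)"
      using key by (intro integral_cong_AE) auto
    also have "\<dots> = (\<integral>x. E a (min v b) i x * E a (min v b) Y x \<partial>M)"
    proof (intro W.real_cond_exp_intg(2)[symmetric])
      show "integrable M (\<lambda>x. E a (min v b) i x * Y x)"
        by (rule Bochner_Integration.integrable_cong_AE_imp[OF intp[OF Y]]) (use key in auto)
    qed auto
    also have "\<dots> = (\<integral>x. E a (min v b) Y x * E a (min v b) i x \<partial>M)" by (simp add: mult.commute)
    also have "\<dots> = (\<integral>x. E a (min v b) Y x * i x \<partial>M)"
      using inti[OF E_int[OF Y, of a "min v b"]] by (intro W.real_cond_exp_intg(2)) (auto simp: im mult.commute)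
    also have "\<dots> = (\<integral>x\<in>S. E a (min v b) Y x \<partial>M)"
      unfolding set_lebesgue_integral_def i_def by (simp add: mult.commute)
    finally show "(\<integral>x\<in>S. E a b Y x \<partial>M) = (\<integral>x\<in>S. E a (min v b) Y x \<partial>M)" .
  next
    show "E a (min v b) Y \<in> borel_measurable (F u v)"
      by (rule F_measurable_mono[OF borel_measurable_cond_exp au(1)]) simp
  qed (use Y E_int in auto)
  then show ?thesis using au by simp
qed

lemma E_E_le:
  assumes "integrable M Y" "u \<le> a" "v \<le> b"
  shows "AE x in M. E u v (E a b Y) x = E u v Y x"
  using commuting[OF assms(1), of u v a b] assms(2,3) by (simp add: min_absorb1)

text \<open>The form in which commutation enters the norm inequality and the orthogonality of orthomartingale differences.\<close>

lemma E_commute_measurable: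
  assumes "integrable M w" "w \<in> borel_measurable (F a b)"
  shows "AE x in M. E u v w x = E (min u a) (min v b) w x"
proof -
  have "AE x in M. E u v (E a b w) x = E u v w x"
    by (rule E_cong) (use E_F_meas[OF assms] assms(1) in auto)
  with commuting[OF assms(1), of u v a b] show ?thesis by eventually_elim simp
qed

lemma sum_block_shift:
  fixes f :: "nat \<Rightarrow> real"
  shows "(\<Sum>u\<in>{k * N<..(k + 1) * N}. f u) = (\<Sum>u=1..N. f (u + k * N))"
  by (rule sum.reindex_bij_witness[of _ "\<lambda>u. u + k * N" "\<lambda>u. u - k * N"]) auto

lemma box_sum_sq: "sq_integrable M h \<Longrightarrow> sq_integrable M (box_sum n m h)"
  unfolding box_sum_def by (intro sq_integrable_sum sq_integrable_sh)

text \<open>The one-dimensional inequality is applied to the row sums with the filtration \<open>F k m\<close> for \<open>k = 0, 1, ...\<close>. By commutation the prediction of a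
block of row sums is a sum over \<open>v\<close> of shifts of a single function \<open>g q\<close>, which is known at \<open>(1, 0)\<close>. Its sums
in the other direction are bounded by a second application, now with the filtration \<open>F 1 k\<close>.\<close>

theorem l2n_box_sum_le:
  assumes h: "sq_integrable M h" and hF: "h \<in> borel_measurable (F 0 0)"
    and n: "n < 2 ^ Q" and m: "m < 2 ^ Q'"
  shows "l2n M (box_sum n m h) \<le> 25 * (sqrt n * sqrt m) *
    (\<Sum>q<Q. \<Sum>p<Q'. l2n M (E 1 1 (box_sum (2 ^ q) (2 ^ p) h)) / (sqrt (2 ^ q) * sqrt (2 ^ p)))"
proof -
  define \<beta> where "\<beta> q p = l2n M (E 1 1 (box_sum (2 ^ q) (2 ^ p) h))" for q p
  define A where "A q = 5 * sqrt m * (\<Sum>p<Q'. \<beta> q p / sqrt (2 ^ p))" for q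
  have hF': "sh (int u) (int v) h \<in> borel_measurable (F (int u) (int v))" for u v
    using sh_F[OF hF, of "int u" "int v"] by simp
  define w where "w N v x = (\<Sum>u=1..N. sh (int u) v h x)" for N :: nat and v x
  have wsq: "sq_integrable M (w N v)" for N v
    unfolding w_def by (intro sq_integrable_sum sq_integrable_sh h)
  note wint = sq_integrable_integrable[OF wsq]
  have wF: "w N v \<in> borel_measurable (F N v)" for N v
  proof -
    have "sh (int u) v h \<in> borel_measurable (F N v)" if "u \<le> N" for u
      by (rule F_measurable_mono[OF sh_F[OF hF, of "int u" v]]) (use that in auto)
    then show ?thesis unfolding w_def by (intro borel_measurable_sum) auto
  qed
  define g where "g q = E 1 0 (w (2 ^ q) 0)" for q
  have gsq: "sq_integrable M (g q)" for q unfolding g_def by (intro E_sq wsq)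
  have gsh: "AE x in M. sh s v (g q) x = E (1 + s) v (sh s v (w (2 ^ q) 0)) x" for s v q
    using E_shift[OF wint[of "2 ^ q" 0], of s v 1 0] unfolding g_def by simp
  have second: "l2n M (\<lambda>x. \<Sum>v=1..m. sh 0 (int v) (g q) x) \<le> A q" for q
    unfolding A_def
  proof (rule dyadic_martingale_bound[where G="\<lambda>k. F 1 (int k)", OF _ _ _ _ _ m])
    fix p k :: nat
    let ?s = "k * 2 ^ p"
    let ?I = "{k * 2 ^ p<..(k + 1) * 2 ^ p}"
    have w0: "sh 0 v (w (2 ^ q) 0) = w (2 ^ q) v" for v
      unfolding w_def by (rule ext) (simp add: sh_def \<theta>_add)
    have a1: "AE x in M. E 1 (int (?s + 1)) (\<lambda>x. \<Sum>v\<in>?I. sh 0 (int v) (g q) x) x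
        = (\<Sum>v\<in>?I. E 1 (int (?s + 1)) (sh 0 (int v) (g q)) x)"
      by (rule E_sum) (intro sq_integrable_integrable sq_integrable_sh gsq)
    have a2: "AE x in M. \<forall>v\<in>?I. E 1 (int (?s + 1)) (sh 0 (int v) (g q)) x = E 1 (int (?s + 1)) (w (2 ^ q) (int v)) x"
    proof (rule AE_finite_allI)
      fix v assume v: "v \<in> ?I"
      have "AE x in M. E 1 (int (?s + 1)) (sh 0 (int v) (g q)) x = E 1 (int (?s + 1)) (E 1 (int v) (w (2 ^ q) (int v))) x"
        by (rule E_cong) (use gsh[of 0 "int v" q] w0 gsq in \<open>auto intro: measurable_sh sq_integrable_measurable\<close>)
      moreover have "AE x in M. E 1 (int (?s + 1)) (E 1 (int v) (w (2 ^ q) (int v))) x = E 1 (int (?s + 1)) (w (2 ^ q) (int v)) x"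
      proof (rule E_E_le[OF wint order_refl])
        have "?s + 1 \<le> v" using v by simp
        then show "int (?s + 1) \<le> int v" by (rule of_nat_mono)
      qed
      ultimately show "AE x in M. E 1 (int (?s + 1)) (sh 0 (int v) (g q)) x = E 1 (int (?s + 1)) (w (2 ^ q) (int v)) x"
        by eventually_elim simp
    qed simp
    have a3: "AE x in M. E 1 (int (?s + 1)) (\<lambda>x. \<Sum>v\<in>?I. w (2 ^ q) (int v) x) x
        = (\<Sum>v\<in>?I. E 1 (int (?s + 1)) (w (2 ^ q) (int v)) x)"
      by (rule E_sum) (intro wint)
    have a4: "AE x in M. sh 0 (int ?s) (E 1 1 (box_sum (2 ^ q) (2 ^ p) h)) x = E 1 (int (?s + 1)) (sh 0 (int ?s) (box_sum (2 ^ q) (2 ^ p) h)) x"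
      using E_shift[OF sq_integrable_integrable[OF box_sum_sq[OF h]], of 0 "int ?s" 1 1 "2 ^ q" "2 ^ p"]
      by (simp add: add.commute)
    have a5: "sh 0 (int ?s) (box_sum (2 ^ q) (2 ^ p) h) = (\<lambda>x. \<Sum>v\<in>?I. w (2 ^ q) (int v) x)"
    proof
      fix x
      show "sh 0 (int ?s) (box_sum (2 ^ q) (2 ^ p) h) x = (\<Sum>v\<in>?I. w (2 ^ q) (int v) x)"
        unfolding sum_block_shift w_def box_sum_def
        by (subst sum.swap) (simp add: sh_def box_sum_def \<theta>_add)
    qed
    from a1 a2 a3 a4[unfolded a5] have "AE x in M. E 1 (int (?s + 1)) (\<lambda>x. \<Sum>v\<in>?I. sh 0 (int v) (g q) x) x = sh 0 (int ?s) (E 1 1 (box_sum (2 ^ q) (2 ^ p) h)) x"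
      by eventually_elim simp
    then have "l2n M (E 1 (int (?s + 1)) (\<lambda>x. \<Sum>v\<in>?I. sh 0 (int v) (g q) x)) = l2n M (sh 0 (int ?s) (E 1 1 (box_sum (2 ^ q) (2 ^ p) h)))"
      by (intro l2n_cong_AE) auto
    also have "\<dots> = \<beta> q p" unfolding \<beta>_def by (intro l2n_sh) simp
    finally show "l2n M (E 1 (int (k * 2 ^ p + 1)) (\<lambda>x. \<Sum>v\<in>{k * 2 ^ p<..(k + 1) * 2 ^ p}. sh 0 (int v) (g q) x)) \<le> \<beta> q p"
      by simp
  next
    fix v show "sh 0 (int (Suc v)) (g q) \<in> borel_measurable (F 1 (int (Suc v)))"
      using sh_F[of "g q" 1 0 0 "int (Suc v)"] unfolding g_def by simp
  next
    show "sets (F 1 (int j)) \<subseteq> sets (F 1 (int k))" if "j \<le> k" for j k using that by (intro F_mono) auto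
  qed (intro sub_F sq_integrable_sh gsq)+
  have "l2n M (\<lambda>x. \<Sum>u=1..n. (\<Sum>v=1..m. sh (int u) (int v) h x)) \<le> 5 * sqrt n * (\<Sum>q<Q. A q / sqrt (2 ^ q))"
  proof (rule dyadic_martingale_bound[where G="\<lambda>k. F (int k) (int m)", OF _ _ _ _ _ n])
    fix q k :: nat
    let ?s = "k * 2 ^ q"
    let ?I = "{k * 2 ^ q<..(k + 1) * 2 ^ q}"
    define wv where "wv v = sh (int ?s) (int v) (w (2 ^ q) 0)" for v
    have wv: "wv v x = (\<Sum>u\<in>?I. sh (int u) (int v) h x)" for v x
      unfolding wv_def sum_block_shift w_def by (simp add: sh_def \<theta>_add)
    have wvF: "wv v \<in> borel_measurable (F (2 ^ q + ?s) (int v))" for v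
      using sh_F[OF wF[of "2 ^ q" 0], of "int ?s" "int v"] unfolding wv_def by simp
    have wvsq: "sq_integrable M (wv v)" for v unfolding wv_def by (intro sq_integrable_sh wsq)
    have e: "(\<lambda>x. \<Sum>u\<in>?I. \<Sum>v=1..m. sh (int u) (int v) h x) = (\<lambda>x. \<Sum>v=1..m. wv v x)"
      unfolding wv by (rule ext) (rule sum.swap)
    have "AE x in M. E (int (?s + 1)) (int m) (\<lambda>x. \<Sum>v=1..m. wv v x) x = (\<Sum>v=1..m. E (int (?s + 1)) (int m) (wv v) x)"
      by (rule E_sum) (intro sq_integrable_integrable wvsq)
    moreover have "AE x in M. \<forall>v\<in>{1..m}. E (int (?s + 1)) (int m) (wv v) x = sh (int ?s) (int v) (g q) x"
    proof (rule AE_finite_allI)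
      fix v assume v: "v \<in> {1..m}"
      have "AE x in M. E (int (?s + 1)) (int m) (wv v) x = E (min (int (?s + 1)) (2 ^ q + ?s)) (min (int m) (int v)) (wv v) x"
        by (rule E_commute_measurable[OF sq_integrable_integrable[OF wvsq] wvF])
      moreover have "min (int (?s + 1)) (2 ^ q + ?s) = 1 + int ?s" "min (int m) (int v) = int v"
        using v by auto
      ultimately have "AE x in M. E (int (?s + 1)) (int m) (wv v) x = E (1 + int ?s) (int v) (wv v) x" by (simp only:)
      then show "AE x in M. E (int (?s + 1)) (int m) (wv v) x = sh (int ?s) (int v) (g q) x"
        using gsh[of "int ?s" "int v" q] unfolding wv_def[symmetric] by eventually_elim simp
    qed simp
    ultimately have "AE x in M. E (int (?s + 1)) (int m) (\<lambda>x. \<Sum>v=1..m. wv v x) x = (\<Sum>v=1..m. sh (int ?s) (int v) (g q) x)"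
      by eventually_elim simp
    moreover have "(\<Sum>v=1..m. sh (int ?s) (int v) (g q) x) = sh (int ?s) 0 (\<lambda>x. \<Sum>v=1..m. sh 0 (int v) (g q) x) x" for x
      by (simp add: sh_def \<theta>_add)
    ultimately have "l2n M (E (int (?s + 1)) (int m) (\<lambda>x. \<Sum>v=1..m. wv v x)) = l2n M (sh (int ?s) 0 (\<lambda>x. \<Sum>v=1..m. sh 0 (int v) (g q) x))"
      by (intro l2n_cong_AE borel_measurable_cond_exp2 measurable_sh borel_measurable_sum
          sq_integrable_measurable[OF gsq]) simp
    also have "\<dots> = l2n M (\<lambda>x. \<Sum>v=1..m. sh 0 (int v) (g q) x)"
      by (intro l2n_sh borel_measurable_sum measurable_sh sq_integrable_measurable gsq)
    finally show "l2n M (E (int (k * 2 ^ q + 1)) (int m) (\<lambda>x. \<Sum>u\<in>{k * 2 ^ q<..(k + 1) * 2 ^ q}. \<Sum>v=1..m. sh (int u) (int v) h x)) \<le> A q"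
      using second[of q] unfolding e by simp
  next
    fix u show "(\<lambda>x. \<Sum>v=1..m. sh (int (Suc u)) (int v) h x) \<in> borel_measurable (F (int (Suc u)) (int m))"
      by (intro borel_measurable_sum, rule F_measurable_mono[OF hF']) auto
  next
    show "sets (F (int j) (int m)) \<subseteq> sets (F (int k) (int m))" if "j \<le> k" for j k using that by (intro F_mono) auto
  qed (intro sub_F sq_integrable_sum sq_integrable_sh h)+
  also have "\<dots> = 25 * (sqrt n * sqrt m) * (\<Sum>q<Q. \<Sum>p<Q'. \<beta> q p / (sqrt (2 ^ q) * sqrt (2 ^ p)))"
    unfolding A_def by (simp add: sum_distrib_left sum_divide_distrib mult_ac)
  finally show ?thesis unfolding box_sum_def[symmetric, THEN ext] \<beta>_def by (simp add: box_sum_def[abs_def])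
qed

end

section \<open>The dyadic Maxwell-Woodroofe norm\<close>

text \<open>Outside a rectangle whose partial sum is within \<open>e\<close> of the supremum of all partial sums, only \<open>e\<close> is left.\<close>

lemma double_sum_tail:
  fixes b :: "nat \<Rightarrow> nat \<Rightarrow> real"
  assumes nn: "\<And>q p. 0 \<le> b q p" and bd: "\<And>Q P. (\<Sum>q<Q. \<Sum>p<P. b q p) \<le> B" and e: "0 < e"
  shows "\<exists>r0. \<forall>r\<ge>r0. \<forall>Q P. (\<Sum>q\<in>{r..<Q}. \<Sum>p<P. b q p) \<le> e"
proof -
  define S where "S Q P = (\<Sum>q<Q. \<Sum>p<P. b q p)" for Q P
  define L where "L = (SUP z. S (fst z) (snd z))"
  have bdd: "bdd_above (range (\<lambda>z. S (fst z) (snd z)))"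
    using bd unfolding S_def by (intro bdd_aboveI[of _ B]) auto
  have SL: "S Q P \<le> L" for Q P
    unfolding L_def using cSUP_upper[OF _ bdd, of "(Q, P)"] by simp
  have "L - e < L" using e by simp
  then obtain z where z: "L - e < S (fst z) (snd z)"
    unfolding L_def using less_cSUP_iff[OF _ bdd] by auto
  have mono: "S Q P \<le> S Q' P'" if "Q \<le> Q'" "P \<le> P'" for Q P Q' P'
  proof -
    have "S Q P \<le> (\<Sum>q<Q. \<Sum>p<P'. b q p)"
      unfolding S_def using that nn by (intro sum_mono sum_mono2) auto
    also have "\<dots> \<le> S Q' P'"
      unfolding S_def using that nn by (intro sum_mono2) (auto intro: sum_nonneg)
    finally show ?thesis .
  qed
  have "(\<Sum>q\<in>{r..<Q}. \<Sum>p<P. b q p) \<le> e" if r: "fst z \<le> r" for r Q P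
  proof (cases "r \<le> Q")
    case True
    define P' where "P' = max P (snd z)"
    have "(\<Sum>q\<in>{r..<Q}. \<Sum>p<P. b q p) \<le> (\<Sum>q\<in>{r..<Q}. \<Sum>p<P'. b q p)"
      unfolding P'_def using nn by (intro sum_mono sum_mono2) auto
    also have "\<dots> = S Q P' - S r P'"
      unfolding S_def lessThan_atLeast0 using True
        sum.atLeastLessThan_concat[of 0 r Q "\<lambda>q. \<Sum>p\<in>{0..<P'}. b q p"] by linarith
    also have "\<dots> \<le> L - S (fst z) (snd z)"
      using SL[of Q P'] mono[OF r, of "snd z" P'] unfolding P'_def by simp
    also have "\<dots> \<le> e" using z by simp
    finally show ?thesis .
  qed (use e in simp)
  then show ?thesis by blast
qed

lemma sum_sqrt_pow2: "(\<Sum>q<r. sqrt (2 ^ q)) \<le> 4 * sqrt (2 ^ r)"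
proof (induction r)
  case (Suc r)
  have "5 \<le> 4 * sqrt 2"
    by (rule power2_le_imp_le) (auto simp: power_mult_distrib)
  then have "5 * sqrt (2 ^ r) \<le> 4 * sqrt 2 * sqrt (2 ^ r)" by (rule mult_right_mono) simp
  then have "(\<Sum>q<r. sqrt (2 ^ q)) + sqrt (2 ^ r) \<le> 4 * sqrt 2 * sqrt (2 ^ r)" using Suc by linarith
  then show ?case by (simp add: real_sqrt_mult)
qed simp

context commuting_shifts
begin

text \<open>The sum of \<open>Q1^u Q2^v h\<close> over \<open>u < j\<close>, \<open>v < k\<close>, where \<open>Q1\<close> and \<open>Q2\<close> are the prediction operators
\<open>g \<mapsto> E 0 0 (sh 1 0 g)\<close> and \<open>g \<mapsto> E 0 0 (sh 0 1 g)\<close> on functions known at the origin.\<close>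

definition condsum :: "nat \<Rightarrow> nat \<Rightarrow> ('a \<Rightarrow> real) \<Rightarrow> 'a \<Rightarrow> real" where
  "condsum j k h = E 0 0 (\<lambda>x. \<Sum>u<j. \<Sum>v<k. sh (int u) (int v) h x)"

lemma condsum_sq: "sq_integrable M h \<Longrightarrow> sq_integrable M (condsum j k h)"
  unfolding condsum_def by (intro E_sq sq_integrable_sum sq_integrable_sh)

lemma condsum_F: "condsum j k h \<in> borel_measurable (F 0 0)"
  unfolding condsum_def by simp

lemma condsum_measurable [measurable]: "condsum j k h \<in> borel_measurable M"
  unfolding condsum_def by simp

lemma condsum_AE_sum:
  assumes "sq_integrable M h"
  shows "AE x in M. condsum j k h x = (\<Sum>u<j. \<Sum>v<k. E 0 0 (sh (int u) (int v) h) x)"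
proof -
  note i = sq_integrable_integrable[OF sq_integrable_sh[OF assms]]
  have "AE x in M. condsum j k h x = (\<Sum>u<j. E 0 0 (\<lambda>x. \<Sum>v<k. sh (int u) (int v) h x) x)"
    unfolding condsum_def by (rule E_sum) (intro Bochner_Integration.integrable_sum i)
  moreover have "AE x in M. \<forall>u\<in>{..<j}. E 0 0 (\<lambda>x. \<Sum>v<k. sh (int u) (int v) h x) x = (\<Sum>v<k. E 0 0 (sh (int u) (int v) h) x)"
    by (intro AE_finite_allI finite_lessThan E_sum i)
  ultimately show ?thesis by eventually_elim simp
qed

lemma E00_shift_E00:
  assumes h: "integrable M h"
  shows "AE x in M. E 0 0 (sh (int a) (int b) (E 0 0 h)) x = E 0 0 (sh (int a) (int b) h) x"
proof -
  have "AE x in M. E 0 0 (sh (int a) (int b) (E 0 0 h)) x = E 0 0 (E (int a) (int b) (sh (int a) (int b) h)) x"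
    by (rule E_cong) (use E_shift[OF h, of "int a" "int b" 0 0] in \<open>auto intro: measurable_sh\<close>)
  moreover have "AE x in M. E 0 0 (E (int a) (int b) (sh (int a) (int b) h)) x = E 0 0 (sh (int a) (int b) h) x"
    by (rule E_E_le[OF integrable_sh[OF h]]) auto
  ultimately show ?thesis by eventually_elim simp
qed

text \<open>The product of two polynomials in \<open>Q1\<close> and \<open>Q2\<close>, computed by the tower property.\<close>

lemma condsum_condsum:
  assumes h: "sq_integrable M h"
  shows "AE x in M. condsum j k (condsum j' k' h) x =
    E 0 0 (\<lambda>x. \<Sum>u<j. \<Sum>v<k. \<Sum>u'<j'. \<Sum>v'<k'. sh (int (u + u')) (int (v + v')) h x) x"
proof -
  define W where "W x = (\<Sum>u<j'. \<Sum>v<k'. sh (int u) (int v) h x)" for x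
  have W: "sq_integrable M W" unfolding W_def by (intro sq_integrable_sum sq_integrable_sh h)
  have VW: "condsum j' k' h = E 0 0 W" unfolding condsum_def W_def by simp
  have shW: "sh (int u) (int v) W x = (\<Sum>u'<j'. \<Sum>v'<k'. sh (int (u + u')) (int (v + v')) h x)" for u v x
    unfolding W_def by (simp add: sh_def \<theta>_add add.commute)
  have "AE x in M. condsum j k (condsum j' k' h) x = (\<Sum>u<j. \<Sum>v<k. E 0 0 (sh (int u) (int v) (E 0 0 W)) x)"
    unfolding VW by (rule condsum_AE_sum[OF E_sq[OF W]])
  moreover have "AE x in M. \<forall>u\<in>{..<j}. \<forall>v\<in>{..<k}. E 0 0 (sh (int u) (int v) (E 0 0 W)) x = E 0 0 (sh (int u) (int v) W) x"
    by (intro AE_finite_allI finite_lessThan E00_shift_E00 sq_integrable_integrable W)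
  moreover have "AE x in M. condsum j k W x = (\<Sum>u<j. \<Sum>v<k. E 0 0 (sh (int u) (int v) W) x)"
    by (rule condsum_AE_sum[OF W])
  ultimately have "AE x in M. condsum j k (condsum j' k' h) x = condsum j k W x" by eventually_elim simp
  moreover have "condsum j k W = E 0 0 (\<lambda>x. \<Sum>u<j. \<Sum>v<k. \<Sum>u'<j'. \<Sum>v'<k'. sh (int (u + u')) (int (v + v')) h x)"
    unfolding condsum_def shW ..
  ultimately show ?thesis by (simp only:)
qed

lemma condsum_swap_rows:
  assumes h: "sq_integrable M h"
  shows "AE x in M. condsum j k (condsum j' k' h) x = condsum j' k (condsum j k' h) x"
proof -
  have e: "(\<lambda>x. \<Sum>u<j. \<Sum>v<k. \<Sum>u'<j'. \<Sum>v'<k'. sh (int (u + u')) (int (v + v')) h x) =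
    (\<lambda>x. \<Sum>u<j'. \<Sum>v<k. \<Sum>u'<j. \<Sum>v'<k'. sh (int (u + u')) (int (v + v')) h x)"
  proof
    fix x
    have "(\<Sum>u<j. \<Sum>v<k. \<Sum>u'<j'. \<Sum>v'<k'. sh (int (u + u')) (int (v + v')) h x) =
      (\<Sum>v<k. \<Sum>u<j. \<Sum>u'<j'. \<Sum>v'<k'. sh (int (u + u')) (int (v + v')) h x)" by (rule sum.swap)
    also have "\<dots> = (\<Sum>v<k. \<Sum>u'<j'. \<Sum>u<j. \<Sum>v'<k'. sh (int (u + u')) (int (v + v')) h x)"
      by (intro sum.cong refl sum.swap)
    also have "\<dots> = (\<Sum>u'<j'. \<Sum>v<k. \<Sum>u<j. \<Sum>v'<k'. sh (int (u + u')) (int (v + v')) h x)" by (rule sum.swap)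
    finally show "(\<Sum>u<j. \<Sum>v<k. \<Sum>u'<j'. \<Sum>v'<k'. sh (int (u + u')) (int (v + v')) h x) =
      (\<Sum>u<j'. \<Sum>v<k. \<Sum>u'<j. \<Sum>v'<k'. sh (int (u + u')) (int (v + v')) h x)" by (simp add: add.commute)
  qed
  from condsum_condsum[OF h, of j k j' k', unfolded e] condsum_condsum[OF h, of j' k j k'] show ?thesis
    by eventually_elim (simp only:)
qed

lemma condsum_swap_cols:
  assumes h: "sq_integrable M h"
  shows "AE x in M. condsum j k (condsum j' k' h) x = condsum j k' (condsum j' k h) x"
proof -
  have e: "(\<lambda>x. \<Sum>u<j. \<Sum>v<k. \<Sum>u'<j'. \<Sum>v'<k'. sh (int (u + u')) (int (v + v')) h x) =
    (\<lambda>x. \<Sum>u<j. \<Sum>v<k'. \<Sum>u'<j'. \<Sum>v'<k. sh (int (u + u')) (int (v + v')) h x)"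
  proof
    fix x
    have "(\<Sum>v<k. \<Sum>u'<j'. \<Sum>v'<k'. sh (int (u + u')) (int (v + v')) h x) =
      (\<Sum>v<k'. \<Sum>u'<j'. \<Sum>v'<k. sh (int (u + u')) (int (v + v')) h x)" for u
    proof -
      have "(\<Sum>v<k. \<Sum>u'<j'. \<Sum>v'<k'. sh (int (u + u')) (int (v + v')) h x) =
        (\<Sum>u'<j'. \<Sum>v<k. \<Sum>v'<k'. sh (int (u + u')) (int (v + v')) h x)" by (rule sum.swap)
      also have "\<dots> = (\<Sum>u'<j'. \<Sum>v'<k'. \<Sum>v<k. sh (int (u + u')) (int (v + v')) h x)"
        by (intro sum.cong refl sum.swap)
      also have "\<dots> = (\<Sum>v'<k'. \<Sum>u'<j'. \<Sum>v<k. sh (int (u + u')) (int (v + v')) h x)" by (rule sum.swap)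
      finally show ?thesis by (simp add: add.commute)
    qed
    then show "(\<Sum>u<j. \<Sum>v<k. \<Sum>u'<j'. \<Sum>v'<k'. sh (int (u + u')) (int (v + v')) h x) =
      (\<Sum>u<j. \<Sum>v<k'. \<Sum>u'<j'. \<Sum>v'<k. sh (int (u + u')) (int (v + v')) h x)" by simp
  qed
  from condsum_condsum[OF h, of j k j' k', unfolded e] condsum_condsum[OF h, of j k' j' k] show ?thesis
    by eventually_elim (simp only:)
qed

definition condsum_norm :: "nat \<Rightarrow> nat \<Rightarrow> ('a \<Rightarrow> real) \<Rightarrow> real" where "condsum_norm j k h = l2n M (condsum j k h)"

lemma condsum_norm_nonneg [simp]: "0 \<le> condsum_norm j k h" unfolding condsum_norm_def by simp

lemma condsum_norm_le:
  assumes h: "sq_integrable M h" shows "condsum_norm j k h \<le> j * k * l2n M h"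
proof -
  have "condsum_norm j k h \<le> l2n M (\<lambda>x. \<Sum>u<j. \<Sum>v<k. sh (int u) (int v) h x)"
    unfolding condsum_norm_def condsum_def by (intro E_le sq_integrable_sum sq_integrable_sh h)
  also have "\<dots> \<le> (\<Sum>u<j. l2n M (\<lambda>x. \<Sum>v<k. sh (int u) (int v) h x))"
    by (intro l2n_sum sq_integrable_sum sq_integrable_sh h)
  also have "\<dots> \<le> (\<Sum>u<j. \<Sum>v<k. l2n M (sh (int u) (int v) h))"
    by (intro sum_mono l2n_sum sq_integrable_sh h)
  finally show ?thesis using h by (simp add: l2n_sh sq_integrable_measurable)
qed

lemma condsum_norm_cong_AE:
  assumes "sq_integrable M f" "sq_integrable M g" "AE x in M. f x = g x"
  shows "condsum_norm j k f = condsum_norm j k g"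
proof -
  have "AE x in M. \<forall>u\<in>{..<j}. \<forall>v\<in>{..<k}. sh (int u) (int v) f x = sh (int u) (int v) g x"
    unfolding sh_def by (intro AE_finite_allI finite_lessThan AE_sh assms)
  then have "AE x in M. (\<Sum>u<j. \<Sum>v<k. sh (int u) (int v) f x) = (\<Sum>u<j. \<Sum>v<k. sh (int u) (int v) g x)"
    by eventually_elim simp
  then have "AE x in M. condsum j k f x = condsum j k g x"
    unfolding condsum_def
    by (rule E_cong) (intro borel_measurable_sum measurable_sh assms(1,2)[THEN sq_integrable_measurable])+
  then show ?thesis unfolding condsum_norm_def by (intro l2n_cong_AE) auto
qed

lemma condsum_norm_add:
  assumes f: "sq_integrable M f" and g: "sq_integrable M g"
  shows "condsum_norm j k (\<lambda>x. f x + g x) \<le> condsum_norm j k f + condsum_norm j k g"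
proof -
  have "AE x in M. condsum j k (\<lambda>x. f x + g x) x = condsum j k f x + condsum j k g x"
  proof -
    have "(\<lambda>x. \<Sum>u<j. \<Sum>v<k. sh (int u) (int v) (\<lambda>x. f x + g x) x) =
      (\<lambda>x. (\<Sum>u<j. \<Sum>v<k. sh (int u) (int v) f x) + (\<Sum>u<j. \<Sum>v<k. sh (int u) (int v) g x))"
      by (simp add: sh_def sum.distrib)
    then show ?thesis unfolding condsum_def
      by (simp only:) (intro E_add sq_integrable_integrable sq_integrable_sum sq_integrable_sh f g)
  qed
  then have "condsum_norm j k (\<lambda>x. f x + g x) = l2n M (\<lambda>x. condsum j k f x + condsum j k g x)"
    unfolding condsum_norm_def by (intro l2n_cong_AE) auto
  also have "\<dots> \<le> condsum_norm j k f + condsum_norm j k g"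
    unfolding condsum_norm_def by (intro l2n_triangle condsum_sq f g)
  finally show ?thesis .
qed

lemma condsum_norm_cmult:
  assumes f: "sq_integrable M f"
  shows "condsum_norm j k (\<lambda>x. c * f x) = \<bar>c\<bar> * condsum_norm j k f"
proof -
  have "AE x in M. condsum j k (\<lambda>x. c * f x) x = c * condsum j k f x"
  proof -
    have "(\<lambda>x. \<Sum>u<j. \<Sum>v<k. sh (int u) (int v) (\<lambda>x. c * f x) x) =
      (\<lambda>x. c * (\<Sum>u<j. \<Sum>v<k. sh (int u) (int v) f x))"
      by (simp add: sh_def sum_distrib_left)
    then show ?thesis unfolding condsum_def
      by (simp only:) (intro E_cmult sq_integrable_integrable sq_integrable_sum sq_integrable_sh f)
  qed
  then have "condsum_norm j k (\<lambda>x. c * f x) = l2n M (\<lambda>x. c * condsum j k f x)"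
    unfolding condsum_norm_def by (intro l2n_cong_AE) auto
  then show ?thesis unfolding condsum_norm_def by (simp add: l2n_cmult)
qed

text \<open>The hypothesis of the theorem conditions sums that start at \<open>(1, 1)\<close> on the past of \<open>(1, 1)\<close>; a shift turns them into sums that start
at the origin.\<close>

lemma condsum_norm_eq_E11:
  assumes h: "sq_integrable M h" shows "l2n M (E 1 1 (box_sum j k h)) = condsum_norm j k h"
proof -
  define W where "W x = (\<Sum>u<j. \<Sum>v<k. sh (int u) (int v) h x)" for x
  have W: "sq_integrable M W" unfolding W_def by (intro sq_integrable_sum sq_integrable_sh h)
  have r: "(\<Sum>u=1..n. f u) = (\<Sum>u<n. f (u + 1))" for n and f :: "nat \<Rightarrow> real"
    by (rule sum.reindex_bij_witness[of _ "\<lambda>u. u + 1" "\<lambda>u. u - 1"]) auto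
  have "box_sum j k h = sh 1 1 W"
    unfolding box_sum_def W_def r by (rule ext) (simp add: sh_def \<theta>_add add.commute)
  then have "AE x in M. E 1 1 (box_sum j k h) x = sh 1 1 (E 0 0 W) x"
    using E_shift[OF sq_integrable_integrable[OF W], of 1 1 0 0] by simp (auto elim: AE_mp)
  then have "l2n M (E 1 1 (box_sum j k h)) = l2n M (sh 1 1 (E 0 0 W))"
    by (intro l2n_cong_AE measurable_sh) auto
  also have "\<dots> = condsum_norm j k h" unfolding condsum_norm_def condsum_def W_def by (intro l2n_sh) simp
  finally show ?thesis .
qed

text \<open>The sum of the first \<open>R\<close> powers of \<open>Q1\<close> commutes with \<open>condsum j k\<close>. Either its contraction property is used, or its roles with the
sum of \<open>j\<close> powers are exchanged. The second bound serves for \<open>j < R\<close>.\<close>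

lemma condsum_norm_row:
  assumes h: "sq_integrable M h"
  shows "condsum_norm j k (condsum R 1 h) \<le> R * condsum_norm j k h" "condsum_norm j k (condsum R 1 h) \<le> j * condsum_norm R k h"
proof -
  have "AE x in M. condsum j k (condsum R 1 h) x = condsum R 1 (condsum j k h) x"
    using condsum_swap_rows[OF h, of j k R 1] condsum_swap_cols[OF h, of R k j 1] by eventually_elim simp
  then have "condsum_norm j k (condsum R 1 h) = condsum_norm R 1 (condsum j k h)" unfolding condsum_norm_def by (intro l2n_cong_AE) auto
  also have "\<dots> \<le> R * condsum_norm j k h" using condsum_norm_le[OF condsum_sq[OF h], of R 1 j k] unfolding condsum_norm_def by simp
  finally show "condsum_norm j k (condsum R 1 h) \<le> R * condsum_norm j k h" .
  have "condsum_norm j k (condsum R 1 h) = condsum_norm j 1 (condsum R k h)"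
    unfolding condsum_norm_def using condsum_swap_cols[OF h, of j k R 1] by (intro l2n_cong_AE) auto
  also have "\<dots> \<le> j * condsum_norm R k h" using condsum_norm_le[OF condsum_sq[OF h], of j 1 R k] unfolding condsum_norm_def by simp
  finally show "condsum_norm j k (condsum R 1 h) \<le> j * condsum_norm R k h" .
qed

lemma condsum_norm_col:
  assumes h: "sq_integrable M h"
  shows "condsum_norm j k (condsum 1 R h) \<le> R * condsum_norm j k h" "condsum_norm j k (condsum 1 R h) \<le> k * condsum_norm j R h"
proof -
  have "AE x in M. condsum j k (condsum 1 R h) x = condsum 1 R (condsum j k h) x"
    using condsum_swap_rows[OF h, of j k 1 R] condsum_swap_cols[OF h, of 1 k j R] by eventually_elim simp
  then have "condsum_norm j k (condsum 1 R h) = condsum_norm 1 R (condsum j k h)" unfolding condsum_norm_def by (intro l2n_cong_AE) auto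
  also have "\<dots> \<le> R * condsum_norm j k h" using condsum_norm_le[OF condsum_sq[OF h], of 1 R j k] unfolding condsum_norm_def by simp
  finally show "condsum_norm j k (condsum 1 R h) \<le> R * condsum_norm j k h" .
  have "condsum_norm j k (condsum 1 R h) = condsum_norm 1 k (condsum j R h)"
    unfolding condsum_norm_def using condsum_swap_rows[OF h, of j k 1 R] by (intro l2n_cong_AE) auto
  also have "\<dots> \<le> k * condsum_norm j R h" using condsum_norm_le[OF condsum_sq[OF h], of 1 k j R] unfolding condsum_norm_def by simp
  finally show "condsum_norm j k (condsum 1 R h) \<le> k * condsum_norm j R h" .
qed

text \<open>The sum of these terms over all \<open>q\<close> and \<open>p\<close> is the dyadic form of the Maxwell-Woodroofe norm.\<close>

definition dyad :: "nat \<Rightarrow> nat \<Rightarrow> ('a \<Rightarrow> real) \<Rightarrow> real" where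
  "dyad q p h = condsum_norm (2 ^ q) (2 ^ p) h / (sqrt (2 ^ q) * sqrt (2 ^ p))"

lemma dyad_nonneg [simp]: "0 \<le> dyad q p h" unfolding dyad_def by simp

lemma dyad_row:
  assumes h: "sq_integrable M h"
  defines "A \<equiv> (\<lambda>r x. 1 / 2 ^ r * condsum (2 ^ r) 1 h x)"
  shows "dyad q p (A r) \<le> dyad q p h" "dyad q p (A r) \<le> sqrt (2 ^ q) / sqrt (2 ^ r) * dyad r p h"
proof -
  have A: "condsum_norm j k (A r) = condsum_norm j k (condsum (2 ^ r) 1 h) / 2 ^ r" for j k
    unfolding A_def by (subst condsum_norm_cmult[OF condsum_sq[OF h]]) simp
  have "condsum_norm (2 ^ q) (2 ^ p) (A r) \<le> condsum_norm (2 ^ q) (2 ^ p) h"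
    unfolding A using condsum_norm_row(1)[OF h, of "2 ^ q" "2 ^ p" "2 ^ r"] by (simp add: divide_le_eq mult.commute)
  then show "dyad q p (A r) \<le> dyad q p h" unfolding dyad_def by (intro divide_right_mono) auto
  have "condsum_norm (2 ^ q) (2 ^ p) (A r) \<le> 2 ^ q / 2 ^ r * condsum_norm (2 ^ r) (2 ^ p) h"
    unfolding A using condsum_norm_row(2)[OF h, of "2 ^ q" "2 ^ p" "2 ^ r"] by (simp add: divide_right_mono)
  then have "dyad q p (A r) \<le> (2 ^ q / 2 ^ r * condsum_norm (2 ^ r) (2 ^ p) h) / (sqrt (2 ^ q) * sqrt (2 ^ p))"
    unfolding dyad_def by (intro divide_right_mono) auto
  also have "\<dots> = sqrt (2 ^ q) / sqrt (2 ^ r) * dyad r p h"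
  proof -
    have "(2::real) ^ q = sqrt (2 ^ q) * sqrt (2 ^ q)" "(2::real) ^ r = sqrt (2 ^ r) * sqrt (2 ^ r)" by simp_all
    then show ?thesis unfolding dyad_def by (simp add: divide_simps)
  qed
  finally show "dyad q p (A r) \<le> sqrt (2 ^ q) / sqrt (2 ^ r) * dyad r p h" .
qed

lemma dyad_col:
  assumes h: "sq_integrable M h"
  defines "A \<equiv> (\<lambda>r x. 1 / 2 ^ r * condsum 1 (2 ^ r) h x)"
  shows "dyad q p (A r) \<le> dyad q p h" "dyad q p (A r) \<le> sqrt (2 ^ p) / sqrt (2 ^ r) * dyad q r h"
proof -
  have A: "condsum_norm j k (A r) = condsum_norm j k (condsum 1 (2 ^ r) h) / 2 ^ r" for j k
    unfolding A_def by (subst condsum_norm_cmult[OF condsum_sq[OF h]]) simp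
  have "condsum_norm (2 ^ q) (2 ^ p) (A r) \<le> condsum_norm (2 ^ q) (2 ^ p) h"
    unfolding A using condsum_norm_col(1)[OF h, of "2 ^ q" "2 ^ p" "2 ^ r"] by (simp add: divide_le_eq mult.commute)
  then show "dyad q p (A r) \<le> dyad q p h" unfolding dyad_def by (intro divide_right_mono) auto
  have "condsum_norm (2 ^ q) (2 ^ p) (A r) \<le> 2 ^ p / 2 ^ r * condsum_norm (2 ^ q) (2 ^ r) h"
    unfolding A using condsum_norm_col(2)[OF h, of "2 ^ q" "2 ^ p" "2 ^ r"] by (simp add: divide_right_mono)
  then have "dyad q p (A r) \<le> (2 ^ p / 2 ^ r * condsum_norm (2 ^ q) (2 ^ r) h) / (sqrt (2 ^ q) * sqrt (2 ^ p))"
    unfolding dyad_def by (intro divide_right_mono) auto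
  also have "\<dots> = sqrt (2 ^ p) / sqrt (2 ^ r) * dyad q r h"
  proof -
    have "(2::real) ^ p = sqrt (2 ^ p) * sqrt (2 ^ p)" "(2::real) ^ r = sqrt (2 ^ r) * sqrt (2 ^ r)" by simp_all
    then show ?thesis unfolding dyad_def by (simp add: divide_simps)
  qed
  finally show "dyad q p (A r) \<le> sqrt (2 ^ p) / sqrt (2 ^ r) * dyad q r h" .
qed

end

text \<open>The terms below level \<open>r\<close> are dominated by a geometric multiple of the term at level \<open>r\<close>, so a whole dyadic series of an average over \<open>2^r\<close>
steps is bounded by a tail of the series of the original function.\<close>

lemma smoothed_sum_le_tail:
  fixes a b :: "nat \<Rightarrow> nat \<Rightarrow> real"
  assumes nn: "\<And>q p. 0 \<le> b q p" and 1: "\<And>q p. a q p \<le> b q p"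
    and 2: "\<And>q p. a q p \<le> sqrt (2 ^ q) / sqrt (2 ^ r) * b r p"
    and tail: "\<And>Q P. (\<Sum>q\<in>{r..<Q}. \<Sum>p<P. b q p) \<le> e"
  shows "(\<Sum>q<Q. \<Sum>p<P. a q p) \<le> 5 * e"
proof -
  have "(\<Sum>q<Q. \<Sum>p<P. a q p) \<le> (\<Sum>q<Q. if q < r then sqrt (2 ^ q) / sqrt (2 ^ r) * (\<Sum>p<P. b r p) else (\<Sum>p<P. b q p))"
    using 1 2 by (intro sum_mono) (auto simp: sum_distrib_left intro!: sum_mono)
  also have "\<dots> = (\<Sum>q\<in>{..<Q} \<inter> {q. q < r}. sqrt (2 ^ q) / sqrt (2 ^ r) * (\<Sum>p<P. b r p)) + (\<Sum>q\<in>{..<Q} \<inter> - {q. q < r}. \<Sum>p<P. b q p)"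
    by (rule sum.If_cases) simp
  also have "(\<Sum>q\<in>{..<Q} \<inter> {q. q < r}. sqrt (2 ^ q) / sqrt (2 ^ r) * (\<Sum>p<P. b r p)) \<le> (\<Sum>q<r. sqrt (2 ^ q) / sqrt (2 ^ r) * (\<Sum>p<P. b r p))"
    using nn by (intro sum_mono2) (auto intro!: mult_nonneg_nonneg divide_nonneg_nonneg sum_nonneg)
  also have "\<dots> = (\<Sum>q<r. sqrt (2 ^ q)) / sqrt (2 ^ r) * (\<Sum>p<P. b r p)"
    by (simp add: sum_distrib_right sum_divide_distrib)
  also have "\<dots> \<le> 4 * (\<Sum>p<P. b r p)"
    using sum_sqrt_pow2[of r] nn by (intro mult_right_mono) (auto simp: divide_le_eq intro!: sum_nonneg)
  also have "(\<Sum>p<P. b r p) \<le> e" using tail[where Q="Suc r" and P=P] by simp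
  also have "(\<Sum>q\<in>{..<Q} \<inter> - {q. q < r}. \<Sum>p<P. b q p) \<le> e"
  proof -
    have "{..<Q} \<inter> - {q. q < r} = {r..<Q}" by auto
    then show ?thesis using tail[where Q=Q and P=P] by simp
  qed
  finally show ?thesis by simp
qed

context commuting_shifts
begin

text \<open>\<open>(I - A)(I - C) h\<close>, where \<open>A\<close> and \<open>C\<close> are the averages of the first \<open>R\<close> powers of \<open>Q1\<close> and of \<open>Q2\<close>.\<close>

definition residual :: "nat \<Rightarrow> ('a \<Rightarrow> real) \<Rightarrow> 'a \<Rightarrow> real" where
  "residual R h x = h x - condsum R 1 h x / R - condsum 1 R h x / R + condsum R R h x / (real R)\<^sup>2"

lemma residual_sq: "sq_integrable M h \<Longrightarrow> sq_integrable M (residual R h)"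
  unfolding residual_def by (intro sq_integrable_add sq_integrable_diff sq_integrable_divide condsum_sq)

text \<open>\<open>h - residual R h\<close> is \<open>A h + C h - A C h\<close>. For \<open>R = 2 ^ r\<close> the dyadic sums of \<open>A h\<close> and \<open>C h\<close> are bounded by tails of the dyadic sum of
\<open>h\<close>, one in each index, and \<open>A\<close> does not increase the terms of \<open>C h\<close>.\<close>

theorem dyad_residual_small:
  assumes h: "sq_integrable M h" and hF: "h \<in> borel_measurable (F 0 0)"
    and bd: "\<And>Q P. (\<Sum>q<Q. \<Sum>p<P. dyad q p h) \<le> B" and e: "0 < e"
  shows "\<exists>R\<ge>1. \<forall>Q P. (\<Sum>q<Q. \<Sum>p<P. dyad q p (\<lambda>x. h x - residual R h x)) \<le> e"
proof -
  have e': "0 < e / 15" using e by simp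
  obtain r1 where r1: "\<And>r Q P. r \<ge> r1 \<Longrightarrow> (\<Sum>q\<in>{r..<Q}. \<Sum>p<P. dyad q p h) \<le> e / 15"
    using double_sum_tail[OF _ bd e'] by auto
  have bd': "(\<Sum>p<P. \<Sum>q<Q. dyad q p h) \<le> B" for P Q by (subst sum.swap) (rule bd)
  obtain r2 where r2: "\<And>r Q P. r \<ge> r2 \<Longrightarrow> (\<Sum>p\<in>{r..<P}. \<Sum>q<Q. dyad q p h) \<le> e / 15"
    using double_sum_tail[of "\<lambda>p q. dyad q p h", OF _ bd' e'] by auto
  define r where "r = max r1 r2"
  define R :: nat where "R = 2 ^ r"
  define A where "A x = 1 / 2 ^ r * condsum (2 ^ r) 1 h x" for x
  define C where "C x = 1 / 2 ^ r * condsum 1 (2 ^ r) h x" for x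
  define AC where "AC x = 1 / 2 ^ r * condsum (2 ^ r) 1 C x" for x
  have Asq: "sq_integrable M A" unfolding A_def by (intro sq_integrable_cmult condsum_sq h)
  have Csq: "sq_integrable M C" unfolding C_def by (intro sq_integrable_cmult condsum_sq h)
  have ACsq: "sq_integrable M AC" unfolding AC_def by (intro sq_integrable_cmult condsum_sq Csq)
  have sA: "(\<Sum>q<Q. \<Sum>p<P. dyad q p A) \<le> 5 * (e / 15)" for Q P
  proof (rule smoothed_sum_le_tail[where r=r and b="\<lambda>q p. dyad q p h"])
    show "dyad q p A \<le> dyad q p h" for q p unfolding A_def by (rule dyad_row[OF h])
    show "dyad q p A \<le> sqrt (2 ^ q) / sqrt (2 ^ r) * dyad r p h" for q p unfolding A_def by (rule dyad_row[OF h])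
    show "(\<Sum>q\<in>{r..<Q}. \<Sum>p<P. dyad q p h) \<le> e / 15" for Q P by (rule r1) (simp add: r_def)
  qed simp
  have sC: "(\<Sum>q<Q. \<Sum>p<P. dyad q p C) \<le> 5 * (e / 15)" for Q P
  proof (subst sum.swap, rule smoothed_sum_le_tail[where r=r and b="\<lambda>p q. dyad q p h"])
    show "dyad q p C \<le> dyad q p h" for q p unfolding C_def by (rule dyad_col[OF h])
    show "dyad q p C \<le> sqrt (2 ^ p) / sqrt (2 ^ r) * dyad q r h" for q p unfolding C_def by (rule dyad_col[OF h])
    show "(\<Sum>p\<in>{r..<P}. \<Sum>q<Q. dyad q p h) \<le> e / 15" for P Q by (rule r2) (simp add: r_def)
  qed simp
  have sAC: "dyad q p AC \<le> dyad q p C" for q p unfolding AC_def by (rule dyad_row[OF Csq])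
  have ACe: "AE x in M. AC x = condsum R R h x / (real R)\<^sup>2"
  proof -
    have "AE x in M. condsum R 1 C x = 1 / 2 ^ r * condsum R 1 (condsum 1 R h) x"
    proof -
      have "(\<lambda>x. \<Sum>u<R. \<Sum>v<1. sh (int u) (int v) C x) =
        (\<lambda>x. 1 / 2 ^ r * (\<Sum>u<R. \<Sum>v<1. sh (int u) (int v) (condsum 1 R h) x))"
        by (simp add: sh_def C_def R_def sum_distrib_left)
      then show ?thesis unfolding condsum_def[of R 1 C] condsum_def[of R 1 "condsum 1 R h"]
        by (simp only:) (intro E_cmult sq_integrable_integrable sq_integrable_sum sq_integrable_sh condsum_sq h)
    qed
    moreover have "AE x in M. condsum R 1 (condsum 1 R h) x = condsum R R (condsum 1 1 h) x" by (rule condsum_swap_cols[OF h])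
    moreover have "AE x in M. condsum R R (condsum 1 1 h) x = condsum R R h x"
    proof -
      have "AE x in M. condsum 1 1 h x = h x"
        unfolding condsum_def using E_F_meas[OF sq_integrable_integrable[OF h] hF] by (simp add: sh_zero)
      then have "AE x in M. \<forall>u\<in>{..<R}. \<forall>v\<in>{..<R}. sh (int u) (int v) (condsum 1 1 h) x = sh (int u) (int v) h x"
        unfolding sh_def by (intro AE_finite_allI finite_lessThan AE_sh)
      then have "AE x in M. (\<Sum>u<R. \<Sum>v<R. sh (int u) (int v) (condsum 1 1 h) x) = (\<Sum>u<R. \<Sum>v<R. sh (int u) (int v) h x)"
        by eventually_elim simp
      then show ?thesis unfolding condsum_def[of R R]
        by (rule E_cong) (intro borel_measurable_sum measurable_sh condsum_measurable sq_integrable_measurable h)+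
    qed
    ultimately show ?thesis
      unfolding AC_def R_def[symmetric] by eventually_elim (simp add: R_def power2_eq_square)
  qed
  have "(\<Sum>q<Q. \<Sum>p<P. dyad q p (\<lambda>x. h x - residual R h x)) \<le> e" for Q P
  proof -
    have le: "dyad q p (\<lambda>x. h x - residual R h x) \<le> dyad q p A + dyad q p C + dyad q p C" for q p
    proof -
      let ?v = "condsum_norm (2 ^ q) (2 ^ p)"
      have "?v (\<lambda>x. h x - residual R h x) = ?v (\<lambda>x. (A x + C x) + (- 1) * AC x)"
      proof (rule condsum_norm_cong_AE)
        show "AE x in M. h x - residual R h x = (A x + C x) + (- 1) * AC x"
          using ACe by eventually_elim (simp add: residual_def A_def C_def R_def)
      qed (intro sq_integrable_add sq_integrable_diff sq_integrable_cmult Asq Csq ACsq h residual_sq)+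
      also have "\<dots> \<le> ?v (\<lambda>x. A x + C x) + ?v (\<lambda>x. (- 1) * AC x)"
        by (intro condsum_norm_add sq_integrable_add sq_integrable_cmult Asq Csq ACsq)
      also have "\<dots> \<le> ?v A + ?v C + ?v AC"
        using condsum_norm_add[OF Asq Csq, of "2 ^ q" "2 ^ p"] condsum_norm_cmult[OF ACsq, of "2 ^ q" "2 ^ p" "- 1"] by simp
      finally have "dyad q p (\<lambda>x. h x - residual R h x) \<le> (?v A + ?v C + ?v AC) / (sqrt (2 ^ q) * sqrt (2 ^ p))"
        unfolding dyad_def by (rule divide_right_mono) simp
      then have "dyad q p (\<lambda>x. h x - residual R h x) \<le> dyad q p A + dyad q p C + dyad q p AC"
        unfolding dyad_def by (simp add: add_divide_distrib)
      then show ?thesis using sAC[of q p] by simp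
    qed
    have "(\<Sum>q<Q. \<Sum>p<P. dyad q p (\<lambda>x. h x - residual R h x)) \<le> (\<Sum>q<Q. \<Sum>p<P. dyad q p A + dyad q p C + dyad q p C)"
      by (intro sum_mono le)
    also have "\<dots> = (\<Sum>q<Q. \<Sum>p<P. dyad q p A) + (\<Sum>q<Q. \<Sum>p<P. dyad q p C) + (\<Sum>q<Q. \<Sum>p<P. dyad q p C)"
      by (simp only: sum.distrib)
    also have "\<dots> \<le> e" using sA[of P Q] sC[of P Q] by simp
    finally show ?thesis .
  qed
  then show ?thesis by (intro exI[of _ R]) (simp add: R_def)
qed

end

section \<open>Approximation by bounded orthomartingale differences\<close>

context commuting_shifts
begin

lemma box_sum_diff: "box_sum n m (\<lambda>x. f x - g x) x = box_sum n m f x - box_sum n m g x"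
  unfolding box_sum_def by (simp add: sh_def sum_subtractf)

lemma box_sum_cong_AE:
  assumes "AE x in M. f x = g x" shows "AE x in M. box_sum n m f x = box_sum n m g x"
proof -
  have "AE x in M. \<forall>u\<in>{1..n}. \<forall>v\<in>{1..m}. sh (int u) (int v) f x = sh (int u) (int v) g x"
    unfolding sh_def by (intro AE_finite_allI finite_atLeastAtMost AE_sh assms)
  then show ?thesis unfolding box_sum_def by eventually_elim simp
qed

text \<open>\<open>(I - E (- 1) 0)(I - E 0 (- 1)) z\<close>, the innovation of \<open>z\<close> in both directions.\<close>

definition ortho_part :: "('a \<Rightarrow> real) \<Rightarrow> 'a \<Rightarrow> real" where
  "ortho_part z x = z x - E (- 1) 0 z x - E 0 (- 1) z x + E (- 1) (- 1) z x"

definition orthomart :: "('a \<Rightarrow> real) \<Rightarrow> bool" where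
  "orthomart D \<longleftrightarrow> sq_integrable M D \<and> D \<in> borel_measurable (F 0 0) \<and>
    (AE x in M. E (- 1) 0 D x = 0) \<and> (AE x in M. E 0 (- 1) D x = 0)"

lemma orthomartD:
  assumes "orthomart D"
  shows "sq_integrable M D" "D \<in> borel_measurable (F 0 0)"
    "AE x in M. E (- 1) 0 D x = 0" "AE x in M. E 0 (- 1) D x = 0"
  using assms unfolding orthomart_def by auto

lemma ortho_part_sq: "sq_integrable M z \<Longrightarrow> sq_integrable M (ortho_part z)"
  unfolding ortho_part_def by (intro sq_integrable_add sq_integrable_diff E_sq)

lemma ortho_part_F:
  assumes "z \<in> borel_measurable (F 0 0)" shows "ortho_part z \<in> borel_measurable (F 0 0)"
proof -
  have "E (- 1) 0 z \<in> borel_measurable (F 0 0)" "E 0 (- 1) z \<in> borel_measurable (F 0 0)"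
    "E (- 1) (- 1) z \<in> borel_measurable (F 0 0)"
    by (rule F_measurable_mono[OF borel_measurable_cond_exp]; simp)+
  then show ?thesis unfolding ortho_part_def[abs_def] using assms by (intro borel_measurable_add borel_measurable_diff)
qed

lemma E_ortho_part:
  assumes z: "sq_integrable M z"
  shows "AE x in M. E a b (ortho_part z) x = E a b z x - E a b (E (- 1) 0 z) x - E a b (E 0 (- 1) z) x + E a b (E (- 1) (- 1) z) x"
proof -
  note i = sq_integrable_integrable[OF z] sq_integrable_integrable[OF E_sq[OF z]]
  have "AE x in M. E a b (ortho_part z) x = E a b (\<lambda>x. z x - E (- 1) 0 z x - E 0 (- 1) z x) x + E a b (E (- 1) (- 1) z) x"
    unfolding ortho_part_def[abs_def] by (intro E_add Bochner_Integration.integrable_diff i)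
  moreover have "AE x in M. E a b (\<lambda>x. z x - E (- 1) 0 z x - E 0 (- 1) z x) x = E a b (\<lambda>x. z x - E (- 1) 0 z x) x - E a b (E 0 (- 1) z) x"
    by (intro E_diff Bochner_Integration.integrable_diff i)
  moreover have "AE x in M. E a b (\<lambda>x. z x - E (- 1) 0 z x) x = E a b z x - E a b (E (- 1) 0 z) x"
    by (intro E_diff i)
  ultimately show ?thesis by eventually_elim simp
qed

lemma orthomart_ortho_part:
  assumes z: "sq_integrable M z" and zF: "z \<in> borel_measurable (F 0 0)"
  shows "orthomart (ortho_part z)"
proof -
  note i = sq_integrable_integrable[OF z]
  have "AE x in M. E (- 1) 0 (ortho_part z) x = 0"
    using E_ortho_part[OF z, of "- 1" 0] commuting[OF i, of "- 1" 0 "- 1" 0] commuting[OF i, of "- 1" 0 0 "- 1"]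
      commuting[OF i, of "- 1" 0 "- 1" "- 1"] by eventually_elim simp
  moreover have "AE x in M. E 0 (- 1) (ortho_part z) x = 0"
    using E_ortho_part[OF z, of 0 "- 1"] commuting[OF i, of 0 "- 1" "- 1" 0] commuting[OF i, of 0 "- 1" 0 "- 1"]
      commuting[OF i, of 0 "- 1" "- 1" "- 1"] by eventually_elim simp
  ultimately show ?thesis unfolding orthomart_def using ortho_part_sq[OF z] ortho_part_F[OF zF] by simp
qed

lemma l2n_ortho_part_le:
  assumes z: "sq_integrable M z" shows "l2n M (ortho_part z) \<le> 4 * l2n M z"
proof -
  have "l2n M (ortho_part z) \<le> l2n M (\<lambda>x. z x - E (- 1) 0 z x - E 0 (- 1) z x) + l2n M (E (- 1) (- 1) z)"
    unfolding ortho_part_def[abs_def] by (intro l2n_triangle sq_integrable_diff E_sq z)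
  also have "l2n M (\<lambda>x. z x - E (- 1) 0 z x - E 0 (- 1) z x) \<le> l2n M (\<lambda>x. z x - E (- 1) 0 z x) + l2n M (E 0 (- 1) z)"
    by (intro l2n_triangle_diff sq_integrable_diff E_sq z)
  also have "l2n M (\<lambda>x. z x - E (- 1) 0 z x) \<le> l2n M z + l2n M (E (- 1) 0 z)"
    by (intro l2n_triangle_diff E_sq z)
  finally show ?thesis using E_le[OF z, of "- 1" "- 1"] E_le[OF z, of 0 "- 1"] E_le[OF z, of "- 1" 0] by simp
qed

lemma ortho_part_bounded:
  assumes zm: "z \<in> borel_measurable M" and K: "\<And>x. \<bar>z x\<bar> \<le> K"
  shows "AE x in M. \<bar>ortho_part z x\<bar> \<le> 4 * K"
proof -
  have zi: "integrable M z" by (rule bounded_mb_integrable[OF bounded_mbI[OF zm K]])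
  have zK: "z x \<le> K" "- K \<le> z x" for x using K[of x] by auto
  have bd: "AE x in M. \<bar>E a b z x\<bar> \<le> K" for a b
  proof -
    interpret sigma_finite_subalgebra M "F a b" by (rule sigma_finite_F)
    have "AE x in M. E a b z x \<le> K" "AE x in M. - K \<le> E a b z x"
      using zK by (intro real_cond_exp_le_c real_cond_exp_ge_c zi AE_I2; simp)+
    then show ?thesis by eventually_elim auto
  qed
  show ?thesis
    using bd[of "- 1" 0] bd[of 0 "- 1"] bd[of "- 1" "- 1"]
  proof eventually_elim
    case (elim x)
    then show ?case using K[of x] unfolding ortho_part_def by linarith
  qed
qed

lemma orthomart_E_row:
  assumes D: "orthomart D" and "u \<le> a" "b < v"
  shows "AE x in M. E a b (sh u v D) x = 0"
proof -
  note i = sq_integrable_integrable[OF orthomartD(1)[OF D]]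
  have "AE x in M. sh u v (E (a - u) (b - v) D) x = E a b (sh u v D) x"
    using E_shift[OF i, of u v "a - u" "b - v"] by simp
  moreover have "AE x in M. E (a - u) (b - v) D x = E 0 (b - v) D x"
    using E_commute_measurable[OF i orthomartD(2)[OF D], of "a - u" "b - v"] assms by simp
  moreover have "AE x in M. E 0 (b - v) (E 0 (- 1) D) x = E 0 (b - v) D x"
    using assms by (intro E_E_le[OF i]) auto
  moreover have "AE x in M. E 0 (b - v) (E 0 (- 1) D) x = 0"
  proof -
    have "AE x in M. E 0 (b - v) (E 0 (- 1) D) x = E 0 (b - v) (\<lambda>x. 0) x"
      using orthomartD(4)[OF D] by (intro E_cong) auto
    moreover have "AE x in M. E 0 (b - v) (\<lambda>x. 0) x = 0"
      using E_F_meas[of "\<lambda>x. 0" 0 "b - v"] by simp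
    ultimately show ?thesis by eventually_elim simp
  qed
  ultimately have "AE x in M. E (a - u) (b - v) D x = 0" "AE x in M. sh u v (E (a - u) (b - v) D) x = E a b (sh u v D) x"
    by (auto elim!: AE_mp)
  from AE_sh[OF this(1), of u v] this(2) show ?thesis unfolding sh_def by eventually_elim simp
qed

lemma orthomart_E_col:
  assumes D: "orthomart D" and "a < u" "v \<le> b"
  shows "AE x in M. E a b (sh u v D) x = 0"
proof -
  note i = sq_integrable_integrable[OF orthomartD(1)[OF D]]
  have 1: "AE x in M. sh u v (E (a - u) (b - v) D) x = E a b (sh u v D) x"
    using E_shift[OF i, of u v "a - u" "b - v"] by simp
  have 2: "AE x in M. E (a - u) (b - v) D x = E (a - u) 0 D x"
    using E_commute_measurable[OF i orthomartD(2)[OF D], of "a - u" "b - v"] assms by simp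
  have 3: "AE x in M. E (a - u) 0 (E (- 1) 0 D) x = E (a - u) 0 D x"
    using assms by (intro E_E_le[OF i]) auto
  have 4: "AE x in M. E (a - u) 0 (E (- 1) 0 D) x = E (a - u) 0 (\<lambda>x. 0) x"
    using orthomartD(3)[OF D] by (intro E_cong) auto
  have 5: "AE x in M. E (a - u) 0 (\<lambda>x. 0) x = 0"
    using E_F_meas[of "\<lambda>x. 0" "a - u" 0] by simp
  from 2 3 4 5 have "AE x in M. E (a - u) (b - v) D x = 0" by eventually_elim simp
  from AE_sh[OF this, of u v] 1 show ?thesis unfolding sh_def by eventually_elim simp
qed

text \<open>For \<open>v < v'\<close> the first factor is known at \<open>(max u u', v' - 1)\<close>. The second is centred given that past although
\<open>max u u'\<close> may exceed \<open>u'\<close>: this is where commutation is needed. The other cases are symmetric or simpler.\<close>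

lemma orthomart_orthogonal:
  assumes D: "orthomart D" and ne: "(u, v) \<noteq> (u', v')"
  shows "(\<integral>x. sh u v D x * sh u' v' D x \<partial>M) = 0"
proof -
  note sq = sq_integrable_sh[OF orthomartD(1)[OF D]]
  have m: "sh u v D \<in> borel_measurable (F u v)" for u v using sh_F[OF orthomartD(2)[OF D], of u v] by simp
  have r: "(\<integral>x. sh u v D x * sh u' v' D x \<partial>M) = 0" if "v < v'" for u v u' v'
    by (rule cond_exp_orthogonal[OF sub_F _ sq sq orthomart_E_row[OF D, of u' "max u u'" "v' - 1"]])
      (rule F_measurable_mono[OF m], use that in auto)
  have c: "(\<integral>x. sh u v D x * sh u' v D x \<partial>M) = 0" if "u < u'" for u v u'
    by (rule cond_exp_orthogonal[OF sub_F _ sq sq orthomart_E_col[OF D, of "u' - 1" u' v v]])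
      (rule F_measurable_mono[OF m], use that in auto)
  consider "v < v'" | "v' < v" | "v = v'" "u < u'" | "v = v'" "u' < u" using ne by force
  then show ?thesis
    by cases (use r[of v v' u u'] r[of v' v u' u] c[of u u' v] c[of u' u v] in \<open>auto simp: mult.commute\<close>)
qed

lemma box_sum_pairs: "box_sum n m h x = (\<Sum>z\<in>{1..n} \<times> {1..m}. sh (int (fst z)) (int (snd z)) h x)"
  unfolding box_sum_def by (simp add: sum.cartesian_product case_prod_beta)

lemma l2n_box_sum_orthomart:
  assumes D: "orthomart D" shows "l2n M (box_sum n m D) = sqrt n * sqrt m * l2n M D"
proof -
  note sq = sq_integrable_sh[OF orthomartD(1)[OF D]]
  have "(\<integral>x. (box_sum n m D x)\<^sup>2 \<partial>M) = (\<Sum>z\<in>{1..n} \<times> {1..m}. \<integral>x. (sh (int (fst z)) (int (snd z)) D x)\<^sup>2 \<partial>M)"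
    unfolding box_sum_pairs
  proof (rule pythagoras_integral)
    fix i j :: "nat \<times> nat" assume "i \<noteq> j"
    then have "(int (fst i), int (snd i)) \<noteq> (int (fst j), int (snd j))" by (simp add: prod_eq_iff)
    then show "(\<integral>x. sh (int (fst i)) (int (snd i)) D x * sh (int (fst j)) (int (snd j)) D x \<partial>M) = 0"
      by (rule orthomart_orthogonal[OF D])
  qed (use sq in auto)
  also have "\<dots> = (\<Sum>z\<in>{1..n} \<times> {1..m}. (l2n M D)\<^sup>2)"
    unfolding l2n_sq[symmetric] using l2n_sh[OF sq_integrable_measurable[OF orthomartD(1)[OF D]]] by simp
  also have "\<dots> = (sqrt n * sqrt m * l2n M D)\<^sup>2"
    by (simp add: power_mult_distrib)
  finally show ?thesis unfolding l2n_def[of M "box_sum n m D"] by simp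
qed

lemma telescope_nat:
  fixes f :: "int \<Rightarrow> real"
  shows "(\<Sum>u=1..n. f (int u - 1) - f (int u)) = f 0 - f (int n)"
  by (induction n) auto

text \<open>With \<open>p1 = Q1 g\<close>, \<open>p2 = Q2 g\<close>, \<open>p3 = Q1 Q2 g\<close>, the difference between \<open>(I - Q1)(I - Q2) g\<close> and its innovation part is the sum of a
coboundary of \<open>h2\<close> in the first direction, a coboundary of \<open>h3\<close> in the second and a double coboundary of \<open>p3\<close>. Summed over a rectangle,
the first leaves two sums of martingale differences \<open>h2\<close> along sides parallel to the second direction, the second two sums of \<open>h3\<close> along the other
sides, and the last the four corners.\<close>

lemma coboundary_approx:
  assumes g: "sq_integrable M g" and gF: "g \<in> borel_measurable (F 0 0)"
  defines "Y \<equiv> \<lambda>x. g x - E 0 0 (sh 1 0 g) x - E 0 0 (sh 0 1 g) x + E 0 0 (sh 1 1 g) x"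
  shows "\<exists>a\<ge>0. \<forall>n m. l2n M (\<lambda>x. box_sum n m Y x - box_sum n m (ortho_part g) x) \<le> a * (sqrt n + sqrt m + 1)"
proof -
  define p1 p2 p3 where "p1 = E 0 0 (sh 1 0 g)" and "p2 = E 0 0 (sh 0 1 g)" and "p3 = E 0 0 (sh 1 1 g)"
  define h2 where "h2 x = p1 x - sh 0 (- 1) p3 x" for x
  define h3 where "h3 x = p2 x - sh (- 1) 0 p3 x" for x
  note gi = sq_integrable_integrable[OF g] and gs = sq_integrable_sh[OF g]
  note gsi = sq_integrable_integrable[OF gs]
  have psq: "sq_integrable M p1" "sq_integrable M p2" "sq_integrable M p3"
    unfolding p1_def p2_def p3_def by (intro E_sq gs)+
  have hsq: "sq_integrable M h2" "sq_integrable M h3"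
    unfolding h2_def h3_def by (intro sq_integrable_diff psq sq_integrable_sh)+
  have pull: "AE x in M. sh (- 1) 0 p1 x = E (- 1) 0 g x" "AE x in M. sh 0 (- 1) p2 x = E 0 (- 1) g x"
    "AE x in M. sh (- 1) (- 1) p3 x = E (- 1) (- 1) g x"
    "AE x in M. sh 0 (- 1) p3 x = E 0 (- 1) (sh 1 0 g) x" "AE x in M. sh (- 1) 0 p3 x = E (- 1) 0 (sh 0 1 g) x"
    unfolding p1_def p2_def p3_def
    using E_shift[OF gsi[of 1 0], of "- 1" 0 0 0] E_shift[OF gsi[of 0 1], of 0 "- 1" 0 0]
      E_shift[OF gsi[of 1 1], of "- 1" "- 1" 0 0] E_shift[OF gsi[of 1 1], of 0 "- 1" 0 0]
      E_shift[OF gsi[of 1 1], of "- 1" 0 0 0] by (simp_all add: sh_sh sh_zero)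
  have Eh2: "AE x in M. E 0 (- 1) h2 x = 0"
  proof -
    have "AE x in M. E 0 (- 1) h2 x = E 0 (- 1) p1 x - E 0 (- 1) (sh 0 (- 1) p3) x"
      unfolding h2_def[abs_def] by (intro E_diff sq_integrable_integrable psq sq_integrable_sh)
    moreover have "AE x in M. E 0 (- 1) p1 x = E 0 (- 1) (sh 1 0 g) x"
      unfolding p1_def by (rule E_E_le[OF gsi]) auto
    moreover have "AE x in M. E 0 (- 1) (sh 0 (- 1) p3) x = E 0 (- 1) (E 0 (- 1) (sh 1 0 g)) x"
      by (rule E_cong[OF pull(4)]) (auto intro: measurable_sh sq_integrable_measurable psq)
    moreover have "AE x in M. E 0 (- 1) (E 0 (- 1) (sh 1 0 g)) x = E 0 (- 1) (sh 1 0 g) x"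
      by (rule E_E_le[OF gsi]) auto
    ultimately show ?thesis by eventually_elim simp
  qed
  have Eh3: "AE x in M. E (- 1) 0 h3 x = 0"
  proof -
    have "AE x in M. E (- 1) 0 h3 x = E (- 1) 0 p2 x - E (- 1) 0 (sh (- 1) 0 p3) x"
      unfolding h3_def[abs_def] by (intro E_diff sq_integrable_integrable psq sq_integrable_sh)
    moreover have "AE x in M. E (- 1) 0 p2 x = E (- 1) 0 (sh 0 1 g) x"
      unfolding p2_def by (rule E_E_le[OF gsi]) auto
    moreover have "AE x in M. E (- 1) 0 (sh (- 1) 0 p3) x = E (- 1) 0 (E (- 1) 0 (sh 0 1 g)) x"
      by (rule E_cong[OF pull(5)]) (auto intro: measurable_sh sq_integrable_measurable psq)
    moreover have "AE x in M. E (- 1) 0 (E (- 1) 0 (sh 0 1 g)) x = E (- 1) 0 (sh 0 1 g) x"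
      by (rule E_E_le[OF gsi]) auto
    ultimately show ?thesis by eventually_elim simp
  qed
  have hF: "h2 \<in> borel_measurable (F 0 0)" "h3 \<in> borel_measurable (F 0 0)"
  proof -
    have p: "p1 \<in> borel_measurable (F 0 0)" "p2 \<in> borel_measurable (F 0 0)" "p3 \<in> borel_measurable (F 0 0)"
      unfolding p1_def p2_def p3_def by simp_all
    have "sh 0 (- 1) p3 \<in> borel_measurable (F 0 0)" "sh (- 1) 0 p3 \<in> borel_measurable (F 0 0)"
      using F_measurable_mono[OF sh_F[OF p(3), of 0 "- 1"], of 0 0] F_measurable_mono[OF sh_F[OF p(3), of "- 1" 0], of 0 0]
      by simp_all
    then show "h2 \<in> borel_measurable (F 0 0)" "h3 \<in> borel_measurable (F 0 0)"
      unfolding h2_def[abs_def] h3_def[abs_def] using p by (intro borel_measurable_diff; simp)+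
  qed
  have col: "l2n M (\<lambda>x. \<Sum>v=1..m. sh u (int v) h2 x) \<le> sqrt m * l2n M h2" for u m
  proof -
    have lt: "(\<integral>x. sh u (int v) h2 x * sh u (int w) h2 x \<partial>M) = 0" if "v < w" for v w :: nat
    proof (rule cond_exp_orthogonal[OF sub_F _ sq_integrable_sh[OF hsq(1)] sq_integrable_sh[OF hsq(1)]])
      show "sh u (int v) h2 \<in> borel_measurable (F u (int w - 1))"
        by (rule F_measurable_mono[OF sh_F[OF hF(1), of u "int v"]]) (use that in auto)
      show "AE x in M. E u (int w - 1) (sh u (int w) h2) x = 0"
        using E_shift[OF sq_integrable_integrable[OF hsq(1)], of u "int w" 0 "- 1"] AE_sh[OF Eh2, of u "int w"]
        unfolding sh_def[of _ _ "E 0 (- 1) h2"] by simp (auto elim: AE_mp)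
    qed
    have "l2n M (\<lambda>x. \<Sum>v\<in>{1..m}. sh u (int v) h2 x) \<le> sqrt (card {1..m}) * l2n M h2"
    proof (rule pythagoras_le)
      fix i j :: nat assume "i \<noteq> j"
      then show "(\<integral>x. sh u (int i) h2 x * sh u (int j) h2 x \<partial>M) = 0"
        using lt[of i j] lt[of j i] by (cases "i < j") (auto simp: mult.commute)
    qed (use hsq in \<open>auto intro!: sq_integrable_sh simp: l2n_sh sq_integrable_measurable\<close>)
    then show ?thesis by simp
  qed
  have row: "l2n M (\<lambda>x. \<Sum>u=1..n. sh (int u) v h3 x) \<le> sqrt n * l2n M h3" for v n
  proof -
    have lt: "(\<integral>x. sh (int u) v h3 x * sh (int w) v h3 x \<partial>M) = 0" if "u < w" for u w :: nat
    proof (rule cond_exp_orthogonal[OF sub_F _ sq_integrable_sh[OF hsq(2)] sq_integrable_sh[OF hsq(2)]])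
      show "sh (int u) v h3 \<in> borel_measurable (F (int w - 1) v)"
        by (rule F_measurable_mono[OF sh_F[OF hF(2), of "int u" v]]) (use that in auto)
      show "AE x in M. E (int w - 1) v (sh (int w) v h3) x = 0"
        using E_shift[OF sq_integrable_integrable[OF hsq(2)], of "int w" v "- 1" 0] AE_sh[OF Eh3, of "int w" v]
        unfolding sh_def[of _ _ "E (- 1) 0 h3"] by simp (auto elim: AE_mp)
    qed
    have "l2n M (\<lambda>x. \<Sum>u\<in>{1..n}. sh (int u) v h3 x) \<le> sqrt (card {1..n}) * l2n M h3"
    proof (rule pythagoras_le)
      fix i j :: nat assume "i \<noteq> j"
      then show "(\<integral>x. sh (int i) v h3 x * sh (int j) v h3 x \<partial>M) = 0"
        using lt[of i j] lt[of j i] by (cases "i < j") (auto simp: mult.commute)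
    qed (use hsq in \<open>auto intro!: sq_integrable_sh simp: l2n_sh sq_integrable_measurable\<close>)
    then show ?thesis by simp
  qed
  define Z where "Z x = (sh (- 1) 0 h2 x - h2 x) + (sh 0 (- 1) h3 x - h3 x)
    + (p3 x + sh (- 1) (- 1) p3 x - sh 0 (- 1) p3 x - sh (- 1) 0 p3 x)" for x
  have YZ: "AE x in M. Y x - ortho_part g x = Z x"
    using pull(1-3)
  proof eventually_elim
    case (elim x)
    have "sh (- 1) 0 h2 x = sh (- 1) 0 p1 x - sh (- 1) (- 1) p3 x" "sh 0 (- 1) h3 x = sh 0 (- 1) p2 x - sh (- 1) (- 1) p3 x"
      unfolding h2_def h3_def by (simp_all add: sh_def \<theta>_add)
    then show ?case using elim
      unfolding Z_def Y_def ortho_part_def p1_def[symmetric] p2_def[symmetric] p3_def[symmetric] h2_def h3_def by simp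
  qed
  have SZ: "box_sum n m Z x = ((\<Sum>v=1..m. sh 0 (int v) h2 x) - (\<Sum>v=1..m. sh (int n) (int v) h2 x))
     + ((\<Sum>u=1..n. sh (int u) 0 h3 x) - (\<Sum>u=1..n. sh (int u) (int m) h3 x))
     + ((sh 0 0 p3 x - sh 0 (int m) p3 x) - (sh (int n) 0 p3 x - sh (int n) (int m) p3 x))" for n m x
  proof -
    define H2 H3 P3 where "H2 u v = sh u v h2 x" and "H3 u v = sh u v h3 x" and "P3 u v = sh u v p3 x" for u v
    have "box_sum n m Z x = (\<Sum>u=1..n. \<Sum>v=1..m. (H2 (int u - 1) (int v) - H2 (int u) (int v))
       + (H3 (int u) (int v - 1) - H3 (int u) (int v))
       + ((P3 (int u - 1) (int v - 1) - P3 (int u - 1) (int v)) - (P3 (int u) (int v - 1) - P3 (int u) (int v))))"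
      unfolding box_sum_def H2_def H3_def P3_def
    proof (intro sum.cong refl)
      fix u v
      show "sh (int u) (int v) Z x = (sh (int u - 1) (int v) h2 x - sh (int u) (int v) h2 x)
        + (sh (int u) (int v - 1) h3 x - sh (int u) (int v) h3 x)
        + ((sh (int u - 1) (int v - 1) p3 x - sh (int u - 1) (int v) p3 x) - (sh (int u) (int v - 1) p3 x - sh (int u) (int v) p3 x))"
        unfolding sh_def[of "int u" "int v" Z] Z_def by (simp add: sh_def \<theta>_add)
    qed
    also have "\<dots> = (\<Sum>u=1..n. \<Sum>v=1..m. H2 (int u - 1) (int v) - H2 (int u) (int v))
       + (\<Sum>u=1..n. \<Sum>v=1..m. H3 (int u) (int v - 1) - H3 (int u) (int v))
       + (\<Sum>u=1..n. (\<Sum>v=1..m. P3 (int u - 1) (int v - 1) - P3 (int u - 1) (int v)) - (\<Sum>v=1..m. P3 (int u) (int v - 1) - P3 (int u) (int v)))"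
      by (simp only: sum.distrib sum_subtractf)
    also have "(\<Sum>u=1..n. \<Sum>v=1..m. H2 (int u - 1) (int v) - H2 (int u) (int v)) = (\<Sum>v=1..m. \<Sum>u=1..n. H2 (int u - 1) (int v) - H2 (int u) (int v))"
      by (rule sum.swap)
    also have "\<dots> = (\<Sum>v=1..m. H2 0 (int v)) - (\<Sum>v=1..m. H2 (int n) (int v))"
      using telescope_nat[of "\<lambda>u. H2 u _" n] by (simp add: sum_subtractf)
    also have "(\<Sum>u=1..n. \<Sum>v=1..m. H3 (int u) (int v - 1) - H3 (int u) (int v)) = (\<Sum>u=1..n. H3 (int u) 0) - (\<Sum>u=1..n. H3 (int u) (int m))"
      using telescope_nat[of "H3 _" m] by (simp add: sum_subtractf)
    also have "(\<Sum>u=1..n. (\<Sum>v=1..m. P3 (int u - 1) (int v - 1) - P3 (int u - 1) (int v)) - (\<Sum>v=1..m. P3 (int u) (int v - 1) - P3 (int u) (int v)))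
        = (P3 0 0 - P3 0 (int m)) - (P3 (int n) 0 - P3 (int n) (int m))"
      unfolding telescope_nat[of "P3 _" m] using telescope_nat[of "\<lambda>u. P3 u 0 - P3 u (int m)" n] by simp
    finally show ?thesis unfolding H2_def H3_def P3_def .
  qed
  define a where "a = 2 * l2n M h2 + 2 * l2n M h3 + 4 * l2n M p3"
  have "l2n M (\<lambda>x. box_sum n m Y x - box_sum n m (ortho_part g) x) \<le> a * (sqrt n + sqrt m + 1)" for n m
  proof -
    have Ysq: "sq_integrable M Y" unfolding Y_def by (intro sq_integrable_add sq_integrable_diff E_sq gs g)
    have Zsq: "sq_integrable M Z" unfolding Z_def
      by (intro sq_integrable_add sq_integrable_diff sq_integrable_sh hsq psq)
    have "l2n M (\<lambda>x. box_sum n m Y x - box_sum n m (ortho_part g) x) = l2n M (box_sum n m Z)"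
    proof (rule l2n_cong_AE)
      show "AE x in M. box_sum n m Y x - box_sum n m (ortho_part g) x = box_sum n m Z x"
        using box_sum_cong_AE[OF YZ, of n m] unfolding box_sum_diff .
    qed (intro sq_integrable_measurable sq_integrable_diff box_sum_sq Ysq ortho_part_sq g Zsq)+
    also have "\<dots> \<le> (sqrt m * l2n M h2 + sqrt m * l2n M h2) + (sqrt n * l2n M h3 + sqrt n * l2n M h3)
      + ((l2n M p3 + l2n M p3) + (l2n M p3 + l2n M p3))"
    proof -
      have p: "l2n M (sh u v p3) \<le> l2n M p3" for u v using l2n_sh[OF sq_integrable_measurable[OF psq(3)]] by simp
      note s = sq_integrable_sh[OF psq(3)]
      have q: "l2n M (\<lambda>x. sh u v p3 x - sh u' v' p3 x) \<le> l2n M p3 + l2n M p3" for u v u' v'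
        using l2n_triangle_diff[OF s[of u v] s[of u' v']] p[of u v] p[of u' v'] by simp
      have 1: "l2n M (\<lambda>x. (sh 0 0 p3 x - sh 0 (int m) p3 x) - (sh (int n) 0 p3 x - sh (int n) (int m) p3 x)) \<le> (l2n M p3 + l2n M p3) + (l2n M p3 + l2n M p3)"
        by (rule order_trans[OF l2n_triangle_diff add_mono[OF q q]]) (intro sq_integrable_diff s)+
      have 2: "l2n M (\<lambda>x. (\<Sum>v=1..m. sh 0 (int v) h2 x) - (\<Sum>v=1..m. sh (int n) (int v) h2 x)) \<le> sqrt m * l2n M h2 + sqrt m * l2n M h2"
        by (rule order_trans[OF l2n_triangle_diff add_mono[OF col col]]) (intro sq_integrable_sum sq_integrable_sh hsq)+
      have 3: "l2n M (\<lambda>x. (\<Sum>u=1..n. sh (int u) 0 h3 x) - (\<Sum>u=1..n. sh (int u) (int m) h3 x)) \<le> sqrt n * l2n M h3 + sqrt n * l2n M h3"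
        by (rule order_trans[OF l2n_triangle_diff add_mono[OF row row]]) (intro sq_integrable_sum sq_integrable_sh hsq)+
      show ?thesis
        unfolding SZ[abs_def]
        by (rule order_trans[OF l2n_triangle add_mono[OF order_trans[OF l2n_triangle add_mono[OF 2 3]] 1]])
          (intro sq_integrable_add sq_integrable_diff sq_integrable_sum sq_integrable_sh hsq psq)+
    qed
    also have "\<dots> \<le> a * (sqrt n + sqrt m + 1)"
      unfolding a_def by (simp add: algebra_simps)
    finally show ?thesis .
  qed
  moreover have "0 \<le> a" unfolding a_def by simp
  ultimately show ?thesis by blast
qed

text \<open>From \<open>I - A = (1 / R) \<Sum> (I - Q1^k)\<close> and \<open>I - Q1^k = (I - Q1)(I + Q1 + ... + Q1^(k-1))\<close>, and likewise for \<open>Q2\<close>.\<close>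

lemma residual_coboundary:
  assumes h: "sq_integrable M h" and hF: "h \<in> borel_measurable (F 0 0)" and R: "1 \<le> R"
  shows "\<exists>g. sq_integrable M g \<and> g \<in> borel_measurable (F 0 0) \<and>
    (AE x in M. residual R h x = g x - E 0 0 (sh 1 0 g) x - E 0 0 (sh 0 1 g) x + E 0 0 (sh 1 1 g) x)"
proof -
  define c where "c i j = E 0 0 (sh (int i) (int j) h)" for i j
  \<comment> \<open>\<open>g\<close> is \<open>1 / R\<^sup>2\<close> times the sum of \<open>Q1^i Q2^j h\<close> over all \<open>i < k < R\<close> and \<open>j < l < R\<close>\<close>
  define I where "I = (SIGMA k:{..<R}. SIGMA l:{..<R}. {..<k} \<times> {..<l})"
  have finI: "finite I" unfolding I_def by auto
  have sumI: "(\<Sum>z\<in>I. f (fst (snd (snd z))) (snd (snd (snd z)))) = (\<Sum>k<R. \<Sum>l<R. \<Sum>i<k. \<Sum>j<l. f i j)"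
    for f :: "nat \<Rightarrow> nat \<Rightarrow> real"
  proof -
    have "(\<Sum>k<R. \<Sum>l<R. \<Sum>i<k. \<Sum>j<l. f i j) = (\<Sum>k<R. \<Sum>l<R. \<Sum>z\<in>{..<k} \<times> {..<l}. f (fst z) (snd z))"
      by (intro sum.cong refl) (simp add: sum.cartesian_product case_prod_beta)
    also have "\<dots> = (\<Sum>k<R. \<Sum>y\<in>(SIGMA l:{..<R}. {..<k} \<times> {..<l}). f (fst (snd y)) (snd (snd y)))"
      by (intro sum.cong refl, subst sum.Sigma) (auto simp: case_prod_beta)
    also have "\<dots> = (\<Sum>z\<in>I. f (fst (snd (snd z))) (snd (snd (snd z))))"
      unfolding I_def by (subst sum.Sigma) (auto simp: case_prod_beta)
    finally show ?thesis by simp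
  qed
  define g where "g x = 1 / (real R)\<^sup>2 * (\<Sum>z\<in>I. c (fst (snd (snd z))) (snd (snd (snd z))) x)" for x
  have csq: "sq_integrable M (c i j)" for i j unfolding c_def by (intro E_sq sq_integrable_sh h)
  have cF: "c i j \<in> borel_measurable (F 0 0)" for i j unfolding c_def by simp
  have gsq: "sq_integrable M g" unfolding g_def by (intro sq_integrable_cmult sq_integrable_sum csq)
  have gF: "g \<in> borel_measurable (F 0 0)" unfolding g_def using cF by simp
  have Ec: "AE x in M. E 0 0 (sh (int a) (int b) (c i j)) x = c (i + a) (j + b) x" for a b i j
    using E00_shift_E00[OF integrable_sh[OF sq_integrable_integrable[OF h], of "int i" "int j"], of a b]
    unfolding c_def sh_sh by (simp add: add.commute)
  have Eg: "AE x in M. E 0 0 (sh (int a) (int b) g) x = 1 / (real R)\<^sup>2 * (\<Sum>k<R. \<Sum>l<R. \<Sum>i<k. \<Sum>j<l. c (i + a) (j + b) x)" for a b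
  proof -
    define s where "s z = sh (int a) (int b) (c (fst (snd (snd z))) (snd (snd (snd z))))" for z :: "nat \<times> nat \<times> nat \<times> nat"
    have e: "sh (int a) (int b) g = (\<lambda>x. 1 / (real R)\<^sup>2 * (\<Sum>z\<in>I. s z x))"
      by (rule ext) (simp add: s_def g_def sh_def)
    have si: "integrable M (s z)" for z unfolding s_def by (intro sq_integrable_integrable sq_integrable_sh csq)
    have "AE x in M. E 0 0 (sh (int a) (int b) g) x = 1 / (real R)\<^sup>2 * E 0 0 (\<lambda>x. \<Sum>z\<in>I. s z x) x"
      unfolding e by (intro E_cmult Bochner_Integration.integrable_sum si)
    moreover have "AE x in M. E 0 0 (\<lambda>x. \<Sum>z\<in>I. s z x) x = (\<Sum>z\<in>I. E 0 0 (s z) x)"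
      by (intro E_sum si)
    moreover have "AE x in M. \<forall>z\<in>I. E 0 0 (s z) x = c (fst (snd (snd z)) + a) (snd (snd (snd z)) + b) x"
      unfolding s_def by (intro AE_finite_allI finI Ec)
    ultimately show ?thesis
    proof eventually_elim
      case (elim x)
      then show ?case using sumI[of "\<lambda>i j. c (i + a) (j + b) x"] by simp
    qed
  qed
  have c00: "AE x in M. c 0 0 x = h x"
    unfolding c_def using E_F_meas[OF sq_integrable_integrable[OF h] hF] by (simp add: sh_zero)
  have tel: "(\<Sum>i<k. \<Sum>j<l. f i j - f (i + 1) j - f i (j + 1) + f (i + 1) (j + 1)) = f 0 0 - f k 0 - f 0 l + f k l"
    for f :: "nat \<Rightarrow> nat \<Rightarrow> real" and k l
  proof -
    have "(\<Sum>j<l. f i j - f (i + 1) j - f i (j + 1) + f (i + 1) (j + 1)) = (f i 0 - f (i + 1) 0) - (f i l - f (i + 1) l)" for i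
      by (induction l) auto
    then have "(\<Sum>i<k. \<Sum>j<l. f i j - f (i + 1) j - f i (j + 1) + f (i + 1) (j + 1)) = (\<Sum>i<k. (f i 0 - f (i + 1) 0) - (f i l - f (i + 1) l))"
      by simp
    also have "\<dots> = f 0 0 - f k 0 - f 0 l + f k l" by (induction k) auto
    finally show ?thesis .
  qed
  have "AE x in M. residual R h x = g x - E 0 0 (sh 1 0 g) x - E 0 0 (sh 0 1 g) x + E 0 0 (sh 1 1 g) x"
    using condsum_AE_sum[OF h, of R 1] condsum_AE_sum[OF h, of 1 R] condsum_AE_sum[OF h, of R R] c00 Eg[of 1 0] Eg[of 0 1] Eg[of 1 1]
  proof eventually_elim
    case (elim x)
    define f where "f i j = c i j x" for i j
    have condsum: "condsum R 1 h x = (\<Sum>k<R. f k 0)" "condsum 1 R h x = (\<Sum>l<R. f 0 l)" "condsum R R h x = (\<Sum>k<R. \<Sum>l<R. f k l)"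
      using elim(1-3) unfolding f_def c_def by simp_all
    have hx: "h x = f 0 0" using elim(4) unfolding f_def by simp
    have "g x = 1 / (real R)\<^sup>2 * (\<Sum>k<R. \<Sum>l<R. \<Sum>i<k. \<Sum>j<l. f i j)"
      unfolding g_def f_def using sumI[of "\<lambda>i j. c i j x"] by simp
    then have "g x - E 0 0 (sh 1 0 g) x - E 0 0 (sh 0 1 g) x + E 0 0 (sh 1 1 g) x =
      1 / (real R)\<^sup>2 * (\<Sum>k<R. \<Sum>l<R. \<Sum>i<k. \<Sum>j<l. f i j - f (i + 1) j - f i (j + 1) + f (i + 1) (j + 1))"
      using elim(5-7) unfolding f_def by (simp add: sum.distrib sum_subtractf algebra_simps)
    also have "\<dots> = 1 / (real R)\<^sup>2 * (\<Sum>k<R. \<Sum>l<R. f 0 0 - f k 0 - f 0 l + f k l)"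
      by (simp only: tel)
    also have "\<dots> = 1 / (real R)\<^sup>2 * ((real R)\<^sup>2 * f 0 0 - R * (\<Sum>k<R. f k 0) - R * (\<Sum>l<R. f 0 l) + (\<Sum>k<R. \<Sum>l<R. f k l))"
      by (simp add: sum.distrib sum_subtractf power2_eq_square sum_distrib_left right_diff_distrib)
    also have "\<dots> = residual R h x"
      unfolding residual_def condsum hx using R by (simp add: field_simps power2_eq_square)
    finally show ?case by simp
  qed
  then show ?thesis using gsq gF by blast
qed

text \<open>Three errors of size \<open>e / 3\<close>: the difference between \<open>h\<close> and its residual, by the norm inequality; the coboundaries, which are of order \<open>sqrt n + sqrt m\<close>; and the
truncation of \<open>g\<close>, whose effect on the sums is exactly \<open>sqrt (n m)\<close> times a norm, by orthogonality.\<close>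

theorem bounded_orthomartingale_approximation:
  assumes h: "sq_integrable M h" and hF: "h \<in> borel_measurable (F 0 0)"
    and bd: "\<And>Q P. (\<Sum>q<Q. \<Sum>p<P. dyad q p h) \<le> B" and e: "0 < e"
  shows "\<exists>D. bounded_mb (F 0 0) D \<and> orthomart D \<and>
    (\<exists>N. \<forall>n\<ge>N. \<forall>m\<ge>N. l2n M (\<lambda>x. box_sum n m h x - box_sum n m D x) \<le> e * (sqrt n * sqrt m))"
proof -
  have e': "0 < e / 75" using e by simp
  obtain R where R: "1 \<le> R" and sm: "\<And>Q P. (\<Sum>q<Q. \<Sum>p<P. dyad q p (\<lambda>x. h x - residual R h x)) \<le> e / 75"
    using dyad_residual_small[OF h hF bd e'] by blast
  obtain g where g: "sq_integrable M g" "g \<in> borel_measurable (F 0 0)"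
    and rg: "AE x in M. residual R h x = g x - E 0 0 (sh 1 0 g) x - E 0 0 (sh 0 1 g) x + E 0 0 (sh 1 1 g) x"
    using residual_coboundary[OF h hF R] by blast
  define Y where "Y x = g x - E 0 0 (sh 1 0 g) x - E 0 0 (sh 0 1 g) x + E 0 0 (sh 1 1 g) x" for x
  obtain a where a0: "0 \<le> a" and a: "\<And>n m. l2n M (\<lambda>x. box_sum n m Y x - box_sum n m (ortho_part g) x) \<le> a * (sqrt n + sqrt m + 1)"
    using coboundary_approx[OF g] unfolding Y_def[abs_def] by blast
  \<comment> \<open>truncation of \<open>g\<close> at level \<open>K\<close>\<close>
  define cl where "cl K x = max (- K) (min K (g x))" for K x
  have clb: "\<bar>cl K x\<bar> \<le> K" if "0 \<le> K" for K x using that unfolding cl_def by auto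
  have clF: "cl K \<in> borel_measurable (F 0 0)" for K unfolding cl_def[abs_def] using g(2) by simp
  have clM: "cl K \<in> borel_measurable M" for K by (rule measurable_from_subalg[OF sub_F clF])
  have clsq: "sq_integrable M (cl K)" if "0 \<le> K" for K
    using clM clb[OF that] by (intro bounded_mb_sq_integrable bounded_mbI)
  have "(\<lambda>K::nat. \<integral>x. (g x - cl (real K) x)\<^sup>2 \<partial>M) \<longlonglongrightarrow> (\<integral>x. 0 \<partial>M)"
  proof (rule integral_dominated_convergence[where w="\<lambda>x. (g x)\<^sup>2"])
    show "AE x in M. (\<lambda>K::nat. (g x - cl (real K) x)\<^sup>2) \<longlonglongrightarrow> 0"
    proof (rule AE_I2)
      fix x
      obtain k :: nat where k: "\<bar>g x\<bar> \<le> k" using real_arch_simple by blast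
      have "eventually (\<lambda>K::nat. (g x - cl (real K) x)\<^sup>2 = 0) sequentially"
        using eventually_ge_at_top[of k]
      proof eventually_elim
        case (elim K)
        then have "\<bar>g x\<bar> \<le> real K" using k by linarith
        then have "g x \<le> real K" "- real K \<le> g x" by linarith+
        then show ?case unfolding cl_def by simp
      qed
      then show "(\<lambda>K::nat. (g x - cl (real K) x)\<^sup>2) \<longlonglongrightarrow> 0" by (rule tendsto_eventually)
    qed
    show "AE x in M. norm ((g x - cl (real K) x)\<^sup>2) \<le> (g x)\<^sup>2" for K :: nat
    proof (rule AE_I2)
      fix x
      have "\<bar>g x - cl (real K) x\<bar> \<le> \<bar>g x\<bar>" unfolding cl_def by (auto simp: max_def min_def)
      then show "norm ((g x - cl (real K) x)\<^sup>2) \<le> (g x)\<^sup>2" by (simp add: abs_le_square_iff)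
    qed
  qed (use g clM sq_integrable_sq[OF g(1)] sq_integrable_measurable[OF g(1)] in auto)
  then have "eventually (\<lambda>K::nat. (\<integral>x. (g x - cl (real K) x)\<^sup>2 \<partial>M) < (e / 12)\<^sup>2) sequentially"
    using e by (intro order_tendstoD(2)) auto
  then obtain K0 :: nat where K0: "(\<integral>x. (g x - cl (real K0) x)\<^sup>2 \<partial>M) < (e / 12)\<^sup>2"
    unfolding eventually_sequentially by blast
  define z where "z = cl (real K0)"
  have zsq: "sq_integrable M z" and zF: "z \<in> borel_measurable (F 0 0)" and zM: "z \<in> borel_measurable M"
    and zb: "\<And>x. \<bar>z x\<bar> \<le> K0"
    unfolding z_def using clsq clF clM clb by auto
  have gz: "l2n M (\<lambda>x. g x - z x) \<le> e / 12"
    unfolding z_def using K0 e by (intro l2n_leI) auto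
  \<comment> \<open>\<open>ortho_part z\<close> is bounded by \<open>4 K0\<close> only almost surely; clipping gives a version that is bounded everywhere\<close>
  define D where "D x = max (- (4 * real K0)) (min (4 * real K0) (ortho_part z x))" for x
  have DPP: "AE x in M. D x = ortho_part z x"
    using ortho_part_bounded[OF zM zb] unfolding D_def by eventually_elim auto
  have DF: "D \<in> borel_measurable (F 0 0)" unfolding D_def[abs_def] using ortho_part_F[OF zF] by simp
  have DM: "D \<in> borel_measurable M" by (rule measurable_from_subalg[OF sub_F DF])
  have Db: "bounded_mb (F 0 0) D" by (rule bounded_mbI[OF DF, of "4 * K0"]) (auto simp: D_def)
  have Dsq: "sq_integrable M D" by (rule bounded_mb_sq_integrable[OF bounded_mb_mono[OF Db sub_F]])
  have EPP: "AE x in M. E c d D x = E c d (ortho_part z) x" for c d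
    by (rule E_cong[OF DPP]) (auto intro: DM sq_integrable_measurable ortho_part_sq zsq)
  have oz: "orthomart (ortho_part z)" by (rule orthomart_ortho_part[OF zsq zF])
  have Dom: "orthomart D"
    unfolding orthomart_def using Dsq DF EPP[of "- 1" 0] EPP[of 0 "- 1"] orthomartD(3,4)[OF oz]
    by (auto elim: AE_mp)
  have PPd: "AE x in M. ortho_part g x - ortho_part z x = ortho_part (\<lambda>x. g x - z x) x"
  proof -
    note i = sq_integrable_integrable[OF g(1)] sq_integrable_integrable[OF zsq]
    show ?thesis
      using E_diff[OF i, of "- 1" 0] E_diff[OF i, of 0 "- 1"] E_diff[OF i, of "- 1" "- 1"]
      unfolding ortho_part_def by eventually_elim simp
  qed
  have ogz: "orthomart (ortho_part (\<lambda>x. g x - z x))"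
    by (intro orthomart_ortho_part sq_integrable_diff g zsq borel_measurable_diff zF)
  obtain N :: nat where N: "\<And>n. n \<ge> N \<Longrightarrow> 9 * a \<le> e * sqrt (real n)" "1 \<le> N"
  proof -
    obtain N0 :: nat where N0: "(9 * a / e)\<^sup>2 \<le> N0" using real_arch_simple by blast
    have "9 * a \<le> e * sqrt (real n)" if "n \<ge> max 1 N0" for n
    proof -
      have "(9 * a / e)\<^sup>2 \<le> n" using N0 that by linarith
      then have "9 * a / e \<le> sqrt n" by (rule real_le_rsqrt)
      then show ?thesis using e by (simp add: field_simps)
    qed
    then show ?thesis using that[of "max 1 N0"] by auto
  qed
  have "l2n M (\<lambda>x. box_sum n m h x - box_sum n m D x) \<le> e * (sqrt n * sqrt m)" if nm: "n \<ge> N" "m \<ge> N" for n m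
  proof -
    note rsq = residual_sq[OF h, of R]
    have Ysq: "sq_integrable M Y"
      unfolding Y_def[abs_def] by (intro sq_integrable_add sq_integrable_diff E_sq sq_integrable_sh g)
    have 1: "l2n M (box_sum n m (\<lambda>x. h x - residual R h x)) \<le> e / 3 * (sqrt n * sqrt m)"
    proof -
      have rF: "(\<lambda>x. h x - residual R h x) \<in> borel_measurable (F 0 0)"
        unfolding residual_def using hF condsum_F by simp
      have dsq: "sq_integrable M (\<lambda>x. h x - residual R h x)" by (intro sq_integrable_diff h rsq)
      have "l2n M (box_sum n m (\<lambda>x. h x - residual R h x)) \<le> 25 * (sqrt n * sqrt m) *
        (\<Sum>q<n. \<Sum>p<m. dyad q p (\<lambda>x. h x - residual R h x))"
        using l2n_box_sum_le[OF dsq rF, of n n m m] unfolding condsum_norm_eq_E11[OF dsq] dyad_def by simp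
      also have "\<dots> \<le> 25 * (sqrt n * sqrt m) * (e / 75)"
        by (intro mult_left_mono sm) simp
      finally show ?thesis by (simp add: mult_ac)
    qed
    have 2: "l2n M (\<lambda>x. box_sum n m Y x - box_sum n m (ortho_part g) x) \<le> e / 3 * (sqrt n * sqrt m)"
    proof -
      have s: "1 \<le> sqrt n" "1 \<le> sqrt m" using nm N(2) by auto
      have "a * sqrt n \<le> e / 9 * (sqrt n * sqrt m)"
        using mult_right_mono[OF N(1)[OF nm(2)], of "sqrt n"] by (simp add: mult_ac)
      moreover have m1: "a * sqrt m \<le> e / 9 * (sqrt n * sqrt m)"
        using mult_right_mono[OF N(1)[OF nm(1)], of "sqrt m"] by (simp add: mult_ac)
      moreover have "a \<le> e / 9 * (sqrt n * sqrt m)"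
        using m1 mult_left_mono[OF s(2) a0] by linarith
      ultimately have "a * (sqrt n + sqrt m + 1) \<le> e / 3 * (sqrt n * sqrt m)"
        by (simp add: distrib_left)
      then show ?thesis using a[of n m] by linarith
    qed
    have 3: "l2n M (box_sum n m (ortho_part (\<lambda>x. g x - z x))) \<le> e / 3 * (sqrt n * sqrt m)"
    proof -
      have "l2n M (ortho_part (\<lambda>x. g x - z x)) \<le> e / 3"
        using l2n_ortho_part_le[OF sq_integrable_diff[OF g(1) zsq]] gz by simp
      then have "sqrt n * sqrt m * l2n M (ortho_part (\<lambda>x. g x - z x)) \<le> sqrt n * sqrt m * (e / 3)"
        by (intro mult_left_mono) auto
      then show ?thesis unfolding l2n_box_sum_orthomart[OF ogz] by (simp add: mult_ac)
    qed
    have sp: "AE x in M. box_sum n m h x - box_sum n m D x = (box_sum n m (\<lambda>x. h x - residual R h x) x + (box_sum n m Y x - box_sum n m (ortho_part g) x)) + box_sum n m (ortho_part (\<lambda>x. g x - z x)) x"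
      using box_sum_cong_AE[OF DPP, of n m] box_sum_cong_AE[OF rg[folded Y_def], of n m] box_sum_cong_AE[OF PPd, of n m]
      unfolding box_sum_diff by eventually_elim simp
    note sqs = box_sum_sq[OF h] box_sum_sq[OF Dsq] box_sum_sq[OF Ysq] box_sum_sq[OF ortho_part_sq[OF g(1)]] box_sum_sq[OF orthomartD(1)[OF ogz]]
      box_sum_sq[OF sq_integrable_diff[OF h rsq]]
    have "l2n M (\<lambda>x. box_sum n m h x - box_sum n m D x) = l2n M (\<lambda>x. (box_sum n m (\<lambda>x. h x - residual R h x) x + (box_sum n m Y x - box_sum n m (ortho_part g) x)) + box_sum n m (ortho_part (\<lambda>x. g x - z x)) x)"
      by (rule l2n_cong_AE[OF _ _ sp]) (intro sq_integrable_measurable sq_integrable_add sq_integrable_diff sqs)+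
    also have "\<dots> \<le> (e / 3 * (sqrt n * sqrt m) + e / 3 * (sqrt n * sqrt m)) + e / 3 * (sqrt n * sqrt m)"
      by (rule order_trans[OF l2n_triangle add_mono[OF order_trans[OF l2n_triangle add_mono[OF 1 2]] 3]])
        (intro sq_integrable_add sq_integrable_diff sqs)+
    finally show ?thesis by (simp add: mult_ac)
  qed
  then show ?thesis using Db Dom by blast
qed

end

section \<open>Ergodic orthomartingales\<close>

locale ergodic_orthomartingale = commuting_shifts M \<theta> F
  for M :: "'a measure" and \<theta> and F +
  fixes D :: "'a \<Rightarrow> real" and K :: real and \<sigma>2 :: real
  assumes erg: "ergodic M (\<theta> 1 0)" and D: "orthomart D"
    and K: "\<And>x. \<bar>D x\<bar> \<le> K" and \<sigma>2: "\<sigma>2 = (\<integral>x. (D x)\<^sup>2 \<partial>M)"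
begin

lemma D_bounded: "bounded_mb (F 0 0) D"
  by (rule bounded_mbI[OF orthomartD(2)[OF D] K])

lemma shD_bounded: "bounded_mb (F u v) (sh u v D)"
proof (rule bounded_mbI)
  show "sh u v D \<in> borel_measurable (F u v)" using sh_F[OF orthomartD(2)[OF D], of u v] by simp
  show "\<bar>sh u v D x\<bar> \<le> K" for x unfolding sh_def by (rule K)
qed

lemma shD_bounded_M: "bounded_mb M (sh u v D)"
  by (rule bounded_mb_mono[OF shD_bounded sub_F])

lemma shD_bounded_le:
  assumes "u \<le> a" "v \<le> b" shows "bounded_mb (F a b) (sh u v D)"
  by (rule bounded_mb_mono[OF shD_bounded subalgebraI_mono[OF sub_F sub_F F_mono[OF assms]]])

lemma second_moment_sh: "(\<integral>x. (sh u v D x)\<^sup>2 \<partial>M) = \<sigma>2"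
  using integral_sh[of "\<lambda>x. (D x)\<^sup>2" u v] bounded_mb_measurable[OF bounded_mb_mono[OF D_bounded sub_F]]
  unfolding \<sigma>2 by (simp add: sh_def)

lemma \<theta>_pow: "(\<theta> 1 0 ^^ i) x = \<theta> (int i) 0 x"
  by (induction i) (simp_all add: \<theta>_zero \<theta>_add)

text \<open>The differences along the first direction of the column at \<open>0\<close> plus \<open>\<alpha>\<close> times the column at \<open>w\<close>. The cases \<open>\<alpha> = 0, 1, - 1\<close> are used
for polarization.\<close>

definition pair :: "real \<Rightarrow> nat \<Rightarrow> nat \<Rightarrow> 'a \<Rightarrow> real" where
  "pair \<alpha> w u x = sh (int u + 1) 0 D x + \<alpha> * sh (int u + 1) (int w) D x"

lemma pair_martingale:
  assumes w: "1 \<le> w"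
  shows "uniformly_bounded_martingale_differences M (pair \<alpha> w) (\<lambda>u. F (int u) (int w)) ((1 + \<alpha>\<^sup>2) * \<sigma>2) ((1 + \<bar>\<alpha>\<bar>) * K)"
proof unfold_locales
  show "subalgebra M (F (int k) (int w))" for k by (rule sub_F)
  show "sets (F (int j) (int w)) \<subseteq> sets (F (int k) (int w))" if "j \<le> k" for j k
    using that by (intro F_mono) auto
  show "bounded_mb (F (int (Suc u)) (int w)) (pair \<alpha> w u)" for u
    unfolding pair_def by (intro bounded_mb_intros shD_bounded_le) auto
  show "AE x in M. E (int u) (int w) (pair \<alpha> w u) x = 0" for u
  proof -
    note i = bounded_mb_integrable[OF shD_bounded_M]
    have "AE x in M. E (int u) (int w) (pair \<alpha> w u) x = E (int u) (int w) (sh (int u + 1) 0 D) x + E (int u) (int w) (\<lambda>x. \<alpha> * sh (int u + 1) (int w) D x) x"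
      unfolding pair_def by (intro E_add i integrable_mult_right)
    moreover have "AE x in M. E (int u) (int w) (\<lambda>x. \<alpha> * sh (int u + 1) (int w) D x) x = \<alpha> * E (int u) (int w) (sh (int u + 1) (int w) D) x"
      by (intro E_cmult i)
    moreover have "AE x in M. E (int u) (int w) (sh (int u + 1) 0 D) x = 0"
      by (rule orthomart_E_col[OF D]) auto
    moreover have "AE x in M. E (int u) (int w) (sh (int u + 1) (int w) D) x = 0"
      by (rule orthomart_E_col[OF D]) auto
    ultimately show ?thesis by eventually_elim simp
  qed
  show "(\<integral>x. (pair \<alpha> w u x)\<^sup>2 \<partial>M) = (1 + \<alpha>\<^sup>2) * \<sigma>2" for u
  proof -
    define a b where "a = sh (int u + 1) 0 D" and "b = sh (int u + 1) (int w) D"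
    have ab: "bounded_mb M a" "bounded_mb M b" unfolding a_def b_def by (rule shD_bounded_M)+
    have i: "integrable M (\<lambda>x. (a x)\<^sup>2)" "integrable M (\<lambda>x. (b x)\<^sup>2)" "integrable M (\<lambda>x. a x * b x)"
      by (intro bounded_mb_integrable bounded_mb_intros ab)+
    have "(\<integral>x. (pair \<alpha> w u x)\<^sup>2 \<partial>M) = (\<integral>x. (a x)\<^sup>2 + \<alpha>\<^sup>2 * (b x)\<^sup>2 + 2 * \<alpha> * (a x * b x) \<partial>M)"
      unfolding pair_def a_def b_def by (simp add: power2_eq_square algebra_simps)
    also have "\<dots> = (\<integral>x. (a x)\<^sup>2 \<partial>M) + \<alpha>\<^sup>2 * (\<integral>x. (b x)\<^sup>2 \<partial>M) + 2 * \<alpha> * (\<integral>x. a x * b x \<partial>M)"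
      using i by simp
    also have "(\<integral>x. a x * b x \<partial>M) = 0"
      unfolding a_def b_def by (rule orthomart_orthogonal[OF D]) (use w in auto)
    finally show ?thesis unfolding a_def b_def second_moment_sh by (simp add: algebra_simps)
  qed
  show "\<bar>pair \<alpha> w u x\<bar> \<le> (1 + \<bar>\<alpha>\<bar>) * K" for u x
  proof -
    have "\<bar>pair \<alpha> w u x\<bar> \<le> \<bar>sh (int u + 1) 0 D x\<bar> + \<bar>\<alpha>\<bar> * \<bar>sh (int u + 1) (int w) D x\<bar>"
      unfolding pair_def by (rule order_trans[OF abs_triangle_ineq]) (simp add: abs_mult)
    also have "\<dots> \<le> K + \<bar>\<alpha>\<bar> * K"
      unfolding sh_def by (intro add_mono mult_left_mono K) simp
    finally show ?thesis by (simp add: algebra_simps)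
  qed
qed

text \<open>The squares are a bounded function along the orbits of the ergodic shift, so the mean ergodic theorem supplies the required law of large numbers; by
invariance it is uniform in the starting point.\<close>

lemma pair_fourth_moment_limit:
  assumes w: "1 \<le> w"
  shows "(\<lambda>n. (\<integral>x. (\<Sum>u<n. pair \<alpha> w u x) ^ 4 \<partial>M) / (real n)\<^sup>2) \<longlonglongrightarrow> 3 * ((1 + \<alpha>\<^sup>2) * \<sigma>2)\<^sup>2"
proof -
  interpret P: uniformly_bounded_martingale_differences M "pair \<alpha> w" "\<lambda>u. F (int u) (int w)" "(1 + \<alpha>\<^sup>2) * \<sigma>2" "(1 + \<bar>\<alpha>\<bar>) * K"
    by (rule pair_martingale[OF w])
  interpret T: measure_preserving_map M "\<theta> 1 0"
    by unfold_locales (auto simp: \<theta>_distr)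
  define h where "h x = (pair \<alpha> w 0 x)\<^sup>2" for x
  have hb: "bounded_mb M h" unfolding h_def[abs_def] by (intro bounded_mb_intros P.d_bounded)
  have Eh: "(\<integral>x. h x \<partial>M) = (1 + \<alpha>\<^sup>2) * \<sigma>2" unfolding h_def by (rule P.second_moment)
  have "(\<lambda>n. (\<integral>x. (P.mart n x) ^ 4 \<partial>M) / (real n)\<^sup>2) \<longlonglongrightarrow> 3 * ((1 + \<alpha>\<^sup>2) * \<sigma>2)\<^sup>2"
  proof (rule P.fourth_moment_limit)
    fix \<epsilon> :: real assume "0 < \<epsilon>"
    from T.mean_ergodic[OF erg hb this] obtain b where b: "1 \<le> b" and
      bb: "l2n M (\<lambda>x. T.ave h b x - (1 + \<alpha>\<^sup>2) * \<sigma>2) \<le> \<epsilon>" unfolding Eh by auto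
    have "l2n M (\<lambda>x. P.sqs s b x - b * ((1 + \<alpha>\<^sup>2) * \<sigma>2)) \<le> \<epsilon> * b" for s
    proof -
      define g where "g x = T.ave h b x - (1 + \<alpha>\<^sup>2) * \<sigma>2" for x
      have gb: "bounded_mb M g" unfolding g_def[abs_def] by (intro bounded_mb_intros T.bounded_ave hb)
      have "P.sqs s b x = (\<Sum>u<b. h ((\<theta> 1 0 ^^ u) (\<theta> (int s) 0 x)))" for x
      proof -
        have "P.sqs s b x = (\<Sum>u<b. (pair \<alpha> w (u + s) x)\<^sup>2)"
          unfolding P.sqs_def by (rule sum.reindex_bij_witness[of _ "\<lambda>u. u + s" "\<lambda>u. u - s"]) auto
        then show ?thesis unfolding h_def pair_def \<theta>_pow by (simp add: sh_def \<theta>_add add_ac)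
      qed
      then have e: "P.sqs s b x - b * ((1 + \<alpha>\<^sup>2) * \<sigma>2) = real b * sh (int s) 0 g x" for x
        using b unfolding g_def T.ave_def by (simp add: sh_def right_diff_distrib)
      have "l2n M (\<lambda>x. P.sqs s b x - b * ((1 + \<alpha>\<^sup>2) * \<sigma>2)) = b * l2n M g"
        unfolding e l2n_cmult l2n_sh[OF bounded_mb_measurable[OF gb]] by simp
      also have "\<dots> \<le> b * \<epsilon>" using bb unfolding g_def by (intro mult_left_mono) auto
      finally show ?thesis by (simp add: mult.commute)
    qed
    then show "\<exists>b\<ge>1. \<forall>s. l2n M (\<lambda>x. P.sqs s b x - b * ((1 + \<alpha>\<^sup>2) * \<sigma>2)) \<le> \<epsilon> * b" using b by blast
  qed
  then show ?thesis unfolding P.mart_def .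
qed

definition col :: "nat \<Rightarrow> int \<Rightarrow> 'a \<Rightarrow> real" where
  "col n v x = (\<Sum>u<n. sh (int u + 1) v D x)"

lemma col_bounded: "bounded_mb M (col n v)"
  unfolding col_def by (intro bounded_mb_intros shD_bounded_M)

lemma sh_col: "sh 0 s (col n v) = col n (v + s)"
  unfolding col_def by (rule ext) (simp add: sh_def \<theta>_add)

lemma col_shift:
  fixes f :: "real \<Rightarrow> real"
  assumes "f \<in> borel_measurable borel"
  shows "(\<integral>x. f (col n v x) \<partial>M) = (\<integral>x. f (col n 0 x) \<partial>M)"
proof -
  have c: "col n v x = sh 0 v (col n 0) x" for x unfolding sh_col by simp
  have "(\<integral>x. f (col n v x) \<partial>M) = (\<integral>x. sh 0 v (\<lambda>x. f (col n 0 x)) x \<partial>M)"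
    unfolding c by (simp add: sh_def)
  also have "\<dots> = (\<integral>x. f (col n 0 x) \<partial>M)"
    by (rule integral_sh) (use assms bounded_mb_measurable[OF col_bounded] in measurable)
  finally show ?thesis .
qed

text \<open>Polarization: \<open>12 a\<^sup>2 b\<^sup>2 = (a + b)^4 + (a - b)^4 - 2 a^4 - 2 b^4\<close>. The limits are \<open>12 \<sigma>2\<^sup>2\<close> for the sum and the
difference and \<open>3 \<sigma>2\<^sup>2\<close> for the single columns.\<close>

lemma mixed_moment_limit:
  assumes w: "1 \<le> w"
  shows "(\<lambda>n. (\<integral>x. (col n 0 x)\<^sup>2 * (col n (int w) x)\<^sup>2 \<partial>M) / (real n)\<^sup>2) \<longlonglongrightarrow> \<sigma>2\<^sup>2"
proof -
  define q where "q \<alpha> n = (\<integral>x. (\<Sum>u<n. pair \<alpha> w u x) ^ 4 \<partial>M) / (real n)\<^sup>2" for \<alpha> n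
  have pc: "(\<Sum>u<n. pair \<alpha> w u x) = col n 0 x + \<alpha> * col n (int w) x" for \<alpha> n x
    unfolding pair_def col_def by (simp add: sum.distrib sum_distrib_left)
  have lim: "q \<alpha> \<longlonglongrightarrow> 3 * ((1 + \<alpha>\<^sup>2) * \<sigma>2)\<^sup>2" for \<alpha>
    unfolding q_def by (rule pair_fourth_moment_limit[OF w])
  have polar: "(\<integral>x. (col n 0 x)\<^sup>2 * (col n (int w) x)\<^sup>2 \<partial>M) / (real n)\<^sup>2 = (q 1 n + q (- 1) n - 4 * q 0 n) / 12" for n
  proof -
    define a b where "a = col n 0" and "b = col n (int w)"
    have ab: "bounded_mb M a" "bounded_mb M b" unfolding a_def b_def by (rule col_bounded)+
    have i: "integrable M (\<lambda>x. (a x + b x) ^ 4)" "integrable M (\<lambda>x. (a x - b x) ^ 4)" "integrable M (\<lambda>x. (a x) ^ 4)" "integrable M (\<lambda>x. (b x) ^ 4)"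
      by (intro bounded_mb_integrable bounded_mb_intros ab)+
    have b4: "(\<integral>x. (b x) ^ 4 \<partial>M) = (\<integral>x. (a x) ^ 4 \<partial>M)"
      unfolding a_def b_def by (rule col_shift) simp
    have "(\<integral>x. (a x)\<^sup>2 * (b x)\<^sup>2 \<partial>M) = (\<integral>x. ((a x + b x) ^ 4 + (a x - b x) ^ 4 - 2 * (a x) ^ 4 - 2 * (b x) ^ 4) / 12 \<partial>M)"
      by (intro Bochner_Integration.integral_cong refl) (simp add: power4_eq_xxxx power2_eq_square algebra_simps)
    also have "\<dots> = ((\<integral>x. (a x + b x) ^ 4 \<partial>M) + (\<integral>x. (a x - b x) ^ 4 \<partial>M) - 4 * (\<integral>x. (a x) ^ 4 \<partial>M)) / 12"
      using i b4 by simp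
    finally show ?thesis
      unfolding q_def pc a_def[symmetric] b_def[symmetric]
      by (simp add: add_divide_distrib diff_divide_distrib)
  qed
  have "(\<lambda>n. (q 1 n + q (- 1) n - 4 * q 0 n) / 12) \<longlonglongrightarrow>
    (3 * ((1 + 1\<^sup>2) * \<sigma>2)\<^sup>2 + 3 * ((1 + (- 1)\<^sup>2) * \<sigma>2)\<^sup>2 - 4 * (3 * ((1 + 0\<^sup>2) * \<sigma>2)\<^sup>2)) / 12"
    by (intro tendsto_intros lim) simp
  then show ?thesis unfolding polar by (simp add: power_mult_distrib)
qed

lemma col_fourth_moment: "(\<integral>x. (col n v x) ^ 4 \<partial>M) \<le> 11 * K ^ 4 * (real n)\<^sup>2"
proof -
  interpret P: uniformly_bounded_martingale_differences M "pair 0 1" "\<lambda>u. F (int u) (int 1)" "(1 + 0\<^sup>2) * \<sigma>2" "(1 + \<bar>0\<bar>) * K"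
    by (rule pair_martingale) simp
  have "P.mart n x = col n 0 x" for x unfolding P.mart_def pair_def col_def by simp
  moreover have "(\<integral>x. (col n v x) ^ 4 \<partial>M) = (\<integral>x. (col n 0 x) ^ 4 \<partial>M)" by (rule col_shift) simp
  ultimately show ?thesis using P.fourth_moment_bound[of n] by simp
qed

lemma col_second_moment: "(\<integral>x. (col n v x)\<^sup>2 \<partial>M) = n * \<sigma>2"
proof -
  interpret P: uniformly_bounded_martingale_differences M "pair 0 1" "\<lambda>u. F (int u) (int 1)" "(1 + 0\<^sup>2) * \<sigma>2" "(1 + \<bar>0\<bar>) * K"
    by (rule pair_martingale) simp
  have "P.mart n x = col n 0 x" for x unfolding P.mart_def pair_def col_def by simp
  moreover have "(\<integral>x. (col n v x)\<^sup>2 \<partial>M) = (\<integral>x. (col n 0 x)\<^sup>2 \<partial>M)" by (rule col_shift) simp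
  ultimately show ?thesis using P.second_moment_mart[of n] by simp
qed

definition ncol :: "nat \<Rightarrow> nat \<Rightarrow> 'a \<Rightarrow> real" where
  "ncol n v x = col n (int v + 1) x / sqrt n"

lemma ncol_bounded: "bounded_mb M (ncol n v)"
  unfolding ncol_def by (intro bounded_mb_intros col_bounded)

text \<open>Columns of a fixed height \<open>n\<close>, in the filtration \<open>F n v\<close>; an index shift by one makes column \<open>v + 1\<close> the difference that becomes known at time \<open>v + 1\<close>.\<close>

lemma ncol_martingale:
  assumes n: "1 \<le> n"
  shows "bounded_martingale_differences M (ncol n) (\<lambda>v. F (int n) (int v)) \<sigma>2"
proof unfold_locales
  show "subalgebra M (F (int n) (int k))" for k by (rule sub_F)
  show "sets (F (int n) (int j)) \<subseteq> sets (F (int n) (int k))" if "j \<le> k" for j k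
    using that by (intro F_mono) auto
  show "bounded_mb (F (int n) (int (Suc v))) (ncol n v)" for v
    unfolding ncol_def col_def by (intro bounded_mb_intros shD_bounded_le) auto
  show "AE x in M. E (int n) (int v) (ncol n v) x = 0" for v
  proof -
    have "AE x in M. E (int n) (int v) (ncol n v) x = E (int n) (int v) (col n (int v + 1)) x / sqrt n"
      unfolding ncol_def by (rule sigma_finite_subalgebra.real_cond_exp_cdiv[OF sigma_finite_F bounded_mb_integrable[OF col_bounded]])
    moreover have "AE x in M. E (int n) (int v) (col n (int v + 1)) x = (\<Sum>u<n. E (int n) (int v) (sh (int u + 1) (int v + 1) D) x)"
      unfolding col_def by (rule E_sum) (intro bounded_mb_integrable shD_bounded_M)
    moreover have "AE x in M. \<forall>u\<in>{..<n}. E (int n) (int v) (sh (int u + 1) (int v + 1) D) x = 0"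
      by (intro AE_finite_allI finite_lessThan orthomart_E_row[OF D]) auto
    ultimately show ?thesis by eventually_elim simp
  qed
  show "(\<integral>x. (ncol n v x)\<^sup>2 \<partial>M) = \<sigma>2" for v
    using n col_second_moment[of n "int v + 1"] unfolding ncol_def by (simp add: power_divide)
qed

lemma ncol_fourth_moment:
  assumes n: "1 \<le> n" shows "(\<integral>x. (ncol n v x) ^ 4 \<partial>M) \<le> 11 * K ^ 4"
proof -
  have s: "(sqrt (real n)) ^ 4 = (real n)\<^sup>2" by (simp add: power4_eq_xxxx power2_eq_square mult.assoc)
  have "(\<integral>x. (ncol n v x) ^ 4 \<partial>M) = (\<integral>x. (col n (int v + 1) x) ^ 4 \<partial>M) / (real n)\<^sup>2"
    unfolding ncol_def power_divide s by simp
  also have "\<dots> \<le> 11 * K ^ 4" using col_fourth_moment[of n "int v + 1"] n by (simp add: divide_le_eq)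
  finally show ?thesis .
qed

lemma ncol_mixed_moment:
  assumes n: "1 \<le> n" and vw: "v < w"
  shows "(\<integral>x. (ncol n v x)\<^sup>2 * (ncol n w x)\<^sup>2 \<partial>M) = (\<integral>x. (col n 0 x)\<^sup>2 * (col n (int (w - v)) x)\<^sup>2 \<partial>M) / (real n)\<^sup>2"
proof -
  have "(\<integral>x. (ncol n v x)\<^sup>2 * (ncol n w x)\<^sup>2 \<partial>M) = (\<integral>x. (col n (int v + 1) x)\<^sup>2 * (col n (int w + 1) x)\<^sup>2 \<partial>M) / (real n)\<^sup>2"
    unfolding ncol_def by (simp add: power_divide power2_eq_square)
  also have "(\<integral>x. (col n (int v + 1) x)\<^sup>2 * (col n (int w + 1) x)\<^sup>2 \<partial>M) =
    (\<integral>x. sh 0 (int v + 1) (\<lambda>x. (col n 0 x)\<^sup>2 * (col n (int (w - v)) x)\<^sup>2) x \<partial>M)"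
  proof -
    have "col n (int v + 1) = sh 0 (int v + 1) (col n 0)" "col n (int w + 1) = sh 0 (int v + 1) (col n (int (w - v)))"
      unfolding sh_col using vw by (simp_all add: of_nat_diff)
    then show ?thesis by (simp add: sh_def)
  qed
  also have "\<dots> = (\<integral>x. (col n 0 x)\<^sup>2 * (col n (int (w - v)) x)\<^sup>2 \<partial>M)"
    by (rule integral_sh) (intro bounded_mb_measurable bounded_mb_intros col_bounded)
  finally show ?thesis .
qed

text \<open>The variance of a block average of squared columns consists of \<open>b\<close> diagonal terms, bounded by fourth moments, and of covariances, which tend to zero as
\<open>n\<close> grows. So for a block of fixed length \<open>b\<close> it is of order \<open>1 / b\<close> once \<open>n\<close> is large.\<close>

lemma block_variance:
  assumes b: "1 \<le> b"
  shows "\<exists>N\<ge>1. \<forall>n\<ge>N. \<forall>s. (\<integral>x. \<bar>(\<Sum>v\<in>{s..<s + b}. (ncol n v x)\<^sup>2) - b * \<sigma>2\<bar> \<partial>M) \<le> b * sqrt ((11 * K ^ 4 + 1) / b)"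
proof -
  have "eventually (\<lambda>n. \<forall>w\<in>{1..<b}. (\<integral>x. (col n 0 x)\<^sup>2 * (col n (int w) x)\<^sup>2 \<partial>M) / (real n)\<^sup>2 < \<sigma>2\<^sup>2 + 1 / b) sequentially"
    using mixed_moment_limit b by (intro eventually_ball_finite ballI order_tendstoD(2)) auto
  then obtain N0 where N0: "\<And>n w. n \<ge> N0 \<Longrightarrow> w \<in> {1..<b} \<Longrightarrow> (\<integral>x. (col n 0 x)\<^sup>2 * (col n (int w) x)\<^sup>2 \<partial>M) / (real n)\<^sup>2 < \<sigma>2\<^sup>2 + 1 / b"
    unfolding eventually_sequentially by blast
  have "(\<integral>x. \<bar>(\<Sum>v\<in>{s..<s + b}. (ncol n v x)\<^sup>2) - b * \<sigma>2\<bar> \<partial>M) \<le> b * sqrt ((11 * K ^ 4 + 1) / b)" if n: "n \<ge> max 1 N0" for n s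
  proof -
    have n1: "1 \<le> n" using n by simp
    interpret P: bounded_martingale_differences M "ncol n" "\<lambda>v. F (int n) (int v)" \<sigma>2 by (rule ncol_martingale[OF n1])
    define q where "q v x = (ncol n v x)\<^sup>2 - \<sigma>2" for v x
    have qb: "bounded_mb M (q v)" for v unfolding q_def[abs_def] by (intro bounded_mb_intros ncol_bounded)
    have e: "(\<Sum>v\<in>{s..<s + b}. (ncol n v x)\<^sup>2) - b * \<sigma>2 = (\<Sum>v\<in>{s..<s + b}. q v x)" for x
      unfolding q_def by (simp add: sum_subtractf)
    have qq: "(\<integral>x. q v x * q w x \<partial>M) = (\<integral>x. (ncol n v x)\<^sup>2 * (ncol n w x)\<^sup>2 \<partial>M) - \<sigma>2\<^sup>2" for v w
    proof -
      have i: "integrable M (\<lambda>x. (ncol n v x)\<^sup>2 * (ncol n w x)\<^sup>2)" "integrable M (\<lambda>x. (ncol n v x)\<^sup>2)" "integrable M (\<lambda>x. (ncol n w x)\<^sup>2)"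
        by (intro bounded_mb_integrable bounded_mb_intros ncol_bounded)+
      have "(\<integral>x. q v x * q w x \<partial>M) = (\<integral>x. (ncol n v x)\<^sup>2 * (ncol n w x)\<^sup>2 - \<sigma>2 * (ncol n v x)\<^sup>2 - \<sigma>2 * (ncol n w x)\<^sup>2 + \<sigma>2 * \<sigma>2 \<partial>M)"
        unfolding q_def by (intro Bochner_Integration.integral_cong refl) (simp add: algebra_simps)
      then show ?thesis using i P.second_moment by (simp add: prob_space power2_eq_square)
    qed
    have diag: "(\<integral>x. q v x * q v x \<partial>M) \<le> 11 * K ^ 4" for v
    proof -
      have "(\<integral>x. (ncol n v x)\<^sup>2 * (ncol n v x)\<^sup>2 \<partial>M) = (\<integral>x. (ncol n v x) ^ 4 \<partial>M)"
        by (simp add: power4_eq_xxxx power2_eq_square mult.assoc)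
      moreover have "0 \<le> \<sigma>2\<^sup>2" by simp
      ultimately show ?thesis unfolding qq using ncol_fourth_moment[OF n1, of v] by linarith
    qed
    have off: "(\<integral>x. q v x * q w x \<partial>M) \<le> 1 / b" if "v \<in> {s..<s + b}" "w \<in> {s..<s + b}" "v < w" for v w
    proof -
      have "w - v \<in> {1..<b}" using that by auto
      then show ?thesis unfolding qq ncol_mixed_moment[OF n1 that(3)] using N0[of n "w - v"] n by simp
    qed
    have "(\<integral>x. (\<Sum>v\<in>{s..<s + b}. q v x)\<^sup>2 \<partial>M) = (\<Sum>v\<in>{s..<s + b}. \<Sum>w\<in>{s..<s + b}. \<integral>x. q v x * q w x \<partial>M)"
      unfolding power2_eq_square sum_product
      by (subst Bochner_Integration.integral_sum, intro bounded_mb_integrable bounded_mb_intros qb,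
          intro sum.cong refl Bochner_Integration.integral_sum bounded_mb_integrable bounded_mb_intros qb)
    also have "\<dots> \<le> (\<Sum>v\<in>{s..<s + b}. \<Sum>w\<in>{s..<s + b}. (if w = v then 11 * K ^ 4 else 0) + 1 / b)"
    proof (intro sum_mono)
      fix v w assume vw: "v \<in> {s..<s + b}" "w \<in> {s..<s + b}"
      consider "v < w" | "w < v" | "v = w" by linarith
      then show "(\<integral>x. q v x * q w x \<partial>M) \<le> (if w = v then 11 * K ^ 4 else 0) + 1 / b"
      proof cases
        case 1 then show ?thesis using off[OF vw 1] by simp
      next
        case 2 then show ?thesis using off[OF vw(2,1) 2] by (simp add: mult.commute)
      next
        case 3
        have "0 \<le> 1 / real b" by simp
        with diag[of v] have "(\<integral>x. q v x * q v x \<partial>M) \<le> 11 * K ^ 4 + 1 / b" by linarith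
        then show ?thesis using 3 by simp
      qed
    qed
    also have "\<dots> = b * (11 * K ^ 4 + 1)"
      using b by (simp add: sum.distrib distrib_left)
    also have "\<dots> = (real b)\<^sup>2 * ((11 * K ^ 4 + 1) / b)"
      using b by (simp add: power2_eq_square)
    also have "\<dots> = (b * sqrt ((11 * K ^ 4 + 1) / b))\<^sup>2"
      by (simp add: power_mult_distrib)
    finally have "l2n M (\<lambda>x. \<Sum>v\<in>{s..<s + b}. q v x) \<le> b * sqrt ((11 * K ^ 4 + 1) / b)"
      by (intro l2n_leI) auto
    moreover have "(\<integral>x. \<bar>\<Sum>v\<in>{s..<s + b}. q v x\<bar> \<partial>M) \<le> l2n M (\<lambda>x. \<Sum>v\<in>{s..<s + b}. q v x)"
      by (intro l1_le_l2n bounded_mb_sq_integrable bounded_mb_intros qb)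
    ultimately show ?thesis unfolding e by linarith
  qed
  then show ?thesis by (intro exI[of _ "max 1 N0"]) auto
qed

text \<open>First the block length \<open>b\<close> is chosen so large that block averages of squares concentrate well enough, then \<open>n\<close> and \<open>m\<close> large depending on \<open>b\<close>. Both bounds
hold for all larger \<open>n\<close> and \<open>m\<close> independently of each other, as the limit over rectangles requires.\<close>

theorem orthomartingale_clt:
  assumes e: "0 < e"
  shows "\<exists>N. \<forall>n\<ge>N. \<forall>m\<ge>N. \<bar>(\<integral>x. cos (t / (sqrt n * sqrt m) * box_sum n m D x + p) \<partial>M) - exp (- (t\<^sup>2 * \<sigma>2 / 2)) * cos p\<bar> \<le> e"
proof -
  define C where "C = 11 * K ^ 4"
  have C0: "0 \<le> C" unfolding C_def by simp
  obtain b :: nat where b: "1 \<le> b" and bt: "t\<^sup>2 * sqrt ((C + 1) / b) / 2 \<le> e / 2"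
  proof -
    obtain b0 :: nat where b0: "(t\<^sup>2 / e)\<^sup>2 * (C + 1) \<le> b0" using real_arch_simple by blast
    define b where "b = max 1 b0"
    have bp: "0 < real b" unfolding b_def by simp
    have "(t\<^sup>2 / e)\<^sup>2 * ((C + 1) / b) \<le> 1"
      using b0 bp unfolding b_def by (simp add: divide_le_eq)
    then have "sqrt ((t\<^sup>2 / e)\<^sup>2 * ((C + 1) / b)) \<le> sqrt 1" by (rule real_sqrt_le_mono)
    moreover have "sqrt ((t\<^sup>2 / e)\<^sup>2 * ((C + 1) / b)) = t\<^sup>2 / e * sqrt ((C + 1) / b)"
      unfolding real_sqrt_mult real_sqrt_abs using e by simp
    ultimately have "t\<^sup>2 / e * sqrt ((C + 1) / b) \<le> 1" by (simp only: real_sqrt_one)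
    then have "t\<^sup>2 * sqrt ((C + 1) / b) / 2 \<le> e / 2" using e by (simp add: field_simps)
    then show ?thesis using that[of b] unfolding b_def by simp
  qed
  obtain N1 where N1: "1 \<le> N1" and blk: "\<And>n s. n \<ge> N1 \<Longrightarrow> (\<integral>x. \<bar>(\<Sum>v\<in>{s..<s + b}. (ncol n v x)\<^sup>2) - b * \<sigma>2\<bar> \<partial>M) \<le> b * sqrt ((C + 1) / b)"
    using block_variance[OF b] unfolding C_def by blast
  define B where "B = \<bar>t\<bar> ^ 3 * (\<sigma>2 + (real b) ^ 3 * C) + t ^ 4 * \<sigma>2\<^sup>2 * b + \<bar>t\<bar> * sqrt (b * \<sigma>2) + t\<^sup>2 * \<sigma>2 * b"
  obtain N2 :: nat where N2: "(2 * \<bar>B\<bar> / e)\<^sup>2 \<le> N2" using real_arch_simple by blast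
  have "\<bar>(\<integral>x. cos (t / (sqrt n * sqrt m) * box_sum n m D x + p) \<partial>M) - exp (- (t\<^sup>2 * \<sigma>2 / 2)) * cos p\<bar> \<le> e"
    if n: "n \<ge> max N1 (max 1 N2)" and m: "m \<ge> max N1 (max 1 N2)" for n m
  proof -
    have n1: "1 \<le> n" "1 \<le> m" "n \<ge> N1" using n m by auto
    interpret P: bounded_martingale_differences M "ncol n" "\<lambda>v. F (int n) (int v)" \<sigma>2 by (rule ncol_martingale[OF n1(1)])
    have mart: "P.mart m x = box_sum n m D x / sqrt n" for x
    proof -
      have r: "(\<Sum>u=1..k. f u) = (\<Sum>u<k. f (u + 1))" for k and f :: "nat \<Rightarrow> real"
        by (rule sum.reindex_bij_witness[of _ "\<lambda>u. u + 1" "\<lambda>u. u - 1"]) auto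
      have "box_sum n m D x = (\<Sum>v<m. col n (int v + 1) x)"
        unfolding box_sum_def col_def r by (subst sum.swap) (simp add: add.commute)
      then show ?thesis unfolding P.mart_def ncol_def by (simp add: sum_divide_distrib)
    qed
    have "\<bar>(\<integral>x. cos (t / sqrt m * P.mart m x + p) \<partial>M) - exp (- (t\<^sup>2 * \<sigma>2 / 2)) * cos p\<bar> \<le> t\<^sup>2 * sqrt ((C + 1) / b) / 2 + B / sqrt m"
      unfolding B_def
      by (rule P.cosint_bound[OF ncol_fourth_moment[OF n1(1), folded C_def] _ b n1(2)])
        (use blk[OF n1(3)] in \<open>simp add: P.sqs_def\<close>)
    also have "B / sqrt m \<le> e / 2"
    proof -
      have "(2 * \<bar>B\<bar> / e)\<^sup>2 \<le> m" using N2 m by linarith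
      then have "2 * \<bar>B\<bar> / e \<le> sqrt m" by (rule real_le_rsqrt)
      then have "2 * \<bar>B\<bar> \<le> e * sqrt m" using e by (simp add: field_simps)
      then have "2 * B \<le> e * sqrt m" by linarith
      then show ?thesis using n1(2) by (simp add: field_simps)
    qed
    finally show ?thesis using bt unfolding mart by (simp add: mult.commute)
  qed
  then show ?thesis by blast
qed

end

section \<open>The central limit theorem for square integrable fields\<close>

text \<open>Pair \<open>j\<close> with \<open>N - j\<close>.\<close>

lemma subadditive_le_average:
  fixes f :: "nat \<Rightarrow> real"
  assumes f0: "f 0 = 0" and nn: "\<And>i. 0 \<le> f i" and sub: "\<And>i j. f (i + j) \<le> f i + f j" and N: "1 \<le> N"
  shows "f N \<le> 2 / N * (\<Sum>j=1..N. f j)"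
proof -
  have r: "(\<Sum>j\<le>N. f (N - j)) = (\<Sum>j\<le>N. f j)"
    by (rule sum.reindex_bij_witness[of _ "\<lambda>j. N - j" "\<lambda>j. N - j"]) auto
  have z: "(\<Sum>j\<le>N. f j) = (\<Sum>j=1..N. f j)"
    by (rule sum.mono_neutral_right) (auto simp: f0 not_le intro: Suc_leI)
  have "(\<Sum>j\<le>N. f N) \<le> (\<Sum>j\<le>N. f j + f (N - j))"
  proof (rule sum_mono)
    fix j assume "j \<in> {..N}"
    then show "f N \<le> f j + f (N - j)" using sub[of j "N - j"] by simp
  qed
  then have le: "(N + 1) * f N \<le> 2 * (\<Sum>j=1..N. f j)" by (simp add: sum.distrib r z)
  have "N * f N \<le> 2 * (\<Sum>j=1..N. f j)" using le nn[of N] by (simp add: algebra_simps)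
  then show ?thesis using N by (simp add: field_simps)
qed

text \<open>A geometric series that starts at the first \<open>q\<close> with \<open>j \<le> 2^q\<close>. In the induction on \<open>Q\<close> the term
\<open>- 2 * w Q\<close> keeps room for the remaining terms, each of which is at most half its predecessor.\<close>

lemma dyadic_weights:
  fixes j :: nat
  assumes j: "1 \<le> j"
  shows "(\<Sum>q<Q. if j \<le> 2 ^ q then 1 / (2 ^ q * sqrt (2 ^ q)) else 0) \<le> 2 / (j * sqrt j)"
proof -
  define w :: "nat \<Rightarrow> real" where "w q = 1 / (2 ^ q * sqrt (2 ^ q))" for q
  have w0: "0 \<le> w q" for q unfolding w_def by simp
  have wS: "2 * w (Suc q) \<le> w q" for q
  proof -
    have "(2::real) ^ q * sqrt (2 ^ q) \<le> 2 ^ q * sqrt (2 ^ Suc q)" by (intro mult_left_mono) auto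
    then have "1 / (2 ^ q * sqrt (2 ^ Suc q)) \<le> w q" unfolding w_def by (intro divide_left_mono mult_pos_pos) auto
    then show ?thesis unfolding w_def by simp
  qed
  have wj: "w q \<le> 1 / (j * sqrt j)" if "j \<le> 2 ^ q" for q
  proof -
    have "real j \<le> 2 ^ q" using that by (metis of_nat_le_iff of_nat_numeral of_nat_power)
    then have "j * sqrt j \<le> 2 ^ q * sqrt (2 ^ q)" by (intro mult_mono) auto
    then show ?thesis unfolding w_def using j by (intro divide_left_mono mult_pos_pos) auto
  qed
  have "(\<Sum>q<Q. if j \<le> 2 ^ q then w q else 0) \<le> (if j \<le> 2 ^ Q then 2 / (j * sqrt j) - 2 * w Q else 0)"
  proof (induction Q)
    case 0
    then show ?case using j by (auto simp: w_def)
  next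
    case (Suc Q)
    consider "j \<le> 2 ^ Q" | "\<not> j \<le> 2 ^ Q" "j \<le> 2 ^ Suc Q" | "\<not> j \<le> 2 ^ Suc Q" "\<not> j \<le> 2 ^ Q" by fastforce
    then show ?case
    proof cases
      case 1
      then have "j \<le> 2 ^ Suc Q" by simp
      then show ?thesis using Suc 1 wS[of Q] by simp
    next
      case 2
      then show ?thesis using Suc wj[of "Suc Q"] by simp
    next
      case 3
      then show ?thesis using Suc by simp
    qed
  qed
  also have "\<dots> \<le> 2 / (j * sqrt j)" using w0[of Q] by simp
  finally show ?thesis unfolding w_def .
qed

lemma dyadic_sum_le:
  fixes g :: "nat \<Rightarrow> real"
  assumes g: "\<And>j. 0 \<le> g j"
  shows "(\<Sum>q<Q. 1 / (2 ^ q * sqrt (2 ^ q)) * (\<Sum>j=1..2 ^ q. g j)) \<le> 2 * (\<Sum>j=1..2 ^ Q. g j / (j * sqrt j))"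
proof -
  have "(\<Sum>q<Q. 1 / (2 ^ q * sqrt (2 ^ q)) * (\<Sum>j=1..2 ^ q. g j))
    = (\<Sum>q<Q. \<Sum>j=1..2 ^ Q. (if j \<le> 2 ^ q then 1 / (2 ^ q * sqrt (2 ^ q)) else 0) * g j)"
  proof (rule sum.cong[OF refl])
    fix q assume q: "q \<in> {..<Q}"
    have le: "(2::nat) ^ q \<le> 2 ^ Q" using q by (intro power_increasing) auto
    have "(\<Sum>j=1..2 ^ Q. (if j \<le> 2 ^ q then 1 / (2 ^ q * sqrt (2 ^ q)) else 0) * g j)
      = (\<Sum>j=1..2 ^ q. (if j \<le> 2 ^ q then 1 / (2 ^ q * sqrt (2 ^ q)) else 0) * g j)"
      by (rule sum.mono_neutral_right) (use le in auto)
    also have "\<dots> = (\<Sum>j=1..2 ^ q. 1 / (2 ^ q * sqrt (2 ^ q)) * g j)" by (intro sum.cong) auto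
    finally show "1 / (2 ^ q * sqrt (2 ^ q)) * (\<Sum>j=1..2 ^ q. g j) = (\<Sum>j=1..2 ^ Q. (if j \<le> 2 ^ q then 1 / (2 ^ q * sqrt (2 ^ q)) else 0) * g j)"
      by (simp add: sum_distrib_left)
  qed
  also have "\<dots> = (\<Sum>j=1..2 ^ Q. (\<Sum>q<Q. if j \<le> 2 ^ q then 1 / (2 ^ q * sqrt (2 ^ q)) else 0) * g j)"
    by (subst sum.swap) (simp add: sum_distrib_right)
  also have "\<dots> \<le> (\<Sum>j=1..2 ^ Q. 2 / (j * sqrt j) * g j)"
    by (intro sum_mono mult_right_mono dyadic_weights g) auto
  finally show ?thesis by (simp add: sum_distrib_left)
qed

text \<open>A nonnegative doubly subadditive array is dominated at \<open>(2^q, 2^p)\<close> by its averages over smaller indices. Exchanging the order of summation turns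
the dyadic sum of these averages into the series with weights \<open>(j k)^(-3/2)\<close>.\<close>

lemma dyadic_double_sum_bounded:
  fixes a :: "nat \<Rightarrow> nat \<Rightarrow> real"
  assumes nn: "\<And>j k. 0 \<le> a j k" and z: "\<And>k. a 0 k = 0" "\<And>j. a j 0 = 0"
    and s1: "\<And>i j k. a (i + j) k \<le> a i k + a j k" and s2: "\<And>i j k. a k (i + j) \<le> a k i + a k j"
    and bd: "\<And>J K. (\<Sum>j=1..J. \<Sum>k=1..K. a j k / ((j * sqrt j) * (k * sqrt k))) \<le> B"
  shows "(\<Sum>q<Q. \<Sum>p<P. a (2 ^ q) (2 ^ p) / (sqrt (2 ^ q) * sqrt (2 ^ p))) \<le> 16 * B"
proof -
  define w :: "nat \<Rightarrow> real" where "w q = 1 / (2 ^ q * sqrt (2 ^ q))" for q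
  have w0: "0 \<le> w q" for q unfolding w_def by simp
  have one: "a (2 ^ q) (2 ^ p) / (sqrt (2 ^ q) * sqrt (2 ^ p)) \<le> 4 * (w q * (\<Sum>j=1..2 ^ q. w p * (\<Sum>k=1..2 ^ p. a j k)))" for q p
  proof -
    have "a (2 ^ q) (2 ^ p) \<le> 2 / real (2 ^ q) * (\<Sum>j=1..2 ^ q. a j (2 ^ p))"
      by (rule subadditive_le_average) (use z s1 nn in auto)
    also have "\<dots> \<le> 2 / real (2 ^ q) * (\<Sum>j=1..2 ^ q. 2 / real (2 ^ p) * (\<Sum>k=1..2 ^ p. a j k))"
      by (intro mult_left_mono sum_mono subadditive_le_average) (use z s2 nn in auto)
    finally have "a (2 ^ q) (2 ^ p) / (sqrt (2 ^ q) * sqrt (2 ^ p)) \<le>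
      (2 / real (2 ^ q) * (\<Sum>j=1..2 ^ q. 2 / real (2 ^ p) * (\<Sum>k=1..2 ^ p. a j k))) / (sqrt (2 ^ q) * sqrt (2 ^ p))"
      by (rule divide_right_mono) simp
    also have "\<dots> = 4 * (w q * (\<Sum>j=1..2 ^ q. w p * (\<Sum>k=1..2 ^ p. a j k)))"
      unfolding w_def sum_distrib_left[symmetric] by (simp add: field_simps)
    finally show ?thesis .
  qed
  have "(\<Sum>q<Q. \<Sum>p<P. a (2 ^ q) (2 ^ p) / (sqrt (2 ^ q) * sqrt (2 ^ p))) \<le>
    (\<Sum>q<Q. \<Sum>p<P. 4 * (w q * (\<Sum>j=1..2 ^ q. w p * (\<Sum>k=1..2 ^ p. a j k))))"
    by (intro sum_mono one)
  also have "\<dots> = 4 * (\<Sum>q<Q. w q * (\<Sum>j=1..2 ^ q. \<Sum>p<P. w p * (\<Sum>k=1..2 ^ p. a j k)))"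
  proof -
    have "(\<Sum>p<P. 4 * (w q * (\<Sum>j=1..2 ^ q. w p * (\<Sum>k=1..2 ^ p. a j k)))) =
      4 * (w q * (\<Sum>j=1..2 ^ q. \<Sum>p<P. w p * (\<Sum>k=1..2 ^ p. a j k)))" for q
    proof -
      have "(\<Sum>j=1..2 ^ q. \<Sum>p<P. w p * (\<Sum>k=1..2 ^ p. a j k)) = (\<Sum>p<P. \<Sum>j=1..2 ^ q. w p * (\<Sum>k=1..2 ^ p. a j k))"
        by (rule sum.swap)
      then show ?thesis by (simp only: sum_distrib_left[symmetric])
    qed
    then show ?thesis by (simp only: sum_distrib_left[symmetric])
  qed
  also have "\<dots> \<le> 4 * (\<Sum>q<Q. w q * (\<Sum>j=1..2 ^ q. 2 * (\<Sum>k=1..2 ^ P. a j k / (k * sqrt k))))"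
    unfolding w_def by (intro mult_left_mono sum_mono dyadic_sum_le nn) (auto simp: w0)
  also have "\<dots> \<le> 4 * (2 * (\<Sum>j=1..2 ^ Q. (2 * (\<Sum>k=1..2 ^ P. a j k / (k * sqrt k))) / (j * sqrt j)))"
    unfolding w_def by (intro mult_left_mono dyadic_sum_le mult_nonneg_nonneg sum_nonneg divide_nonneg_nonneg nn) auto
  also have "\<dots> = 16 * (\<Sum>j=1..2 ^ Q. \<Sum>k=1..2 ^ P. a j k / ((j * sqrt j) * (k * sqrt k)))"
    by (simp add: sum_distrib_left sum_divide_distrib mult_ac)
  also have "\<dots> \<le> 16 * B" by (intro mult_left_mono bd) simp
  finally show ?thesis .
qed

context commuting_shifts
begin

lemma l2n_cond_exp_add_shift:
  assumes W: "sq_integrable M W" and W': "sq_integrable M W'"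
  shows "l2n M (E 0 0 (\<lambda>x. W x + sh (int a) (int b) W' x)) \<le> l2n M (E 0 0 W) + l2n M (E 0 0 W')"
proof -
  note i = sq_integrable_integrable
  have "AE x in M. E 0 0 (\<lambda>x. W x + sh (int a) (int b) W' x) x = E 0 0 W x + E 0 0 (sh (int a) (int b) W') x"
    by (intro E_add i W sq_integrable_sh W')
  moreover have "AE x in M. E 0 0 (sh (int a) (int b) (E 0 0 W')) x = E 0 0 (sh (int a) (int b) W') x"
    by (rule E00_shift_E00[OF i[OF W']])
  ultimately have "AE x in M. E 0 0 (\<lambda>x. W x + sh (int a) (int b) W' x) x = E 0 0 W x + E 0 0 (sh (int a) (int b) (E 0 0 W')) x"
    by eventually_elim simp
  then have "l2n M (E 0 0 (\<lambda>x. W x + sh (int a) (int b) W' x)) = l2n M (\<lambda>x. E 0 0 W x + E 0 0 (sh (int a) (int b) (E 0 0 W')) x)"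
    by (intro l2n_cong_AE) auto
  also have "\<dots> \<le> l2n M (E 0 0 W) + l2n M (E 0 0 (sh (int a) (int b) (E 0 0 W')))"
    by (intro l2n_triangle E_sq sq_integrable_sh W W')
  also have "l2n M (E 0 0 (sh (int a) (int b) (E 0 0 W'))) \<le> l2n M (sh (int a) (int b) (E 0 0 W'))"
    by (intro E_le sq_integrable_sh E_sq W')
  also have "\<dots> = l2n M (E 0 0 W')" by (intro l2n_sh) simp
  finally show ?thesis by simp
qed

lemma sum_lessThan_add: "(\<Sum>u<i + j. f u) = (\<Sum>u<i. f u) + (\<Sum>u<j. f (u + i))" for f :: "nat \<Rightarrow> real"
  by (induction j) (simp_all add: add.assoc add.commute)

lemma condsum_norm_add_rows:
  assumes h: "sq_integrable M h" shows "condsum_norm (i + j) k h \<le> condsum_norm i k h + condsum_norm j k h"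
proof -
  have "(\<lambda>x. \<Sum>u<i + j. \<Sum>v<k. sh (int u) (int v) h x) =
    (\<lambda>x. (\<Sum>u<i. \<Sum>v<k. sh (int u) (int v) h x) + sh (int i) (int 0) (\<lambda>x. \<Sum>u<j. \<Sum>v<k. sh (int u) (int v) h x) x)"
    unfolding sum_lessThan_add by (simp add: sh_def \<theta>_add)
  then show ?thesis unfolding condsum_norm_def condsum_def
    by (simp only:) (intro l2n_cond_exp_add_shift sq_integrable_sum sq_integrable_sh h)
qed

lemma condsum_norm_add_cols:
  assumes h: "sq_integrable M h" shows "condsum_norm k (i + j) h \<le> condsum_norm k i h + condsum_norm k j h"
proof -
  have "(\<lambda>x. \<Sum>u<k. \<Sum>v<i + j. sh (int u) (int v) h x) =
    (\<lambda>x. (\<Sum>u<k. \<Sum>v<i. sh (int u) (int v) h x) + sh (int 0) (int i) (\<lambda>x. \<Sum>u<k. \<Sum>v<j. sh (int u) (int v) h x) x)"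
    unfolding sum_lessThan_add by (simp add: sh_def \<theta>_add sum.distrib)
  then show ?thesis unfolding condsum_norm_def condsum_def
    by (simp only:) (intro l2n_cond_exp_add_shift sq_integrable_sum sq_integrable_sh h)
qed

text \<open>The only place where the weights \<open>(j k)^(-3/2)\<close> matter: the norms of the prediction sums are subadditive in both indices.\<close>

lemma dyad_sums_bounded:
  assumes h: "sq_integrable M h"
    and bd: "\<And>J K. (\<Sum>j=1..J. \<Sum>k=1..K. l2n M (E 1 1 (box_sum j k h)) / ((j * sqrt j) * (k * sqrt k))) \<le> B"
  shows "(\<Sum>q<Q. \<Sum>p<P. dyad q p h) \<le> 16 * B"
  unfolding dyad_def
proof (rule dyadic_double_sum_bounded[where a="\<lambda>j k. condsum_norm j k h"])
  have z: "l2n M (E 0 0 (\<lambda>x. 0)) = 0"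
  proof -
    have "l2n M (E 0 0 (\<lambda>x. 0)) = l2n M (\<lambda>x. 0)"
      using E_F_meas[of "\<lambda>x. 0" 0 0] by (intro l2n_cong_AE) auto
    then show ?thesis by simp
  qed
  show "condsum_norm 0 k h = 0" "condsum_norm j 0 h = 0" for j k unfolding condsum_norm_def condsum_def using z by simp_all
  show "(\<Sum>j=1..J. \<Sum>k=1..K. condsum_norm j k h / ((j * sqrt j) * (k * sqrt k))) \<le> B" for J K
    using bd unfolding condsum_norm_eq_E11[OF h] .
qed (use condsum_norm_add_rows[OF h] condsum_norm_add_cols[OF h] in auto)

text \<open>The normalized norms of the sums of \<open>h\<close> are within \<open>e k\<close> of the norm \<open>s k\<close> of the \<open>k\<close>-th approximating difference, so \<open>s\<close> is a Cauchy sequence and its limit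
\<open>c\<close> is also the limit of the normalized norms. The integrals of cosines are Lipschitz in L1 and pass to the limit in the same way.\<close>

theorem field_clt:
  assumes erg: "ergodic M (\<theta> 1 0)" and h: "sq_integrable M h" and hF: "h \<in> borel_measurable (F 0 0)"
    and bd: "\<And>Q P. (\<Sum>q<Q. \<Sum>p<P. dyad q p h) \<le> B"
  shows "\<exists>c\<ge>0. ((\<lambda>(n, m). l2n M (box_sum n m h) / (sqrt n * sqrt m)) \<longlongrightarrow> c) (sequentially \<times>\<^sub>F sequentially) \<and>
    (\<forall>t p. ((\<lambda>(n, m). \<integral>x. cos (t / (sqrt n * sqrt m) * box_sum n m h x + p) \<partial>M) \<longlongrightarrow> exp (- (t\<^sup>2 * c\<^sup>2 / 2)) * cos p)
      (sequentially \<times>\<^sub>F sequentially))"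
proof -
  define e :: "nat \<Rightarrow> real" where "e k = 1 / (real k + 1)" for k
  have e0: "0 < e k" for k unfolding e_def by simp
  have elim0: "e \<longlonglongrightarrow> 0" unfolding e_def using LIMSEQ_inverse_real_of_nat by (simp add: inverse_eq_divide add.commute)
  have "\<exists>D. bounded_mb (F 0 0) D \<and> orthomart D \<and>
    (\<exists>N. \<forall>n\<ge>N. \<forall>m\<ge>N. l2n M (\<lambda>x. box_sum n m h x - box_sum n m D x) \<le> e k * (sqrt n * sqrt m))" for k
    by (rule bounded_orthomartingale_approximation[OF h hF bd e0])
  then obtain D N where Db: "\<And>k. bounded_mb (F 0 0) (D k)" and Do: "\<And>k. orthomart (D k)"
    and DN: "\<And>k n m. n \<ge> N k \<Longrightarrow> m \<ge> N k \<Longrightarrow> l2n M (\<lambda>x. box_sum n m h x - box_sum n m (D k) x) \<le> e k * (sqrt n * sqrt m)"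
    by metis
  define s where "s k = l2n M (D k)" for k
  define a where "a n m = l2n M (box_sum n m h) / (sqrt n * sqrt m)" for n m :: nat
  have as: "\<bar>a n m - s k\<bar> \<le> e k" if "n \<ge> N k" "m \<ge> N k" "1 \<le> n" "1 \<le> m" for n m k
  proof -
    have p: "0 < sqrt n * sqrt m" using that by simp
    have "\<bar>l2n M (box_sum n m h) - sqrt n * sqrt m * s k\<bar> \<le> e k * (sqrt n * sqrt m)"
      using l2n_reverse_triangle[OF box_sum_sq[OF h] box_sum_sq[OF orthomartD(1)[OF Do]], of n m n m k] DN[OF that(1,2)]
      unfolding l2n_box_sum_orthomart[OF Do] s_def by linarith
    moreover have "l2n M (box_sum n m h) - sqrt n * sqrt m * s k = (sqrt n * sqrt m) * (a n m - s k)"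
      unfolding a_def right_diff_distrib using that by simp
    ultimately have "(sqrt n * sqrt m) * \<bar>a n m - s k\<bar> \<le> (sqrt n * sqrt m) * e k"
      using p by (simp add: abs_mult mult_ac)
    then show ?thesis using p by (simp only: mult_le_cancel_left_pos)
  qed
  have ss: "\<bar>s k - s l\<bar> \<le> e k + e l" for k l
  proof -
    define n where "n = max 1 (max (N k) (N l))"
    have "1 \<le> n" "N k \<le> n" "N l \<le> n" unfolding n_def by auto
    then show ?thesis using as[of k n n] as[of l n n] by linarith
  qed
  have "Cauchy s"
  proof (rule metric_CauchyI)
    fix r :: real assume r: "0 < r"
    have "eventually (\<lambda>k. e k < r / 2) sequentially" by (rule order_tendstoD(2)[OF elim0]) (use r in simp)
    then obtain k0 where k0: "\<And>k. k \<ge> k0 \<Longrightarrow> e k < r / 2" unfolding eventually_sequentially by blast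
    have "dist (s k) (s l) < r" if "k \<ge> k0" "l \<ge> k0" for k l
      using ss[of k l] k0[OF that(1)] k0[OF that(2)] unfolding dist_real_def by linarith
    then show "\<exists>K. \<forall>k\<ge>K. \<forall>l\<ge>K. dist (s k) (s l) < r" by blast
  qed
  then obtain c where c: "s \<longlonglongrightarrow> c" using Cauchy_convergent convergent_def by blast
  have c0: "0 \<le> c" by (rule LIMSEQ_le_const[OF c]) (simp add: s_def)
  have sc: "\<bar>s k - c\<bar> \<le> e k" for k
  proof (rule LIMSEQ_le)
    show "(\<lambda>l. \<bar>s k - s l\<bar>) \<longlonglongrightarrow> \<bar>s k - c\<bar>" by (intro tendsto_intros c)
    show "(\<lambda>l. e k + e l) \<longlonglongrightarrow> e k" using tendsto_add[OF tendsto_const elim0, of "e k"] by simp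
  qed (use ss in auto)
  have ev: "eventually (\<lambda>(n, m). n \<ge> N0 \<and> m \<ge> N0) (sequentially \<times>\<^sub>F sequentially)" for N0 :: nat
    unfolding eventually_prod_sequentially by auto
  have "((\<lambda>z. a (fst z) (snd z)) \<longlongrightarrow> c) (sequentially \<times>\<^sub>F sequentially)"
  proof (rule tendstoI)
    fix r :: real assume r: "0 < r"
    have "eventually (\<lambda>k. e k < r / 2) sequentially" by (rule order_tendstoD(2)[OF elim0]) (use r in simp)
    then obtain k where k: "e k < r / 2" unfolding eventually_sequentially by blast
    show "eventually (\<lambda>z. dist (a (fst z) (snd z)) c < r) (sequentially \<times>\<^sub>F sequentially)"
      using ev[of "max 1 (N k)"]
    proof eventually_elim
      case (elim z)
      then have "\<bar>a (fst z) (snd z) - s k\<bar> \<le> e k" by (intro as) (auto simp: case_prod_beta)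
      then show ?case using sc[of k] k unfolding dist_real_def by linarith
    qed
  qed
  moreover have "((\<lambda>z. \<integral>x. cos (t / (sqrt (fst z) * sqrt (snd z)) * box_sum (fst z) (snd z) h x + p) \<partial>M) \<longlongrightarrow> exp (- (t\<^sup>2 * c\<^sup>2 / 2)) * cos p)
      (sequentially \<times>\<^sub>F sequentially)" for t p
  proof (rule tendstoI)
    fix r :: real assume r: "0 < r"
    define L where "L y = exp (- (t\<^sup>2 * y\<^sup>2 / 2)) * cos p" for y
    have "eventually (\<lambda>k. \<bar>t\<bar> * e k < r / 3) sequentially"
      using order_tendstoD(2)[OF tendsto_mult_right_zero[OF elim0, of "\<bar>t\<bar>"], of "r / 3"] r by simp
    moreover have "eventually (\<lambda>k. dist (L (s k)) (L c) < r / 3) sequentially"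
    proof -
      have "(\<lambda>k. L (s k)) \<longlonglongrightarrow> L c" unfolding L_def by (intro tendsto_intros c) simp
      then show ?thesis using r by (intro tendstoD) auto
    qed
    ultimately have "eventually (\<lambda>k. \<bar>t\<bar> * e k < r / 3 \<and> dist (L (s k)) (L c) < r / 3) sequentially"
      by eventually_elim simp
    then obtain k where k: "\<bar>t\<bar> * e k < r / 3" "dist (L (s k)) (L c) < r / 3"
      unfolding eventually_sequentially by blast
    obtain K where K: "\<And>x. \<bar>D k x\<bar> \<le> K" using Db[of k] unfolding bounded_mb_def by auto
    interpret O: ergodic_orthomartingale M \<theta> F "D k" K "(s k)\<^sup>2"
      by unfold_locales (use erg Do K in \<open>auto simp: s_def l2n_sq\<close>)
    have r3: "0 < r / 3" using r by simp
    obtain N1 where N1: "\<And>n m. n \<ge> N1 \<Longrightarrow> m \<ge> N1 \<Longrightarrow>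
      \<bar>(\<integral>x. cos (t / (sqrt n * sqrt m) * box_sum n m (D k) x + p) \<partial>M) - L (s k)\<bar> \<le> r / 3"
      using O.orthomartingale_clt[OF r3, of t p] unfolding L_def by blast
    show "eventually (\<lambda>z. dist (\<integral>x. cos (t / (sqrt (fst z) * sqrt (snd z)) * box_sum (fst z) (snd z) h x + p) \<partial>M) (exp (- (t\<^sup>2 * c\<^sup>2 / 2)) * cos p) < r)
      (sequentially \<times>\<^sub>F sequentially)"
      using ev[of "max 1 (max N1 (N k))"]
    proof eventually_elim
      case (elim z)
      obtain n m where z: "z = (n, m)" by (cases z)
      have nm: "1 \<le> n" "1 \<le> m" "n \<ge> N k" "m \<ge> N k" "n \<ge> N1" "m \<ge> N1" using elim z by auto
      define \<tau> where "\<tau> = t / (sqrt n * sqrt m)"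
      define f g where "f = box_sum n m h" and "g = box_sum n m (D k)"
      have fg: "sq_integrable M f" "sq_integrable M g"
        unfolding f_def g_def by (intro box_sum_sq h orthomartD(1)[OF Do])+
      note fgm = fg[THEN sq_integrable_measurable]
      have ci: "integrable M (\<lambda>x. cos (\<tau> * f x + p))" "integrable M (\<lambda>x. cos (\<tau> * g x + p))"
        using fgm by (intro integrable_const_bound[of _ 1]; auto)+
      have "\<bar>(\<integral>x. cos (\<tau> * f x + p) \<partial>M) - (\<integral>x. cos (\<tau> * g x + p) \<partial>M)\<bar> \<le> (\<integral>x. \<bar>cos (\<tau> * f x + p) - cos (\<tau> * g x + p)\<bar> \<partial>M)"
        unfolding Bochner_Integration.integral_diff[OF ci, symmetric] by (rule integral_abs_bound)
      also have "\<dots> \<le> (\<integral>x. \<bar>\<tau>\<bar> * \<bar>f x - g x\<bar> \<partial>M)"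
      proof (rule integral_mono)
        fix x
        have "\<bar>cos (\<tau> * f x + p) - cos (\<tau> * g x + p)\<bar> \<le> \<bar>(\<tau> * f x + p) - (\<tau> * g x + p)\<bar>" by (rule cos_lipschitz)
        also have "\<dots> = \<bar>\<tau>\<bar> * \<bar>f x - g x\<bar>" by (simp flip: abs_mult add: algebra_simps)
        finally show "\<bar>cos (\<tau> * f x + p) - cos (\<tau> * g x + p)\<bar> \<le> \<bar>\<tau>\<bar> * \<bar>f x - g x\<bar>" .
      qed (use ci sq_integrable_integrable[OF sq_integrable_diff[OF fg]] in auto)
      also have "\<dots> = \<bar>\<tau>\<bar> * (\<integral>x. \<bar>f x - g x\<bar> \<partial>M)" by simp
      also have "\<dots> \<le> \<bar>\<tau>\<bar> * (e k * (sqrt n * sqrt m))"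
        using l1_le_l2n[OF sq_integrable_diff[OF fg]] DN[OF nm(3,4)] unfolding f_def g_def
        by (intro mult_left_mono) auto
      also have "\<dots> = \<bar>t\<bar> * e k"
        unfolding \<tau>_def using nm by (simp add: abs_mult)
      finally show ?case
        using N1[OF nm(5,6)] k unfolding z f_def g_def \<tau>_def dist_real_def L_def[of c] fst_conv snd_conv by linarith
    qed
  qed
  ultimately show ?thesis using c0 unfolding a_def case_prod_beta by blast
qed

end

section \<open>The law of the field on the space of realizations\<close>

lemma past_generator: 
  assumes "random_field M \<xi>"
  shows "{\<xi> i j -` B \<inter> space M | i j B. i \<le> n \<and> j \<le> m \<and> B \<in> sets borel} \<subseteq> sets M"
  using assms unfolding random_field_def by (auto intro: measurable_sets)

lemma sets_past_algebra:
  "sets (past_algebra M \<xi> n m) = sigma_sets (space M) {\<xi> i j -` B \<inter> space M | i j B. i \<le> n \<and> j \<le> m \<and> B \<in> sets borel}"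
  unfolding past_algebra_def by (rule sets_measure_of) auto

lemma space_past_algebra [simp]: "space (past_algebra M \<xi> n m) = space M"
  unfolding past_algebra_def by (rule space_measure_of) auto

lemma subalgebra_past_algebra:
  assumes "random_field M \<xi>" shows "subalgebra M (past_algebra M \<xi> n m)"
  unfolding subalgebra_def sets_past_algebra
  using sets.sigma_sets_subset[OF past_generator[OF assms]] by simp

lemma past_algebra_mono:
  assumes "a \<le> c" "b \<le> d" shows "sets (past_algebra M \<xi> a b) \<subseteq> sets (past_algebra M \<xi> c d)"
  unfolding sets_past_algebra by (rule sigma_sets_mono') (use assms in \<open>blast intro: order_trans\<close>)

lemma past_algebra_coordinate:
  assumes "i \<le> n" "j \<le> m" shows "\<xi> i j \<in> borel_measurable (past_algebra M \<xi> n m)"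
proof (rule measurableI)
  fix B :: "real set" assume "B \<in> sets borel"
  then show "\<xi> i j -` B \<inter> space (past_algebra M \<xi> n m) \<in> sets (past_algebra M \<xi> n m)"
    unfolding sets_past_algebra space_past_algebra by (intro sigma_sets.Basic) (use assms in blast)
qed simp

lemma measurable_into_past_algebra:
  assumes "f \<in> space N \<rightarrow> space M" and "\<And>i j. i \<le> n \<Longrightarrow> j \<le> m \<Longrightarrow> (\<lambda>x. \<xi> i j (f x)) \<in> borel_measurable N"
  shows "f \<in> N \<rightarrow>\<^sub>M past_algebra M \<xi> n m"
  unfolding past_algebra_def
proof (rule measurable_measure_of)
  fix A assume "A \<in> {\<xi> i j -` B \<inter> space M | i j B. i \<le> n \<and> j \<le> m \<and> B \<in> sets borel}"
  then obtain i j B where A: "A = \<xi> i j -` B \<inter> space M" "i \<le> n" "j \<le> m" "B \<in> sets borel" by blast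
  then have "f -` A \<inter> space N = (\<lambda>x. \<xi> i j (f x)) -` B \<inter> space N" using assms(1) by auto
  then show "f -` A \<inter> space N \<in> sets N" using assms(2)[OF A(2,3)] A(4) by (simp add: measurable_sets)
qed (use assms in auto)

definition sample :: "(int \<Rightarrow> int \<Rightarrow> 'a \<Rightarrow> real) \<Rightarrow> 'a \<Rightarrow> int \<times> int \<Rightarrow> real" where
  "sample \<xi> \<omega> = (\<lambda>(i, j). \<xi> i j \<omega>)"

definition shift :: "int \<Rightarrow> int \<Rightarrow> (int \<times> int \<Rightarrow> real) \<Rightarrow> (int \<times> int \<Rightarrow> real)" where
  "shift a b x = (\<lambda>(i, j). x (i + a, j + b))"

definition coord :: "int \<Rightarrow> int \<Rightarrow> (int \<times> int \<Rightarrow> real) \<Rightarrow> real" where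
  "coord i j x = x (i, j)"

lemma measurable_into_field_space:
  assumes "\<And>z. (\<lambda>x. f x z) \<in> borel_measurable N"
  shows "f \<in> N \<rightarrow>\<^sub>M field_space"
  using measurable_PiM_single'[of UNIV "\<lambda>z x. f x z" N "\<lambda>_. borel"] assms by (auto simp: PiE_UNIV_domain)

lemma measurable_sample: "random_field M \<xi> \<Longrightarrow> sample \<xi> \<in> M \<rightarrow>\<^sub>M field_space"
  unfolding random_field_def sample_def by (intro measurable_into_field_space) auto

lemma field_law_sample: "field_law M \<xi> = distr M field_space (sample \<xi>)"
  unfolding field_law_def sample_def ..

lemma space_field_law: "space (field_law M \<xi>) = UNIV"
  unfolding field_law_def by (simp add: space_PiM PiE_UNIV_domain)

lemma sets_field_law [measurable_cong]: "sets (field_law M \<xi>) = sets field_space"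
  unfolding field_law_def by simp

lemma measurable_coord: "coord i j \<in> borel_measurable field_space"
  unfolding coord_def by (rule measurable_component_singleton) simp

lemma random_field_coord: "random_field (field_law M \<xi>) coord"
  unfolding random_field_def using measurable_coord by (simp add: measurable_cong_sets[OF sets_field_law refl])

lemma measurable_shift: "shift a b \<in> field_space \<rightarrow>\<^sub>M field_space"
proof (rule measurable_into_field_space)
  fix z :: "int \<times> int"
  have "(\<lambda>x. shift a b x z) = coord (fst z + a) (snd z + b)"
    unfolding shift_def coord_def by (simp add: case_prod_beta fun_eq_iff)
  then show "(\<lambda>x. shift a b x z) \<in> borel_measurable field_space" using measurable_coord by simp
qed

text \<open>The past of the field is pulled back from the past of the coordinates, because preimages commute with generating a \<sigma>-algebra.\<close>

lemma past_algebra_sample: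
  assumes rf: "random_field M \<xi>" and A: "A \<in> sets (past_algebra M \<xi> n m)"
  shows "\<exists>B\<in>sets (past_algebra (field_law M \<xi>) coord n m). A = sample \<xi> -` B \<inter> space M"
proof -
  let ?g = "{coord i j -` B \<inter> space (field_law M \<xi>) | i j B. i \<le> n \<and> j \<le> m \<and> B \<in> sets borel}"
  have "{sample \<xi> -` A \<inter> space M |A. A \<in> sigma_sets UNIV ?g} = sigma_sets (space M) {sample \<xi> -` A \<inter> space M |A. A \<in> ?g}"
    by (rule sigma_sets_vimage_commute) simp
  also have "{sample \<xi> -` A \<inter> space M |A. A \<in> ?g} = {\<xi> i j -` B \<inter> space M | i j B. i \<le> n \<and> j \<le> m \<and> B \<in> sets borel}"
  proof -
    have e: "sample \<xi> -` (coord i j -` B \<inter> space (field_law M \<xi>)) \<inter> space M = \<xi> i j -` B \<inter> space M" for i j B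
      unfolding sample_def coord_def space_field_law by auto
    show ?thesis
    proof (intro set_eqI iffI)
      fix A assume "A \<in> {sample \<xi> -` A \<inter> space M |A. A \<in> ?g}"
      then obtain i j B where "A = sample \<xi> -` (coord i j -` B \<inter> space (field_law M \<xi>)) \<inter> space M" "i \<le> n" "j \<le> m" "B \<in> sets borel" by blast
      then show "A \<in> {\<xi> i j -` B \<inter> space M | i j B. i \<le> n \<and> j \<le> m \<and> B \<in> sets borel}" unfolding e by blast
    next
      fix A assume "A \<in> {\<xi> i j -` B \<inter> space M | i j B. i \<le> n \<and> j \<le> m \<and> B \<in> sets borel}"
      then obtain i j B where "A = \<xi> i j -` B \<inter> space M" "i \<le> n" "j \<le> m" "B \<in> sets borel" by blast
      then show "A \<in> {sample \<xi> -` A \<inter> space M |A. A \<in> ?g}" unfolding e[symmetric] by blast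
    qed
  qed
  finally have "sets (past_algebra M \<xi> n m) = {sample \<xi> -` A \<inter> space M |A. A \<in> sets (past_algebra (field_law M \<xi>) coord n m)}"
    unfolding sets_past_algebra space_field_law by simp
  then show ?thesis using A by blast
qed

lemma cond_exp_sample:
  assumes M: "prob_space M" and rf: "random_field M \<xi>" and y: "integrable (field_law M \<xi>) y"
  shows "AE \<omega> in M. real_cond_exp M (past_algebra M \<xi> n m) (\<lambda>\<omega>. y (sample \<xi> \<omega>)) \<omega>
    = real_cond_exp (field_law M \<xi>) (past_algebra (field_law M \<xi>) coord n m) y (sample \<xi> \<omega>)"
  unfolding field_law_sample
proof (rule prob_space.cond_exp_comp[OF M measurable_sample[OF rf]])
  show "sample \<xi> \<in> past_algebra M \<xi> n m \<rightarrow>\<^sub>M past_algebra (distr M field_space (sample \<xi>)) coord n m"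
  proof (rule measurable_into_past_algebra)
    show "(\<lambda>x. coord i j (sample \<xi> x)) \<in> borel_measurable (past_algebra M \<xi> n m)" if "i \<le> n" "j \<le> m" for i j
      using past_algebra_coordinate[OF that, of \<xi> M] unfolding coord_def sample_def by simp
  qed (simp add: space_PiM PiE_UNIV_domain)
  show "\<exists>B\<in>sets (past_algebra (distr M field_space (sample \<xi>)) coord n m). A = sample \<xi> -` B \<inter> space M"
    if "A \<in> sets (past_algebra M \<xi> n m)" for A
    using past_algebra_sample[OF rf that] unfolding field_law_sample .
qed (use rf y random_field_coord[of M \<xi>] in \<open>auto simp: field_law_sample[symmetric] intro: subalgebra_past_algebra\<close>)

lemma commuting_shifts_field_law:
  assumes M: "prob_space M" and rf: "random_field M \<xi>" and st: "stationary_field M \<xi>"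
    and co: "commuting M (past_algebra M \<xi>)"
  shows "commuting_shifts (field_law M \<xi>) shift (past_algebra (field_law M \<xi>) coord)"
proof -
  let ?P = "field_law M \<xi>" and ?F = "past_algebra (field_law M \<xi>) coord"
  interpret M: prob_space M by (rule M)
  note sm = measurable_sample[OF rf]
  interpret P: prob_space ?P unfolding field_law_sample by (rule M.prob_space_distr[OF sm])
  have shP: "shift a b \<in> ?P \<rightarrow>\<^sub>M ?P" for a b
    using measurable_shift by (simp add: measurable_cong_sets[OF sets_field_law sets_field_law])
  show ?thesis
  proof unfold_locales
    fix a b
    show "shift a b \<in> ?P \<rightarrow>\<^sub>M ?P" by (rule shP)
    have "distr ?P ?P (shift a b) = distr ?P field_space (shift a b)"
      by (rule distr_cong) (simp_all add: sets_field_law)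
    also have "\<dots> = distr M field_space (shift a b \<circ> sample \<xi>)"
      unfolding field_law_sample by (rule distr_distr[OF measurable_shift sm])
    also have "shift a b \<circ> sample \<xi> = sample (\<lambda>i j. \<xi> (i + a) (j + b))"
      unfolding shift_def sample_def by (auto simp: fun_eq_iff)
    also have "distr M field_space (sample (\<lambda>i j. \<xi> (i + a) (j + b))) = ?P"
      using st unfolding stationary_field_def field_law_sample by blast
    finally show "distr ?P ?P (shift a b) = ?P" .
    show "subalgebra ?P (?F a b)" by (rule subalgebra_past_algebra[OF random_field_coord])
  next
    fix a b c d x show "shift a b (shift c d x) = shift (a + c) (b + d) x"
      unfolding shift_def by (auto simp: fun_eq_iff add_ac)
  next
    fix x show "shift 0 0 x = x" unfolding shift_def by auto
  next
    fix a b c d :: int assume "a \<le> c" "b \<le> d"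
    then show "sets (?F a b) \<subseteq> sets (?F c d)" by (rule past_algebra_mono)
  next
    fix a b c d
    show "shift a b \<in> ?F (c + a) (d + b) \<rightarrow>\<^sub>M ?F c d"
    proof (rule measurable_into_past_algebra)
      fix i j assume "i \<le> c" "j \<le> d"
      then have "coord (i + a) (j + b) \<in> borel_measurable (?F (c + a) (d + b))"
        by (intro past_algebra_coordinate) auto
      then show "(\<lambda>x. coord i j (shift a b x)) \<in> borel_measurable (?F (c + a) (d + b))"
        unfolding coord_def shift_def by simp
    qed (simp add: space_field_law)
  next
    fix a b u v and Y :: "(int \<times> int \<Rightarrow> real) \<Rightarrow> real" assume ua: "(u::int) \<le> a" and Y: "integrable ?P Y"
    let ?E = "\<lambda>a b. real_cond_exp ?P (?F a b)" and ?G = "\<lambda>a b. real_cond_exp M (past_algebra M \<xi> a b)"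
    have sfP: "sigma_finite_subalgebra ?P (?F c d)" for c d
      by (rule P.sigma_finite_subalgebraI[OF subalgebra_past_algebra[OF random_field_coord]])
    have sfM: "sigma_finite_subalgebra M (past_algebra M \<xi> c d)" for c d
      by (rule M.sigma_finite_subalgebraI[OF subalgebra_past_algebra[OF rf]])
    have EY: "integrable ?P (?E c d Y)" for c d
      by (rule sigma_finite_subalgebra.real_cond_exp_int(1)[OF sfP Y])
    have YM: "integrable M (\<lambda>\<omega>. Y (sample \<xi> \<omega>))"
      using Y unfolding field_law_sample by (rule integrable_distr[OF sm])
    have EYM: "(\<lambda>\<omega>. ?E c d Y (sample \<xi> \<omega>)) \<in> borel_measurable M" for c d
      using EY[of c d] unfolding field_law_sample by (rule borel_measurable_integrable[OF integrable_distr[OF sm]])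
    have "AE \<omega> in M. ?G u v (?G a b (\<lambda>\<omega>. Y (sample \<xi> \<omega>))) \<omega> = ?G u (min b v) (\<lambda>\<omega>. Y (sample \<xi> \<omega>)) \<omega>"
      using co ua YM unfolding commuting_def by blast
    moreover have "AE \<omega> in M. ?G u v (?G a b (\<lambda>\<omega>. Y (sample \<xi> \<omega>))) \<omega> = ?G u v (\<lambda>\<omega>. ?E a b Y (sample \<xi> \<omega>)) \<omega>"
      by (rule sigma_finite_subalgebra.real_cond_exp_cong[OF sfM cond_exp_sample[OF M rf Y] _ EYM]) simp
    moreover note cond_exp_sample[OF M rf EY[of a b], of u v] cond_exp_sample[OF M rf Y, of u "min b v"]
    ultimately have "AE \<omega> in M. ?E u v (?E a b Y) (sample \<xi> \<omega>) = ?E u (min b v) Y (sample \<xi> \<omega>)"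
      by eventually_elim simp
    moreover have "{x \<in> space field_space. ?E u v (?E a b Y) x = ?E u (min b v) Y x} \<in> sets field_space"
    proof -
      have "?E c d Z \<in> borel_measurable field_space" for c d Z
        using borel_measurable_cond_exp2[of ?P "?F c d" Z] by (simp add: measurable_cong_sets[OF sets_field_law refl])
      then show ?thesis by measurable
    qed
    ultimately show "AE x in ?P. ?E u v (?E a b Y) x = ?E u (min b v) Y x"
      by (subst (1) field_law_sample) (subst AE_distr_iff[OF sm]; simp)
  qed
qed

section \<open>Convergence in distribution through characteristic functions\<close>

text \<open>A reduction to the continuity theorem for sequences. If distribution functions failed to converge along the product filter, there would be a sequence
of rectangles growing in both directions along which they stay away from the limit.\<close>

lemma conv_in_distr_char:
  fixes \<mu> :: "nat \<times> nat \<Rightarrow> real measure"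
  assumes \<mu>: "\<And>z. real_distribution (\<mu> z)" and \<nu>: "real_distribution \<nu>"
    and ch: "\<And>t. ((\<lambda>z. char (\<mu> z) t) \<longlongrightarrow> char \<nu> t) (sequentially \<times>\<^sub>F sequentially)"
  shows "conv_in_distr \<mu> \<nu> (sequentially \<times>\<^sub>F sequentially)"
  unfolding conv_in_distr_def
proof (intro allI impI tendstoI, rule ccontr)
  fix x e :: real
  assume x: "isCont (cdf \<nu>) x" and e: "0 < e"
    and ne: "\<not> eventually (\<lambda>z. dist (cdf (\<mu> z) x) (cdf \<nu> x) < e) (sequentially \<times>\<^sub>F sequentially)"
  have "\<exists>z. N \<le> fst z \<and> N \<le> snd z \<and> \<not> dist (cdf (\<mu> z) x) (cdf \<nu> x) < e" for N
    using ne unfolding eventually_prod_sequentially by force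
  then obtain z where z: "\<And>N::nat. N \<le> fst (z N)" "\<And>N. N \<le> snd (z N)"
    and far: "\<And>N. \<not> dist (cdf (\<mu> (z N)) x) (cdf \<nu> x) < e" by metis
  have "filterlim z (sequentially \<times>\<^sub>F sequentially) sequentially"
    unfolding filterlim_iff
  proof (intro allI impI)
    fix Q assume "eventually Q (sequentially \<times>\<^sub>F sequentially)"
    then obtain N where N: "\<And>n m. N \<le> n \<Longrightarrow> N \<le> m \<Longrightarrow> Q (m, n)" unfolding eventually_prod_sequentially by blast
    have "Q (z k)" if "N \<le> k" for k
      using N[of "snd (z k)" "fst (z k)"] z[of k] that by simp
    then show "eventually (\<lambda>k. Q (z k)) sequentially" unfolding eventually_sequentially by blast
  qed
  then have "(\<lambda>k. char (\<mu> (z k)) t) \<longlonglongrightarrow> char \<nu> t" for t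
    by (rule filterlim_compose[OF ch])
  then have "weak_conv_m (\<lambda>k. \<mu> (z k)) \<nu>" by (rule levy_continuity[OF \<mu> \<nu>])
  then have "(\<lambda>k. cdf (\<mu> (z k)) x) \<longlonglongrightarrow> cdf \<nu> x" using x unfolding weak_conv_m_def weak_conv_def by blast
  then have "eventually (\<lambda>k. dist (cdf (\<mu> (z k)) x) (cdf \<nu> x) < e) sequentially" using e by (rule tendstoD)
  then show False using far unfolding eventually_sequentially by blast
qed

lemma char_distr:
  assumes M: "prob_space M" and W: "W \<in> borel_measurable M"
  shows "char (distr M borel W) t =
    complex_of_real (\<integral>x. cos (t * W x + 0) \<partial>M) + \<i> * complex_of_real (\<integral>x. cos (t * W x + - (pi / 2)) \<partial>M)"
proof -
  interpret prob_space M by (rule M)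
  have "char (distr M borel W) t = (CLINT x|M. iexp (t * W x))"
    unfolding char_def by (rule integral_distr[OF W]) simp
  also have "\<dots> = (CLINT x|M. complex_of_real (cos (t * W x + 0)) + \<i> * complex_of_real (cos (t * W x + - (pi / 2))))"
    by (rule Bochner_Integration.integral_cong) (simp_all add: complex_eq_iff cos_diff Re_exp Im_exp)
  also have "\<dots> = (CLINT x|M. complex_of_real (cos (t * W x + 0))) + (CLINT x|M. \<i> * complex_of_real (cos (t * W x + - (pi / 2))))"
    using W by (intro Bochner_Integration.integral_add integrable_mult_right integrable_of_real integrable_const_bound[of _ 1]) auto
  finally show ?thesis by simp
qed

lemma real_distribution_normal_law: "0 \<le> c \<Longrightarrow> real_distribution (normal_law 0 (c\<^sup>2))"
  unfolding normal_law_def real_distribution_def real_distribution_axioms_def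
  by (auto intro: prob_space_normal_density prob_space_return)

lemma char_normal_law:
  assumes c: "0 \<le> c" shows "char (normal_law 0 (c\<^sup>2)) t = complex_of_real (exp (- (t\<^sup>2 * c\<^sup>2 / 2)))"
proof (cases "c = 0")
  case True
  then show ?thesis unfolding normal_law_def char_def by (simp add: integral_return)
next
  case False
  then have c: "0 < c" using c by simp
  define N where "N = density lborel (\<lambda>x. ennreal (normal_density 0 c x))"
  interpret N: prob_space N unfolding N_def using c by (rule prob_space_normal_density)
  have NL: "normal_law 0 (c\<^sup>2) = N" unfolding normal_law_def N_def using c by simp
  have "distributed N lborel (\<lambda>x. x) (normal_density 0 c)"
    unfolding distributed_def N_def by (auto simp: distr_id2)
  then have "distributed N lborel (\<lambda>x. x / c) std_normal_density"
    using N.normal_standard_normal_convert[OF c, of "\<lambda>x. x" 0] by simp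
  then have d: "distr N lborel (\<lambda>x. x / c) = std_normal_distribution" unfolding distributed_def by simp
  have "char N t = (CLINT x|N. iexp (t * c * (x / c)))" unfolding char_def using c by simp
  also have "\<dots> = (CLINT x|distr N lborel (\<lambda>x. x / c). iexp (t * c * x))"
    by (rule integral_distr[symmetric]) (simp_all add: N_def)
  also have "\<dots> = char std_normal_distribution (t * c)" unfolding d char_def ..
  also have "\<dots> = complex_of_real (exp (- (t\<^sup>2 * c\<^sup>2 / 2)))"
    unfolding char_std_normal_distribution by (simp add: power_mult_distrib)
  finally show ?thesis unfolding NL .
qed

section \<open>The central limit theorem under the Maxwell-Woodroofe condition\<close>

text \<open>A sum over an infinite index set in \<open>ennreal\<close> is the supremum of its finite partial sums.\<close>

lemma sum_le_nonneg_infsum_ennreal: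
  fixes g :: "'b \<Rightarrow> ennreal"
  assumes "finite A" "A \<subseteq> B" shows "sum g A \<le> infsum g B"
  unfolding nonneg_infsum_complete[of B g, OF zero_le] using assms by (intro SUP_upper) auto

lemma powr_three_halves: "0 < x \<Longrightarrow> x powr (3 / 2) = x * sqrt x" for x :: real
  using powr_add[of x 1 "1 / 2"] by (simp add: powr_half_sqrt)

theorem theorem1:
  fixes M :: "'a measure"
    and \<xi> :: "int \<Rightarrow> int \<Rightarrow> 'a \<Rightarrow> real"
    and f :: "(nat \<times> nat \<Rightarrow> real) \<Rightarrow> real"
  defines "X \<equiv> causal_field f \<xi>"
    and "G \<equiv> past_algebra M \<xi>"
    and "S \<equiv> partial_sum (causal_field f \<xi>)"
  assumes "prob_space M"
    and "random_field M \<xi>"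
    and "stationary_field M \<xi>"
    and "f \<in> borel_measurable (Pi\<^sub>M UNIV (\<lambda>_. borel))"
    and "integrable M (X 0 0)"
    and "commuting M G"
    and "(\<Sum>\<^sub>\<infinity>(j, k)\<in>{1..}\<times>{1..}.
            ennreal (1 / (real j powr (3/2) * real k powr (3/2)))
              * L2_norm M (real_cond_exp M (G 1 1) (S j k))) < \<infinity>"
    and "ergodic (field_law M \<xi>) vertical_shift"
  shows "\<exists>c::real.
      ((\<lambda>(n1, n2). 1 / (real n1 * real n2) * (\<integral>\<omega>. (S n1 n2 \<omega>)\<^sup>2 \<partial>M)) \<longlongrightarrow> c\<^sup>2)
        (sequentially \<times>\<^sub>F sequentially)
    \<and> conv_in_distr
        (\<lambda>(n1, n2). distr M borel (\<lambda>\<omega>. 1 / sqrt (real n1 * real n2) * S n1 n2 \<omega>))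
        (normal_law 0 (c\<^sup>2)) (sequentially \<times>\<^sub>F sequentially)"
proof -
  interpret M: prob_space M by (rule assms(4))
  note rf = assms(5)
  define P where "P = field_law M \<xi>"
  define F where "F = past_algebra P coord"
  interpret C: commuting_shifts P shift F
    unfolding P_def F_def by (rule commuting_shifts_field_law) (use assms in \<open>simp_all add: G_def\<close>)
  note sm = measurable_sample[OF rf]
  have PL: "P = distr M field_space (sample \<xi>)" unfolding P_def by (rule field_law_sample)
  have meas_P: "g \<in> borel_measurable P \<longleftrightarrow> g \<in> borel_measurable field_space" for g :: "(int \<times> int \<Rightarrow> real) \<Rightarrow> real"
    unfolding P_def by (simp add: measurable_cong_sets[OF sets_field_law refl])
  have tr: "(\<integral>\<omega>. g (sample \<xi> \<omega>) \<partial>M) = (\<integral>x. g x \<partial>P)" if "g \<in> borel_measurable P" for g :: "(int \<times> int \<Rightarrow> real) \<Rightarrow> real"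
    using integral_distr[OF sm, of g] that unfolding PL by simp
  have itr: "integrable M (\<lambda>\<omega>. g (sample \<xi> \<omega>)) \<longleftrightarrow> integrable P g" if "g \<in> borel_measurable P" for g :: "(int \<times> int \<Rightarrow> real) \<Rightarrow> real"
    using integrable_distr_eq[OF sm, of g] that unfolding PL by simp
  \<comment> \<open>\<open>X_{0,0}\<close> as a function of the realization\<close>
  define h where "h x = f (\<lambda>(i, j). x (- int i, - int j))" for x :: "int \<times> int \<Rightarrow> real"
  have hF: "h \<in> borel_measurable (F 0 0)"
  proof -
    have "(\<lambda>x z. x (- int (fst z), - int (snd z))) \<in> F 0 0 \<rightarrow>\<^sub>M Pi\<^sub>M UNIV (\<lambda>_::nat \<times> nat. borel)"
    proof (rule measurable_PiM_single')
      show "(\<lambda>x. x (- int (fst z), - int (snd z))) \<in> borel_measurable (F 0 0)" for z :: "nat \<times> nat"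
        using past_algebra_coordinate[of "- int (fst z)" 0 "- int (snd z)" 0 coord P] unfolding F_def coord_def by simp
    qed (simp add: PiE_UNIV_domain)
    from measurable_compose[OF this assms(7)] show ?thesis
      unfolding h_def by (simp add: case_prod_unfold)
  qed
  have hP: "h \<in> borel_measurable P" by (rule measurable_from_subalg[OF C.sub_F hF])
  have XS: "causal_field f \<xi> u v \<omega> = C.sh u v h (sample \<xi> \<omega>)" for u v \<omega>
    unfolding causal_field_def C.sh_def h_def shift_def sample_def by (simp add: case_prod_unfold add.commute)
  have SSS: "S n m \<omega> = C.box_sum n m h (sample \<xi> \<omega>)" for n m \<omega>
    unfolding S_def partial_sum_def C.box_sum_def XS ..
  have hint: "integrable P h"
    using assms(8) itr[OF hP] unfolding X_def XS C.sh_zero by simp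
  have SSint: "integrable P (C.box_sum n m h)" for n m
    unfolding C.box_sum_def by (intro Bochner_Integration.integrable_sum C.integrable_sh hint)
  define T where "T = (\<Sum>\<^sub>\<infinity>(j, k)\<in>{1..}\<times>{1..}.
            ennreal (1 / (real j powr (3/2) * real k powr (3/2)))
              * L2_norm M (real_cond_exp M (G 1 1) (S j k)))"
  have Tfin: "T < \<infinity>" using assms(10) unfolding T_def .
  have le_T: "(\<Sum>(j, k)\<in>A. ennreal (1 / (real j powr (3/2) * real k powr (3/2))) * L2_norm M (real_cond_exp M (G 1 1) (S j k))) \<le> T"
    if "finite A" "A \<subseteq> {1..} \<times> {1..}" for A
    unfolding T_def by (rule sum_le_nonneg_infsum_ennreal[OF that])
  have Etr: "AE \<omega> in M. real_cond_exp M (G 1 1) (S j k) \<omega> = C.E 1 1 (C.box_sum j k h) (sample \<xi> \<omega>)" for j k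
    using cond_exp_sample[OF assms(4) rf, of "C.box_sum j k h" 1 1] SSint[of j k]
    unfolding G_def F_def P_def[symmetric] SSS[symmetric, abs_def] by simp
  have EP: "C.E 1 1 g \<in> borel_measurable P" for g by simp
  have EM: "(\<lambda>\<omega>. C.E 1 1 g (sample \<xi> \<omega>)) \<in> borel_measurable M" for g
    using measurable_compose[OF sm] EP[of g] unfolding meas_P by blast
  have sq_tr: "integrable M (\<lambda>\<omega>. (real_cond_exp M (G 1 1) (S j k) \<omega>)\<^sup>2) \<longleftrightarrow> integrable P (\<lambda>x. (C.E 1 1 (C.box_sum j k h) x)\<^sup>2)"
    "(\<integral>\<omega>. (real_cond_exp M (G 1 1) (S j k) \<omega>)\<^sup>2 \<partial>M) = (\<integral>x. (C.E 1 1 (C.box_sum j k h) x)\<^sup>2 \<partial>P)" for j k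
  proof -
    have m: "(\<lambda>\<omega>. (C.E 1 1 (C.box_sum j k h) (sample \<xi> \<omega>))\<^sup>2) \<in> borel_measurable M"
      "(\<lambda>\<omega>. (real_cond_exp M (G 1 1) (S j k) \<omega>)\<^sup>2) \<in> borel_measurable M"
      using EM by auto
    have a: "AE \<omega> in M. (real_cond_exp M (G 1 1) (S j k) \<omega>)\<^sup>2 = (C.E 1 1 (C.box_sum j k h) (sample \<xi> \<omega>))\<^sup>2"
      using Etr[of j k] by eventually_elim simp
    have mP: "(\<lambda>x. (C.E 1 1 (C.box_sum j k h) x)\<^sup>2) \<in> borel_measurable P" by simp
    show "integrable M (\<lambda>\<omega>. (real_cond_exp M (G 1 1) (S j k) \<omega>)\<^sup>2) \<longleftrightarrow> integrable P (\<lambda>x. (C.E 1 1 (C.box_sum j k h) x)\<^sup>2)"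
      unfolding itr[OF mP, symmetric] by (rule integrable_cong_AE[OF m(2,1) a])
    show "(\<integral>\<omega>. (real_cond_exp M (G 1 1) (S j k) \<omega>)\<^sup>2 \<partial>M) = (\<integral>x. (C.E 1 1 (C.box_sum j k h) x)\<^sup>2 \<partial>P)"
      unfolding tr[OF mP, symmetric] by (rule integral_cong_AE[OF m(2,1) a])
  qed
  have h_sq: "sq_integrable P h"
  proof -
    have "L2_norm M (real_cond_exp M (G 1 1) (S 1 1)) \<le> T"
      using le_T[of "{(1, 1)}"] by simp
    then have "L2_norm M (real_cond_exp M (G 1 1) (S 1 1)) \<noteq> \<infinity>" using Tfin by (metis leD)
    then have "integrable P (\<lambda>x. (C.E 1 1 (C.box_sum 1 1 h) x)\<^sup>2)"
      unfolding sq_tr(1)[symmetric] L2_norm_def by (metis (full_types))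
    then have "sq_integrable P (C.E 1 1 (C.box_sum 1 1 h))" unfolding sq_integrable_def by simp
    moreover have "AE x in P. C.E 1 1 (C.box_sum 1 1 h) x = C.sh 1 1 h x"
    proof -
      have "C.box_sum 1 1 h = C.sh 1 1 h" unfolding C.box_sum_def by (simp add: fun_eq_iff)
      moreover have "AE x in P. C.E 1 1 (C.sh 1 1 h) x = C.sh 1 1 h x"
        using C.sh_F[OF hF, of 1 1] by (intro C.E_F_meas C.integrable_sh hint) simp
      ultimately show ?thesis by simp
    qed
    ultimately have "sq_integrable P (C.sh 1 1 h)"
      by (rule sq_integrable_cong_AE[OF _ C.measurable_sh[OF hP]])
    from C.sq_integrable_sh[OF this, of "- 1" "- 1"] show ?thesis by (simp add: C.sh_sh C.sh_zero)
  qed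
  have norm: "L2_norm M (real_cond_exp M (G 1 1) (S j k)) = ennreal (l2n P (C.E 1 1 (C.box_sum j k h)))" for j k
    using C.E_sq[OF C.box_sum_sq[OF h_sq], of 1 1 j k]
    unfolding L2_norm_def sq_tr l2n_def sq_integrable_def by simp
  have bd: "(\<Sum>j=1..J. \<Sum>k=1..K. l2n P (C.E 1 1 (C.box_sum j k h)) / ((j * sqrt j) * (k * sqrt k))) \<le> enn2real T" for J K :: nat
  proof -
    define \<phi> where "\<phi> z = l2n P (C.E 1 1 (C.box_sum (fst z) (snd z) h)) / ((fst z * sqrt (fst z)) * (snd z * sqrt (snd z)))" for z :: "nat \<times> nat"
    have "ennreal (\<Sum>z\<in>{1..J} \<times> {1..K}. \<phi> z) = (\<Sum>z\<in>{1..J} \<times> {1..K}. ennreal (\<phi> z))"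
      by (rule sum_ennreal[symmetric]) (simp add: \<phi>_def)
    also have "\<dots> = (\<Sum>(j, k)\<in>{1..J} \<times> {1..K}. ennreal (1 / (real j powr (3/2) * real k powr (3/2))) * L2_norm M (real_cond_exp M (G 1 1) (S j k)))"
    proof (intro sum.cong refl)
      fix z assume "z \<in> {1..J} \<times> {1..K}"
      then obtain j k where z: "z = (j, k)" and jk: "1 \<le> j" "1 \<le> k" by auto
      have "ennreal (\<phi> (j, k)) = ennreal (1 / (real j powr (3/2) * real k powr (3/2))) * ennreal (l2n P (C.E 1 1 (C.box_sum j k h)))"
        unfolding \<phi>_def using jk by (subst ennreal_mult[symmetric]) (simp_all add: powr_three_halves)
      then show "ennreal (\<phi> z) = (case z of (j, k) \<Rightarrow> ennreal (1 / (real j powr (3/2) * real k powr (3/2))) * L2_norm M (real_cond_exp M (G 1 1) (S j k)))"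
        unfolding z norm by simp
    qed
    also have "\<dots> \<le> T" by (rule le_T) auto
    finally have "enn2real (ennreal (\<Sum>z\<in>{1..J} \<times> {1..K}. \<phi> z)) \<le> enn2real T" using Tfin by (intro enn2real_mono) auto
    moreover have "0 \<le> (\<Sum>z\<in>{1..J} \<times> {1..K}. \<phi> z)" by (intro sum_nonneg) (simp add: \<phi>_def)
    moreover have "(\<Sum>z\<in>{1..J} \<times> {1..K}. \<phi> z) = (\<Sum>j=1..J. \<Sum>k=1..K. l2n P (C.E 1 1 (C.box_sum j k h)) / ((j * sqrt j) * (k * sqrt k)))"
      unfolding \<phi>_def by (simp add: sum.cartesian_product case_prod_beta)
    ultimately show ?thesis by simp
  qed
  have erg: "ergodic P (shift 1 0)"
  proof -
    have "vertical_shift = shift 1 0" unfolding vertical_shift_def shift_def by (simp add: fun_eq_iff)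
    then show ?thesis using assms(11) unfolding P_def by simp
  qed
  obtain c where c: "0 \<le> c"
    and c1: "((\<lambda>(n, m). l2n P (C.box_sum n m h) / (sqrt n * sqrt m)) \<longlongrightarrow> c) (sequentially \<times>\<^sub>F sequentially)"
    and c2: "\<And>t p. ((\<lambda>(n, m). \<integral>x. cos (t / (sqrt n * sqrt m) * C.box_sum n m h x + p) \<partial>P) \<longlongrightarrow> exp (- (t\<^sup>2 * c\<^sup>2 / 2)) * cos p)
      (sequentially \<times>\<^sub>F sequentially)"
    using C.field_clt[OF erg h_sq hF C.dyad_sums_bounded[OF h_sq bd]] by blast
  have SSm: "C.box_sum n m h \<in> borel_measurable P" for n m by (rule borel_measurable_integrable[OF SSint])
  have Sm: "S n m \<in> borel_measurable M" for n m
    using measurable_compose[OF sm] SSm[of n m] unfolding meas_P SSS[abs_def] by blast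
  have "((\<lambda>(n1, n2). 1 / (real n1 * real n2) * (\<integral>\<omega>. (S n1 n2 \<omega>)\<^sup>2 \<partial>M)) \<longlongrightarrow> c\<^sup>2) (sequentially \<times>\<^sub>F sequentially)"
  proof -
    have "(\<integral>\<omega>. (S n m \<omega>)\<^sup>2 \<partial>M) = (l2n P (C.box_sum n m h))\<^sup>2" for n m
      unfolding l2n_sq SSS using SSm by (intro tr) auto
    then have "(\<lambda>(n1, n2). 1 / (real n1 * real n2) * (\<integral>\<omega>. (S n1 n2 \<omega>)\<^sup>2 \<partial>M)) = (\<lambda>z. (case z of (n, m) \<Rightarrow> l2n P (C.box_sum n m h) / (sqrt n * sqrt m))\<^sup>2)"
      by (auto simp: fun_eq_iff power_divide power_mult_distrib)
    then show ?thesis using tendsto_power[OF c1, of 2] by simp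
  qed
  moreover have "conv_in_distr
        (\<lambda>(n1, n2). distr M borel (\<lambda>\<omega>. 1 / sqrt (real n1 * real n2) * S n1 n2 \<omega>))
        (normal_law 0 (c\<^sup>2)) (sequentially \<times>\<^sub>F sequentially)"
  proof (rule conv_in_distr_char)
    define W where "W z \<omega> = 1 / sqrt (real (fst z) * real (snd z)) * S (fst z) (snd z) \<omega>" for z \<omega>
    have Wm: "W z \<in> borel_measurable M" for z unfolding W_def using Sm by measurable
    have e: "(case z of (n1, n2) \<Rightarrow> distr M borel (\<lambda>\<omega>. 1 / sqrt (real n1 * real n2) * S n1 n2 \<omega>)) = distr M borel (W z)" for z
      unfolding W_def[abs_def] by (simp add: case_prod_beta)
    show "real_distribution (case z of (n1, n2) \<Rightarrow> distr M borel (\<lambda>\<omega>. 1 / sqrt (real n1 * real n2) * S n1 n2 \<omega>))" for z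
      unfolding e real_distribution_def real_distribution_axioms_def using M.prob_space_distr[OF Wm] by simp
    show "real_distribution (normal_law 0 (c\<^sup>2))" by (rule real_distribution_normal_law[OF c])
    fix t
    have lim: "((\<lambda>z. \<integral>\<omega>. cos (t * W z \<omega> + p) \<partial>M) \<longlongrightarrow> exp (- (t\<^sup>2 * c\<^sup>2 / 2)) * cos p) (sequentially \<times>\<^sub>F sequentially)" for p
    proof -
      have "(\<integral>\<omega>. cos (t * W z \<omega> + p) \<partial>M) = (case z of (n, m) \<Rightarrow> \<integral>x. cos (t / (sqrt n * sqrt m) * C.box_sum n m h x + p) \<partial>P)" for z
      proof -
        have "(\<integral>\<omega>. cos (t * W z \<omega> + p) \<partial>M) = (\<integral>\<omega>. (\<lambda>x. cos (t / (sqrt (fst z) * sqrt (snd z)) * C.box_sum (fst z) (snd z) h x + p)) (sample \<xi> \<omega>) \<partial>M)"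
          unfolding W_def SSS by (simp add: real_sqrt_mult)
        also have "\<dots> = (\<integral>x. cos (t / (sqrt (fst z) * sqrt (snd z)) * C.box_sum (fst z) (snd z) h x + p) \<partial>P)"
          by (rule tr) (use SSm in measurable)
        finally show ?thesis by (simp add: case_prod_beta)
      qed
      then show ?thesis using c2[of t p] by simp
    qed
    have "((\<lambda>z. complex_of_real (\<integral>\<omega>. cos (t * W z \<omega> + 0) \<partial>M) + \<i> * complex_of_real (\<integral>\<omega>. cos (t * W z \<omega> + - (pi / 2)) \<partial>M)) \<longlongrightarrow>
      complex_of_real (exp (- (t\<^sup>2 * c\<^sup>2 / 2)) * cos 0) + \<i> * complex_of_real (exp (- (t\<^sup>2 * c\<^sup>2 / 2)) * cos (- (pi / 2)))) (sequentially \<times>\<^sub>F sequentially)"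
      by (intro tendsto_intros lim)
    then show "((\<lambda>z. char (case z of (n1, n2) \<Rightarrow> distr M borel (\<lambda>\<omega>. 1 / sqrt (real n1 * real n2) * S n1 n2 \<omega>)) t) \<longlongrightarrow> char (normal_law 0 (c\<^sup>2)) t) (sequentially \<times>\<^sub>F sequentially)"
      unfolding e char_distr[OF assms(4) Wm] char_normal_law[OF c] by simp
  qed
  ultimately show ?thesis by blast
qed

end
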